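(* Let $a<b$, $\tau>0$, and let $W\in C^3(\mathbb{R})$ satisfy $W(\pm1)=W'(\pm1)=0$, $W''(\pm1)>0$ and $W(u)>0$ for $u\neq\pm1$; set $\lambda:=\min\{W''(1),W''(-1)\}$ and $c_0:=\int_{-1}^1\sqrt{2W(s)}\,ds$. Let $v:[a,b]\to\{-1,+1\}$ be piecewise constant with exactly $N$ jumps at $a<h_1<\dots<h_N<b$, and $r>0$ such that the intervals $(h_i-r,h_i+r)$ are pairwise disjoint, $a\le h_1-r$, $h_N+r\le b$; let $A\in(0,r\sqrt{2\lambda})$ and $f:(0,+\infty)\to(0,+\infty)$. For each $\varepsilon>0$ let $u^\varepsilon$, with $(u^\varepsilon,u^\varepsilon_t)\in C([0,T],H^3(a,b)\times H^1(a,b))$ for every $T>0$, solve $$\tau u_{tt}+u_t=(-\varepsilon^2u_{xx}+W'(u))_{xx}$$ on $(a,b)$ with $u_x(a,t)=u_x(b,t)=u_{xxx}(a,t)=u_{xxx}(b,t)=0$ for all $t\ge0$, and initial data $u^\varepsilon(\cdot,0)=u^\varepsilon_0$, $u^\varepsilon_t(\cdot,0)=u^\varepsilon_1$ satisfying $\lim_{\varepsilon\to0}\|u_0^\varepsilon-v\|_{L^1(a,b)}=0$, $\int_a^b u_1^\varepsilon(y)\,dy=0$, and $E_\varepsilon[u_0^\varepsilon,\tilde u_1^\varepsilon]\le Nc_0+1/f(\varepsilon)$ for all sufficiently small $\varepsilon>0$. Let $T_\varepsilon:=\min\{f(\varepsilon),\exp(A/\varepsilon)\}$. Then $$\sup_{0\le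 t\le T_\varepsilon}\|\tilde u^\varepsilon(\cdot,t)-\tilde v\|_{L^1(a,b)}\to0\quad\text{as }\varepsilon\to0,$$ and for every $\eta\in(0,1)$, $$\sup_{0\le t\le \varepsilon^\eta T_\varepsilon}\|u^\varepsilon(\cdot,t)-v\|_{L^1(a,b)}\to0\quad\text{as }\varepsilon\to0.$$
   Context: For $g\in L^1(a,b)$ (possibly depending on $t$), $\tilde g(x):=\int_a^x g(y)\,dy$; $\tilde u^\varepsilon(\cdot,t)$, $\tilde u_1^\varepsilon$, $\tilde v$ denote this primitive of $u^\varepsilon(\cdot,t)$, $u_1^\varepsilon$, $v$. $E_\varepsilon[u,w]:=\frac{\tau}{2\varepsilon}\|w\|_{L^2(a,b)}^2+\int_a^b\left[\frac{\varepsilon}{2}u_x^2+\frac{W(u)}{\varepsilon}\right]dx$. *)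

theory Defs
  imports "HOL-Analysis.Analysis"
begin

definition C3 :: "(real \<Rightarrow> real) \<Rightarrow> bool" where
  "C3 W \<longleftrightarrow> (\<forall>x. W differentiable (at x)) \<and> (\<forall>x. deriv W differentiable (at x))
     \<and> (\<forall>x. deriv (deriv W) differentiable (at x))
     \<and> continuous_on UNIV (deriv (deriv (deriv W)))"

definition L2fun :: "real \<Rightarrow> real \<Rightarrow> (real \<Rightarrow> real) \<Rightarrow> bool" where
  "L2fun a b g \<longleftrightarrow> g measurable_on {a..b} \<and> (\<lambda>x. (g x)^2) integrable_on {a..b}"

definition cc_test :: "real \<Rightarrow> real \<Rightarrow> (real \<Rightarrow> real) \<Rightarrow> bool" where
  "cc_test a b \<phi> \<longleftrightarrow> (\<forall>n x. (deriv ^^ n) \<phi> differentiable (at x))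
     \<and> (\<exists>c d. a < c \<and> d < b \<and> (\<forall>x. x \<notin> {c..d} \<longrightarrow> \<phi> x = 0))"

definition weak_deriv :: "real \<Rightarrow> real \<Rightarrow> (real \<Rightarrow> real) \<Rightarrow> (real \<Rightarrow> real) \<Rightarrow> bool" where
  "weak_deriv a b g h \<longleftrightarrow> (\<forall>\<phi>. cc_test a b \<phi> \<longrightarrow>
     integral {a..b} (\<lambda>x. g x * deriv \<phi> x) = - integral {a..b} (\<lambda>x. h x * \<phi> x))"

definition Hders :: "real \<Rightarrow> real \<Rightarrow> nat \<Rightarrow> (real \<Rightarrow> real) \<Rightarrow> (nat \<Rightarrow> real \<Rightarrow> real) \<Rightarrow> bool" where
  "Hders a b k g D \<longleftrightarrow> D 0 = g \<and> (\<forall>j\<le>k. L2fun a b (D j))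
     \<and> (\<forall>j<k. weak_deriv a b (D j) (D (Suc j)))"

definition in_H :: "real \<Rightarrow> real \<Rightarrow> nat \<Rightarrow> (real \<Rightarrow> real) \<Rightarrow> bool" where
  "in_H a b k g \<longleftrightarrow> (\<exists>D. Hders a b k g D)"

text \<open>H^k(a,b) norm (weak derivatives are unique a.e., so the choice is irrelevant).\<close>
definition Hnorm :: "real \<Rightarrow> real \<Rightarrow> nat \<Rightarrow> (real \<Rightarrow> real) \<Rightarrow> real" where
  "Hnorm a b k g = sqrt (\<Sum>j\<le>k. integral {a..b} (\<lambda>x. ((SOME D. Hders a b k g D) j x)^2))"

definition prim :: "real \<Rightarrow> (real \<Rightarrow> real) \<Rightarrow> real \<Rightarrow> real" where
  "prim a g x = integral {a..x} g"

definition L1dist :: "real \<Rightarrow> real \<Rightarrow> (real \<Rightarrow> real) \<Rightarrow> (real \<Rightarrow> real) \<Rightarrow> real" where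
  "L1dist a b g h = integral {a..b} (\<lambda>x. \<bar>g x - h x\<bar>)"

definition energy :: "real \<Rightarrow> (real \<Rightarrow> real) \<Rightarrow> real \<Rightarrow> real \<Rightarrow> real
    \<Rightarrow> (real \<Rightarrow> real) \<Rightarrow> (real \<Rightarrow> real) \<Rightarrow> (real \<Rightarrow> real) \<Rightarrow> real" where
  "energy tau W a b eps u ux w =
     tau / (2 * eps) * integral {a..b} (\<lambda>x. (w x)^2)
     + integral {a..b} (\<lambda>x. eps / 2 * (ux x)^2 + W (u x) / eps)"

text \<open>C^2 test functions with phi'(a) = phi'(b) = 0 (for the weak form of the equation
  with the natural boundary conditions u_xxx(a)=u_xxx(b)=0).\<close>
definition neumann_test :: "real \<Rightarrow> real \<Rightarrow> (real \<Rightarrow> real) \<Rightarrow> bool" where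
  "neumann_test a b \<phi> \<longleftrightarrow> (\<forall>x. \<phi> differentiable (at x)) \<and> (\<forall>x. deriv \<phi> differentiable (at x))
     \<and> continuous_on UNIV (deriv (deriv \<phi>)) \<and> deriv \<phi> a = 0 \<and> deriv \<phi> b = 0"

text \<open>u (x,t) is a solution of tau u_tt + u_t = (-eps^2 u_xx + W'(u))_xx on (a,b), t \<ge> 0, with
  u_x = u_xxx = 0 at x = a,b, in the class (u,u_t) in C([0,T], H^3 x H^1) for all T;
  ux, uxx, ut are the (pointwise) derivatives u_x, u_xx, u_t.\<close>
definition solution :: "real \<Rightarrow> (real \<Rightarrow> real) \<Rightarrow> real \<Rightarrow> real \<Rightarrow> real
    \<Rightarrow> (real \<Rightarrow> real \<Rightarrow> real) \<Rightarrow> (real \<Rightarrow> real \<Rightarrow> real) \<Rightarrow> (real \<Rightarrow> real \<Rightarrow> real)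
    \<Rightarrow> (real \<Rightarrow> real \<Rightarrow> real) \<Rightarrow> bool" where
  "solution tau W eps a b u ux uxx ut \<longleftrightarrow>
     (\<forall>t\<ge>0. in_H a b 3 (\<lambda>x. u x t) \<and> in_H a b 1 (\<lambda>x. ut x t))
   \<and> (\<forall>t\<ge>0. ((\<lambda>s. Hnorm a b 3 (\<lambda>x. u x s - u x t)) \<longlongrightarrow> 0) (at t within {0..}))
   \<and> (\<forall>t\<ge>0. ((\<lambda>s. Hnorm a b 1 (\<lambda>x. ut x s - ut x t)) \<longlongrightarrow> 0) (at t within {0..}))
   \<and> (\<forall>t\<ge>0. \<forall>x\<in>{a..b}. ((\<lambda>s. u x s) has_real_derivative ut x t) (at t within {0..}))
   \<and> (\<forall>t\<ge>0. \<forall>x\<in>{a..b}. ((\<lambda>y. u y t) has_real_derivative ux x t) (at x within {a..b})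
                      \<and> ((\<lambda>y. ux y t) has_real_derivative uxx x t) (at x within {a..b}))
   \<and> (\<forall>t\<ge>0. ux a t = 0 \<and> ux b t = 0)
   \<and> (\<forall>\<phi>. neumann_test a b \<phi> \<longrightarrow> (\<forall>t\<ge>0.
        ((\<lambda>s. integral {a..b} (\<lambda>x. ut x s * \<phi> x)) has_real_derivative
           (integral {a..b} (\<lambda>x. (- (eps^2) * uxx x t + deriv W (u x t)) * deriv (deriv \<phi>) x)
            - integral {a..b} (\<lambda>x. ut x t * \<phi> x)) / tau) (at t within {0..})))"

definition node :: "real \<Rightarrow> real \<Rightarrow> nat \<Rightarrow> (nat \<Rightarrow> real) \<Rightarrow> nat \<Rightarrow> real" where
  "node a b N h i = (if i = 0 then a else if i = Suc N then b else h i)"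

end

theory Submission
  imports Defs
begin

text \<open>
  The primitive \<open>U\<close> of \<open>u\<close> solves \<open>\<tau> U_tt + U_t = (- \<epsilon>\<^sup>2 u_xx + W'(u))_x\<close>, so the energy decreases at the
  rate \<open>\<parallel>U_t\<parallel>\<^sup>2 / \<epsilon>\<close>. Conversely, every profile whose primitive is \<open>L\<^sup>1\<close>-close to that of \<open>v\<close> has at least
  the energy \<open>N c\<^sub>0 - C exp (- A / \<epsilon>)\<close>: each jump costs \<open>c\<^sub>0\<close> up to an exponentially small gain in the tails of
  the layer, which an explicit calibration bounds. Initially the energy exceeds \<open>N c\<^sub>0\<close> by at most \<open>1 / f \<epsilon>\<close>,
  so that by the Cauchy-Schwarz inequality \<open>U\<close> moves by at most \<open>O(\<surd>\<epsilon>)\<close> up to the time \<open>T\<^sub>\<epsilon>\<close>, and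
  continuity in time shows that it never leaves the neighbourhood where the lower bound applies. The
  statement on \<open>u\<close> follows by interpolating between \<open>U\<close> and \<open>u_x\<close>.

  Since the solution class is given by weak derivatives in \<open>x\<close> and pointwise derivatives in \<open>t\<close>, one first
  needs that \<open>u_xx\<close> and \<open>u_t\<close> are continuous in \<open>x\<close> and depend on \<open>t\<close> continuously, uniformly in \<open>x\<close>.
\<close>

section \<open>Smooth bump functions\<close>

text \<open>The rate comes from the tails of a layer. With tails of length \<open>l\<close> on both
  sides of a jump, the energy saved is of order \<open>exp (- A / \<epsilon>)\<close> once
  \<open>A < 2 * l * sqrt \<lambda>\<close>. The half-width \<open>r\<close> is not fully available
  as a tail: a short piece next to the jump is spent on finding a point where the profile is near
  the correct well. The hypothesis \<open>A < r * sqrt (2 * \<lambda>)\<close> leaves room for this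
  because \<open>sqrt 2 < 2\<close>.

  Two obstacles shape the analytic part. The time derivative is given pointwise in \<open>x\<close>,
  whereas the \<open>H^1\<close> norm sees \<open>u_t\<close> only up to a null set of
  \<open>x\<close> that may vary with \<open>t\<close>; the two have to be reconciled. And
  \<open>u_tt\<close> is present only in a weak form, so that the energy identity is extracted from
  difference quotients and mean values.

  The horizon for \<open>u\<close> is shorter because the interpolation multiplies the squared
  displacement of \<open>U\<close>, of order \<open>\<epsilon>\<close>, by the squared norm of
  \<open>u_x\<close>, of order \<open>1 / \<epsilon>\<close>. Nothing small is left at time
  \<open>T_\<epsilon>\<close>; the factor \<open>\<epsilon>^\<eta>\<close> in the time supplies the
  smallness.\<close>

definition smooth :: "(real \<Rightarrow> real) \<Rightarrow> bool" where
  "smooth \<phi> \<longleftrightarrow> (\<forall>n x. (deriv ^^ n) \<phi> differentiable (at x))"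

text \<open>The iterated derivatives of a bump have no convenient closed form; it is enough to
  exhibit a family that contains the function and is stable under \<open>deriv\<close>.\<close>

lemma smoothI_closed:
  assumes "\<phi> \<in> F" and "\<And>\<psi>. \<psi> \<in> F \<Longrightarrow> deriv \<psi> \<in> F"
    and diff: "\<And>\<psi> x. \<psi> \<in> F \<Longrightarrow> \<psi> differentiable (at x)"
  shows "smooth \<phi>"
proof -
  have "(deriv ^^ n) \<phi> \<in> F" for n by (induction n) (use assms in auto)
  then show ?thesis unfolding smooth_def using diff by blast
qed

lemma smooth_differentiable: "smooth \<phi> \<Longrightarrow> \<phi> differentiable (at x)"
  unfolding smooth_def by (metis funpow_0)

lemma smooth_deriv: "smooth \<phi> \<Longrightarrow> smooth (deriv \<phi>)"
  unfolding smooth_def by (metis comp_apply funpow_Suc_right)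

lemma smooth_diff_cmult:
  assumes "smooth \<phi>" "smooth \<psi>"
  shows "smooth (\<lambda>x. \<phi> x - c * \<psi> x)"
proof (rule smoothI_closed[of _ "{\<theta>. \<exists>\<phi> \<psi>. \<theta> = (\<lambda>x. \<phi> x - c * \<psi> x) \<and> smooth \<phi> \<and> smooth \<psi>}"])
  show "(\<lambda>x. \<phi> x - c * \<psi> x) \<in> {\<theta>. \<exists>\<phi> \<psi>. \<theta> = (\<lambda>x. \<phi> x - c * \<psi> x) \<and> smooth \<phi> \<and> smooth \<psi>}"
    using assms by blast
next
  fix \<theta> assume "\<theta> \<in> {\<theta>. \<exists>\<phi> \<psi>. \<theta> = (\<lambda>x. \<phi> x - c * \<psi> x) \<and> smooth \<phi> \<and> smooth \<psi>}"
  then obtain f g where \<theta>: "\<theta> = (\<lambda>x. f x - c * g x)" and s: "smooth f" "smooth g" by blast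
  have d: "f field_differentiable at x" "g field_differentiable at x" for x
    using s smooth_differentiable real_differentiable_def field_differentiable_def by metis+
  have "deriv \<theta> = (\<lambda>x. deriv f x - c * deriv g x)"
    unfolding \<theta> using d by (auto intro!: ext simp: deriv_diff deriv_cmult field_differentiable_mult)
  then show "deriv \<theta> \<in> {\<theta>. \<exists>\<phi> \<psi>. \<theta> = (\<lambda>x. \<phi> x - c * \<psi> x) \<and> smooth \<phi> \<and> smooth \<psi>}"
    using s smooth_deriv by blast
next
  fix \<theta> x assume "\<theta> \<in> {\<theta>. \<exists>\<phi> \<psi>. \<theta> = (\<lambda>x. \<phi> x - c * \<psi> x) \<and> smooth \<phi> \<and> smooth \<psi>}"
  then show "\<theta> differentiable (at x)" using smooth_differentiable
    by (auto intro!: differentiable_diff differentiable_mult)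
qed

lemma smooth_antideriv:
  assumes "\<And>x. (\<phi> has_real_derivative \<psi> x) (at x)" "smooth \<psi>"
  shows "smooth \<phi>"
proof -
  have "deriv \<phi> = \<psi>" using assms(1) DERIV_imp_deriv by blast
  then have "(deriv ^^ n) \<phi> differentiable (at x)" for n x
    using assms by (cases n) (auto simp: smooth_def funpow_Suc_right real_differentiable_def simp del: funpow.simps)
  then show ?thesis by (simp add: smooth_def)
qed

text \<open>A single term of the exponential series. Read at \<open>y = 1 / q\<close>, it lets
  \<open>exp (- 1 / q)\<close> absorb any negative power of \<open>q\<close>.\<close>

lemma power_le_fact_exp:
  fixes y :: real
  assumes "0 \<le> y"
  shows "y ^ n \<le> fact n * exp y"
proof -
  have "(\<Sum>k\<in>{n}. y ^ k /\<^sub>R fact k) \<le> (\<Sum>k. y ^ k /\<^sub>R fact k)"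
    using assms by (intro sum_le_suminf summable_exp_generic) auto
  then show ?thesis by (simp add: exp_def divide_simps mult_ac)
qed

text \<open>Serves at the two endpoints of a bump, where its defining formula changes.\<close>

lemma has_derivative_zero_quadratic:
  fixes g :: "real \<Rightarrow> real"
  assumes "\<And>x. \<bar>g x\<bar> \<le> C * (x - c)^2"
  shows "(g has_real_derivative 0) (at c)"
proof -
  have g0: "g c = 0" using assms[of c] by simp
  have "((\<lambda>x. (g x - g c) / (x - c)) \<longlongrightarrow> 0) (at c)"
  proof (rule Lim_null_comparison)
    show "\<forall>\<^sub>F x in at c. norm ((g x - g c) / (x - c)) \<le> C * \<bar>x - c\<bar>"
    proof (rule eventually_mono[OF eventually_neq_at_within[of c]])
      fix x assume "x \<noteq> c"
      then show "norm ((g x - g c) / (x - c)) \<le> C * \<bar>x - c\<bar>"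
        using assms[of x] g0 by (simp add: abs_divide divide_le_eq power2_eq_square abs_mult_self_eq ac_simps flip: abs_mult) 
    qed
    show "((\<lambda>x. C * \<bar>x - c\<bar>) \<longlongrightarrow> 0) (at c)" by (auto intro!: tendsto_eq_intros)
  qed
  then show ?thesis by (simp add: has_field_derivative_iff)
qed

text \<open>A polynomial rather than a function, so that \<open>pderiv\<close> keeps all derivatives
  inside one algebraic family.\<close>

definition bumpq :: "real \<Rightarrow> real \<Rightarrow> real \<Rightarrow> real poly" where
  "bumpq c d l = [:- l * c * d, l * (c + d), - l:]"

lemma poly_bumpq: "poly (bumpq c d l) x = l * (x - c) * (d - x)"
  by (simp add: bumpq_def algebra_simps)

text \<open>The family that \<open>smoothI_closed\<close> asks for: rational factors with
  denominator \<open>q ^ k\<close> times \<open>exp (- 1 / q)\<close>. The bump itself is the member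
  with \<open>p = 1\<close> and \<open>k = 0\<close>.\<close>

definition bumpf :: "real \<Rightarrow> real \<Rightarrow> real \<Rightarrow> real poly \<Rightarrow> nat \<Rightarrow> real \<Rightarrow> real" where
  "bumpf c d l p k x = (if c < x \<and> x < d
     then poly p x / poly (bumpq c d l) x ^ k * exp (- 1 / poly (bumpq c d l) x) else 0)"

text \<open>The exponential absorbs \<open>1 / q ^ (k + 2)\<close>, two powers more than the
  denominator contains. The surplus \<open>q ^ 2\<close> vanishes quadratically at both
  endpoints.\<close>

lemma bumpf_bound:
  assumes "l > 0"
  obtains C where "\<And>x. \<bar>bumpf c d l p k x\<bar> \<le> C * ((x - c) * (d - x))^2"
proof -
  have "compact (poly p ` {c..d})"
    by (intro compact_continuous_image continuous_on_poly) simp_all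
  then obtain M where M: "\<And>x. x \<in> {c..d} \<Longrightarrow> \<bar>poly p x\<bar> \<le> M"
    using compact_imp_bounded bounded_iff by (metis image_eqI real_norm_def)
  have "\<bar>bumpf c d l p k x\<bar> \<le> (\<bar>M\<bar> * fact (k+2) * l^2) * ((x - c) * (d - x))^2" for x
  proof (cases "c < x \<and> x < d")
    case True
    define q where "q = poly (bumpq c d l) x"
    have q: "q > 0" using True assms by (simp add: q_def poly_bumpq)
    have "(1/q)^(k+2) \<le> fact (k+2) * exp (1/q)" using power_le_fact_exp[of "1/q" "k+2"] q by simp
    then have "exp (-1/q) * (1/q)^(k+2) \<le> fact (k+2)"
      using mult_left_mono[of "(1/q)^(k+2)" "fact (k+2) * exp (1/q)" "exp (-1/q)"]
      by (simp only: mult.assoc[symmetric] mult.commute[of _ "fact (k+2)"] mult_exp_exp exp_ge_zero)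
        (simp add: mult.assoc mult_exp_exp)
    then have *: "exp (-1/q) / q^k \<le> fact (k+2) * q^2"
      using q by (simp add: power_add power_divide divide_simps) (simp add: mult_ac power2_eq_square)
    have "\<bar>bumpf c d l p k x\<bar> = \<bar>poly p x\<bar> * (exp (-1/q) / q^k)"
      using True q by (simp add: bumpf_def abs_mult abs_divide flip: q_def)
    also have "\<dots> \<le> \<bar>M\<bar> * (fact (k+2) * q^2)"
      using * M[of x] True q by (intro mult_mono) (auto simp: less_imp_le)
    also have "\<dots> = (\<bar>M\<bar> * fact (k+2) * l^2) * ((x - c) * (d - x))^2"
      by (simp add: q_def poly_bumpq power_mult_distrib)
    finally show ?thesis .
  qed (auto simp: bumpf_def)
  then show ?thesis using that by blast
qed

text \<open>The quotient rule contributes the denominator \<open>q ^ (k + 1)\<close>, the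
  exponential a factor \<open>q' / q ^ 2\<close>; over \<open>q ^ (k + 2)\<close> the numerator is
  again a polynomial. At the endpoints the derivative is 0 by the quadratic bound.\<close>

lemma bumpf_DERIV:
  assumes "l > 0" "c < d"
  defines "q \<equiv> bumpq c d l"
  shows "(bumpf c d l p k has_real_derivative
    bumpf c d l (pderiv p * q^2 - of_nat k * p * pderiv q * q + p * pderiv q) (k+2) x) (at x)"
    (is "(_ has_real_derivative bumpf c d l ?P _ x) _")
proof -
  consider "c < x \<and> x < d" | "x < c" | "x > d" | "x = c" | "x = d" by linarith
  then show ?thesis
  proof cases
    case 1
    then have q0: "poly q x > 0" using assms by (simp add: q_def poly_bumpq)
    have "((\<lambda>x. poly p x / poly q x ^ k * exp (- 1 / poly q x)) has_real_derivative
       poly ?P x / poly q x ^ (k+2) * exp (- 1 / poly q x)) (at x)"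
    proof -
      let ?p = "poly p x" and ?q = "poly q x" and ?p' = "poly (pderiv p) x" and ?q' = "poly (pderiv q) x"
      have "((\<lambda>x. poly p x / poly q x ^ k * exp (- 1 / poly q x)) has_real_derivative
        (?p' * ?q^k - ?p * (real k * ?q ^ (k - 1) * ?q')) / (?q^k * ?q^k) * exp (- 1 / ?q)
         + ?p / ?q^k * (exp (- 1 / ?q) * (?q' / (?q * ?q)))) (at x)"
        using q0 by (auto intro!: derivative_eq_intros poly_DERIV, simp add: diff_divide_distrib add_divide_distrib,
            simp add: field_simps)
      \<comment> \<open>Here \<open>r\<close> stands for \<open>q ^ k\<close> and
        \<open>m * (r / q)\<close> for \<open>k * q ^ (k - 1)\<close>. For \<open>k = 0\<close> the
        truncated exponent is harmless because \<open>m = 0\<close>.\<close>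
      moreover have "(p' * r - p * (m * (r / q) * q')) / (r * r) * e + p / r * (e * (q' / (q * q)))
          = (p' * q\<^sup>2 - m * p * q' * q + p * q') / (r * q\<^sup>2) * e"
        if "q > 0" "r > 0" for p q r m e p' q' :: real
        using that by (simp add: field_simps power2_eq_square)
      from this[of ?q "?q ^ k" ?p' ?p "real k" ?q' "exp (- 1 / ?q)"]
      have "(?p' * ?q^k - ?p * (real k * ?q ^ (k - 1) * ?q')) / (?q^k * ?q^k) * exp (- 1 / ?q)
         + ?p / ?q^k * (exp (- 1 / ?q) * (?q' / (?q * ?q))) = poly ?P x / ?q ^ (k+2) * exp (- 1 / ?q)"
        using q0 by (cases k) (simp_all add: power_add power2_eq_square)
      ultimately show ?thesis by metis
    qed
    moreover have "\<forall>\<^sub>F y in nhds x. c < y \<and> y < d"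
      using 1 by (intro eventually_conj order_tendstoD[of "\<lambda>x. x"]) (auto intro: filterlim_ident)
    then have "\<forall>\<^sub>F y in nhds x. bumpf c d l p k y = poly p y / poly q y ^ k * exp (- 1 / poly q y)"
      by eventually_elim (simp add: bumpf_def q_def)
    moreover have "bumpf c d l ?P (k+2) x = poly ?P x / poly q x ^ (k+2) * exp (- 1 / poly q x)"
      using 1 by (simp add: bumpf_def q_def)
    ultimately show ?thesis
      using DERIV_cong_ev[OF refl _ refl] by fastforce
  next
    case 2
    then have "\<forall>\<^sub>F y in nhds x. bumpf c d l p k y = 0"
      using eventually_mono[OF order_tendstoD(2)[of "\<lambda>x. x" x "nhds x" c]] by (auto simp: bumpf_def filterlim_ident)
    moreover have "bumpf c d l ?P (k+2) x = 0" using 2 by (simp add: bumpf_def)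
    ultimately show ?thesis using DERIV_cong_ev[OF refl _ refl, THEN iffD2, of _ "\<lambda>x. 0"] by fastforce
  next
    case 3
    then have "\<forall>\<^sub>F y in nhds x. bumpf c d l p k y = 0"
      using eventually_mono[OF order_tendstoD(1)[of "\<lambda>x. x" x "nhds x" d]] by (auto simp: bumpf_def filterlim_ident)
    moreover have "bumpf c d l ?P (k+2) x = 0" using 3 by (simp add: bumpf_def)
    ultimately show ?thesis using DERIV_cong_ev[OF refl _ refl, THEN iffD2, of _ "\<lambda>x. 0"] by fastforce
  next
    case 4
    obtain C where C: "\<And>x. \<bar>bumpf c d l p k x\<bar> \<le> C * ((x - c) * (d - x))^2"
      using bumpf_bound[OF assms(1)] by metis
    have "\<bar>bumpf c d l p k y\<bar> \<le> (\<bar>C\<bar> * (d-c)^2) * (y - c)^2" for y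
    proof (cases "c < y \<and> y < d")
      case True
      have "C * ((y - c) * (d - y))^2 \<le> \<bar>C\<bar> * ((y - c)^2 * (d - c)^2)"
        unfolding power_mult_distrib using True by (intro mult_mono power_mono) auto
      then show ?thesis using C[of y] by (simp add: ac_simps)
    qed (auto simp: bumpf_def)
    moreover have "bumpf c d l ?P (k+2) x = 0" using 4 by (simp add: bumpf_def)
    ultimately show ?thesis using has_derivative_zero_quadratic 4 by metis
  next
    case 5
    obtain C where C: "\<And>x. \<bar>bumpf c d l p k x\<bar> \<le> C * ((x - c) * (d - x))^2"
      using bumpf_bound[OF assms(1)] by metis
    have "\<bar>bumpf c d l p k y\<bar> \<le> (\<bar>C\<bar> * (d-c)^2) * (y - d)^2" for y
    proof (cases "c < y \<and> y < d")
      case True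
      have "C * ((y - c) * (d - y))^2 \<le> \<bar>C\<bar> * ((d - c)^2 * (d - y)^2)"
        unfolding power_mult_distrib using True by (intro mult_mono power_mono) auto
      then show ?thesis using C[of y] by (simp add: ac_simps power2_commute[of y d])
    qed (auto simp: bumpf_def)
    moreover have "bumpf c d l ?P (k+2) x = 0" using 5 by (simp add: bumpf_def)
    ultimately show ?thesis using has_derivative_zero_quadratic 5 by metis
  qed
qed

text \<open>A larger \<open>l\<close> makes the bump steeper; in the limit it becomes the indicator
  of the open interval.\<close>

definition bump :: "real \<Rightarrow> real \<Rightarrow> real \<Rightarrow> real \<Rightarrow> real" where
  "bump c d l x = (if c < x \<and> x < d then exp (- 1 / (l * (x - c) * (d - x))) else 0)"

lemma smooth_bump:
  assumes "l > 0" "c < d"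
  shows "smooth (bump c d l)"
proof (rule smoothI_closed[of _ "{bumpf c d l p k | p k. True}"])
  have "bump c d l = bumpf c d l 1 0"
    by (auto simp: bump_def bumpf_def poly_bumpq fun_eq_iff)
  then show "bump c d l \<in> {bumpf c d l p k | p k. True}" by blast
next
  fix \<psi> assume "\<psi> \<in> {bumpf c d l p k | p k. True}"
  then obtain p k where \<psi>: "\<psi> = bumpf c d l p k" by blast
  show "deriv \<psi> \<in> {bumpf c d l p k | p k. True}"
    using DERIV_imp_deriv[OF bumpf_DERIV[OF assms]] unfolding \<psi> by blast
  show "\<psi> differentiable (at x)" for x
    using bumpf_DERIV[OF assms] unfolding \<psi> real_differentiable_def by blast
qed

lemma bump_bounds: "l > 0 \<Longrightarrow> 0 \<le> bump c d l x" "l > 0 \<Longrightarrow> bump c d l x \<le> 1"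
  by (auto simp: bump_def)

lemma bump_tendsto: "(\<lambda>k. bump c d (real (Suc k)) x) \<longlonglongrightarrow> (if c < x \<and> x < d then 1 else 0)"
proof (cases "c < x \<and> x < d")
  case True
  have "(\<lambda>k. exp (- (1 / ((x - c) * (d - x))) * inverse (real (Suc k)))) \<longlonglongrightarrow> exp (- (1 / ((x - c) * (d - x))) * 0)"
    by (intro tendsto_intros LIMSEQ_inverse_real_of_nat)
  then show ?thesis using True by (simp add: bump_def divide_simps mult_ac del: of_nat_Suc)
qed (auto simp: bump_def)

section \<open>Indefinite integrals\<close>

lemmas HK_integral_diff = Henstock_Kurzweil_Integration.integral_diff
lemmas HK_integral_add = Henstock_Kurzweil_Integration.integral_add
lemmas HK_integral_combine = Henstock_Kurzweil_Integration.integral_combine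

lemma nonneg_integral_0_negligible:
  fixes f :: "real \<Rightarrow> real"
  assumes "(f has_integral 0) {a..b}" "\<And>x. x \<in> {a..b} \<Longrightarrow> 0 \<le> f x"
  shows "negligible {x\<in>{a..b}. f x \<noteq> 0}"
proof -
  have ai: "f absolutely_integrable_on {a..b}"
    using assms by (intro nonnegative_absolutely_integrable_1) auto
  have "(LINT x|lebesgue. indicator {a..b} x *\<^sub>R f x) = 0"
    using set_lebesgue_integral_eq_integral(2)[OF ai] assms(1)
    by (simp add: set_lebesgue_integral_def integral_unique)
  moreover have "integrable lebesgue (\<lambda>x. indicator {a..b} x *\<^sub>R f x)"
    using ai by (simp add: set_integrable_def)
  ultimately have "AE x in lebesgue. indicator {a..b} x *\<^sub>R f x = 0"
    using assms(2) by (subst (asm) integral_nonneg_eq_0_iff_AE) (auto simp: indicator_def)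
  then have "{x \<in> space lebesgue. \<not> indicator {a..b} x *\<^sub>R f x = 0} \<in> null_sets lebesgue"
    by (simp only: completion.AE_iff_null_sets)
  then show ?thesis unfolding negligible_iff_null_sets
    by (rule back_subst[of "\<lambda>S. S \<in> null_sets lebesgue"]) (auto simp: indicator_def)
qed

text \<open>By the Henstock lemma the sums of \<open>|measure k * f x - integral k f|\<close> over
  fine partitions are small. As every \<open>integral k f\<close> vanishes, these are the Riemann
  sums of \<open>|f|\<close>, whose integral is therefore 0.\<close>

lemma zero_integrals_negligible:
  fixes f :: "real \<Rightarrow> real"
  assumes int: "f integrable_on {a..b}"
    and z: "\<And>c d. a \<le> c \<Longrightarrow> c \<le> d \<Longrightarrow> d \<le> b \<Longrightarrow> integral {c..d} f = 0"
  shows "negligible {x\<in>{a..b}. f x \<noteq> 0}"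
proof -
  have "((\<lambda>x. \<bar>f x\<bar>) has_integral 0) (cbox a b)"
    unfolding has_integral
  proof (intro allI impI)
    fix e :: real assume "e > 0"
    obtain \<gamma> where g: "gauge \<gamma>" and
      \<gamma>: "\<And>p. \<lbrakk>p tagged_partial_division_of (cbox a b); \<gamma> fine p\<rbrakk> \<Longrightarrow>
             sum (\<lambda>(x,k). norm(measure lborel k *\<^sub>R f x - integral k f)) p < e"
      using Henstock_lemma[of f a b e] int \<open>e > 0\<close> by auto
    have "norm ((\<Sum>(x, k)\<in>p. measure lborel k *\<^sub>R \<bar>f x\<bar>) - 0) < e"
      if p: "p tagged_division_of (cbox a b)" "\<gamma> fine p" for p
    proof -
      have "(\<Sum>(x, k)\<in>p. measure lborel k *\<^sub>R \<bar>f x\<bar>) = sum (\<lambda>(x,k). norm(measure lborel k *\<^sub>R f x - integral k f)) p"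
      proof (rule sum.cong[OF refl], clarify)
        fix x k assume xk: "(x, k) \<in> p"
        obtain c d where k: "k = cbox c d" using tagged_division_ofD(4)[OF p(1) xk] by blast
        have "x \<in> k" "k \<subseteq> cbox a b" using tagged_division_ofD(2,3)[OF p(1) xk] by auto
        then have "integral k f = 0" using z[of c d] unfolding k by (auto simp: subset_eq)
        then show "measure lborel k *\<^sub>R \<bar>f x\<bar> = norm (measure lborel k *\<^sub>R f x - integral k f)"
          by (simp add: abs_mult)
      qed
      moreover have "(\<Sum>(x, k)\<in>p. measure lborel k *\<^sub>R \<bar>f x\<bar>) \<ge> 0"
        by (intro sum_nonneg) auto
      ultimately show ?thesis using \<gamma>[OF _ p(2)] p(1) by (simp add: tagged_division_of_def)
    qed
    then show "\<exists>\<gamma>. gauge \<gamma> \<and> (\<forall>\<D>. \<D> tagged_division_of cbox a b \<and> \<gamma> fine \<D> \<longrightarrow>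
        norm ((\<Sum>(x, k)\<in>\<D>. measure lborel k *\<^sub>R \<bar>f x\<bar>) - 0) < e)" using g by blast
  qed
  from nonneg_integral_0_negligible[of "\<lambda>x. \<bar>f x\<bar>" a b] this show ?thesis by simp
qed

lemma absolutely_integrable_mult_continuous:
  fixes f \<phi> :: "real \<Rightarrow> real"
  assumes "f absolutely_integrable_on {a..b}" "continuous_on {a..b} \<phi>"
  shows "(\<lambda>x. f x * \<phi> x) absolutely_integrable_on {a..b}"
proof -
  have "(\<lambda>x. \<phi> x * f x) absolutely_integrable_on {a..b}"
    using assms by (intro absolutely_integrable_bounded_measurable_product_real)
      (auto intro: continuous_imp_measurable_on_sets_lebesgue compact_imp_bounded compact_continuous_image)
  then show ?thesis by (simp add: mult.commute)
qed

lemma integral_abs_bound_integral: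
  fixes f g :: "real \<Rightarrow> real"
  assumes "f integrable_on S" "g integrable_on S" "\<And>x. x \<in> S \<Longrightarrow> \<bar>f x\<bar> \<le> g x"
  shows "\<bar>integral S f\<bar> \<le> integral S g"
  using integral_norm_bound_integral[of f S g] assms by simp

lemma integral_Icc_diff:
  fixes f :: "real \<Rightarrow> real"
  assumes "f integrable_on {a..b}" "a \<le> x" "x \<le> y" "y \<le> b"
  shows "integral {a..y} f - integral {a..x} f = integral {x..y} f"
proof -
  have "f integrable_on {a..y}" using assms integrable_subinterval_real[OF assms(1)] by auto
  from HK_integral_combine[OF assms(2,3) this] show ?thesis by simp
qed

text \<open>Differentiating both sides only works almost everywhere; instead the difference \<open>J\<close> of the
  two sides changes by \<open>o(\<bar>y - x\<bar>)\<close> at every point.\<close>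

lemma integration_by_parts_indefinite:
  fixes h \<phi> \<phi>' :: "real \<Rightarrow> real"
  assumes h: "h absolutely_integrable_on {a..b}" and ab: "a \<le> b"
    and \<phi>: "\<And>x. x \<in> {a..b} \<Longrightarrow> (\<phi> has_real_derivative \<phi>' x) (at x within {a..b})"
    and \<phi>': "continuous_on {a..b} \<phi>'"
  shows "integral {a..b} (\<lambda>x. h x * \<phi> x) = integral {a..b} h * \<phi> b
     - integral {a..b} (\<lambda>x. integral {a..x} h * \<phi>' x)"
proof -
  define H where "H x = integral {a..x} h" for x
  define A where "A x = integral {a..x} (\<lambda>x. \<bar>h x\<bar>)" for x
  define J where "J x = integral {a..x} (\<lambda>x. h x * \<phi> x) - H x * \<phi> x + integral {a..x} (\<lambda>x. H x * \<phi>' x)" for x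
  have hi: "h integrable_on {a..b}" and ha: "(\<lambda>x. \<bar>h x\<bar>) integrable_on {a..b}"
    using h unfolding absolutely_integrable_on_def by auto
  have cH: "continuous_on {a..b} H" unfolding H_def by (rule indefinite_integral_continuous_1[OF hi])
  have cA: "continuous_on {a..b} A" unfolding A_def by (rule indefinite_integral_continuous_1[OF ha])
  have c\<phi>: "continuous_on {a..b} \<phi>" using \<phi> DERIV_continuous_on by blast
  have h\<phi>: "(\<lambda>x. h x * \<phi> x) integrable_on {a..b}"
    using absolutely_integrable_mult_continuous[OF h c\<phi>] by (simp add: absolutely_integrable_on_def)
  have H\<phi>: "(\<lambda>x. H x * \<phi>' x) integrable_on {a..b}"
    by (intro integrable_continuous_real continuous_intros cH \<phi>')
  obtain L where L: "\<And>x. x \<in> {a..b} \<Longrightarrow> \<bar>\<phi>' x\<bar> \<le> L"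
    using compact_imp_bounded[OF compact_continuous_image[OF \<phi>' compact_Icc]] 
    unfolding bounded_iff by (metis image_eqI real_norm_def)
  have L0: "L \<ge> 0" using L[of a] ab by auto
  have lip: "\<bar>\<phi> y - \<phi> x\<bar> \<le> L * \<bar>y - x\<bar>" if "x \<in> {a..b}" "y \<in> {a..b}" for x y
    using field_differentiable_bound[of "{a..b}" \<phi> \<phi>' L y x] \<phi> L that by auto
  have sub: "g integrable_on {x..y}" if "g integrable_on {a..b}" "a \<le> x" "y \<le> b" for g :: "real \<Rightarrow> real" and x y
    using that integrable_subinterval_real[OF that(1)] by auto
  note subs = sub[OF hi] sub[OF ha] sub[OF H\<phi>] sub[OF integrable_continuous_real[OF \<phi>']] sub[OF h\<phi>]
  \<comment> \<open>\<open>A\<close> is the primitive of \<open>|h|\<close>. Its continuity makes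
    the right-hand side \<open>o(y - x)\<close>, so the derivative of \<open>J\<close> vanishes at
    every point.\<close>
  have est: "\<bar>J y - J x\<bar> \<le> 2 * L * ((y - x) * (A y - A x))" if xy: "a \<le> x" "x \<le> y" "y \<le> b" for x y
  proof -
    have Ayx: "A y - A x = integral {x..y} (\<lambda>x. \<bar>h x\<bar>)"
      unfolding A_def by (rule integral_Icc_diff[OF ha xy])
    have Hyx: "H y - H x = integral {x..y} h" if "a \<le> x" "x \<le> y" "y \<le> b" for x y
      unfolding H_def by (rule integral_Icc_diff[OF hi that])
    have HA: "\<bar>H y - H s\<bar> \<le> A y - A x" if "x \<le> s" "s \<le> y" for s
    proof -
      have "\<bar>H y - H s\<bar> \<le> integral {s..y} (\<lambda>x. \<bar>h x\<bar>)"
        using that xy unfolding Hyx[OF order_trans[OF xy(1) that(1)] that(2) xy(3)]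
        by (intro integral_abs_bound_integral subs) auto
      also have "\<dots> \<le> integral {x..y} (\<lambda>x. \<bar>h x\<bar>)"
        using that xy by (intro integral_subset_le subs) auto
      finally show ?thesis using Ayx by simp
    qed
    have fi: "(\<lambda>s. (\<phi> s - \<phi> x) * h s) integrable_on {x..y}"
    proof -
      have "(\<lambda>s. h s * (\<phi> s - \<phi> x)) absolutely_integrable_on {a..b}"
        by (intro absolutely_integrable_mult_continuous h continuous_intros c\<phi>)
      then show ?thesis using sub xy by (auto simp: absolutely_integrable_on_def mult.commute)
    qed
    have "J y - J x = integral {x..y} (\<lambda>x. h x * \<phi> x) - (H y * \<phi> y - H x * \<phi> x) + integral {x..y} (\<lambda>x. H x * \<phi>' x)"
      unfolding J_def using integral_Icc_diff[OF h\<phi> xy] integral_Icc_diff[OF H\<phi> xy] by simp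
    also have "integral {x..y} (\<lambda>s. h s * \<phi> s) = integral {x..y} (\<lambda>s. (\<phi> s - \<phi> x) * h s) + \<phi> x * (H y - H x)"
    proof -
      have "integral {x..y} (\<lambda>s. h s * \<phi> s) = integral {x..y} (\<lambda>s. (\<phi> s - \<phi> x) * h s + \<phi> x * h s)"
        by (simp add: algebra_simps)
      also have "\<dots> = integral {x..y} (\<lambda>s. (\<phi> s - \<phi> x) * h s) + integral {x..y} (\<lambda>s. \<phi> x * h s)"
        using xy by (intro HK_integral_add fi integrable_on_mult_right subs)
      finally show ?thesis using Hyx[OF xy] by simp
    qed
    also have "\<phi> y - \<phi> x = integral {x..y} \<phi>'"
      using xy \<phi> by (intro integral_unique[symmetric] fundamental_theorem_of_calculus)
        (auto intro: has_vector_derivative_within_subset[of \<phi> _ _ "{a..b}"] simp: has_real_derivative_iff_has_vector_derivative)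
    then have "H y * \<phi> y = H y * \<phi> x + integral {x..y} (\<lambda>s. H y * \<phi>' s)" by (simp add: algebra_simps)
    finally have "J y - J x = integral {x..y} (\<lambda>s. (\<phi> s - \<phi> x) * h s) - (integral {x..y} (\<lambda>s. H y * \<phi>' s) - integral {x..y} (\<lambda>x. H x * \<phi>' x))"
      by (simp add: algebra_simps)
    also have "integral {x..y} (\<lambda>s. H y * \<phi>' s) - integral {x..y} (\<lambda>x. H x * \<phi>' x) = integral {x..y} (\<lambda>s. (H y - H s) * \<phi>' s)"
      using xy by (subst HK_integral_diff[symmetric])
        (auto intro!: integrable_on_mult_right subs simp: algebra_simps)
    finally have J: "J y - J x = integral {x..y} (\<lambda>s. (\<phi> s - \<phi> x) * h s) - integral {x..y} (\<lambda>s. (H y - H s) * \<phi>' s)" .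
    have "\<bar>integral {x..y} (\<lambda>s. (\<phi> s - \<phi> x) * h s)\<bar> \<le> integral {x..y} (\<lambda>s. (L * (y - x)) * \<bar>h s\<bar>)"
    proof (intro integral_abs_bound_integral fi integrable_on_mult_right subs xy)
      fix s assume s: "s \<in> {x..y}"
      have "\<bar>\<phi> s - \<phi> x\<bar> \<le> L * \<bar>s - x\<bar>" using lip[of x s] s xy by auto
      also have "\<dots> \<le> L * (y - x)" using s L0 by (intro mult_left_mono) auto
      finally show "\<bar>(\<phi> s - \<phi> x) * h s\<bar> \<le> L * (y - x) * \<bar>h s\<bar>"
        by (simp add: abs_mult mult_right_mono)
    qed
    moreover have "\<bar>integral {x..y} (\<lambda>s. (H y - H s) * \<phi>' s)\<bar> \<le> integral {x..y} (\<lambda>s. (A y - A x) * L)"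
    proof (intro integral_abs_bound_integral)
      show "(\<lambda>s. (H y - H s) * \<phi>' s) integrable_on {x..y}"
        using xy by (intro sub[OF integrable_continuous_real]) (auto intro!: continuous_intros cH \<phi>')
      fix s assume s: "s \<in> {x..y}"
      then show "\<bar>(H y - H s) * \<phi>' s\<bar> \<le> (A y - A x) * L"
        unfolding abs_mult using HA[of s] L[of s] xy by (intro mult_mono) auto
    qed auto
    moreover have "integral {x..y} (\<lambda>s. L * (y - x) * \<bar>h s\<bar>) = L * ((y - x) * (A y - A x))"
      "integral {x..y} (\<lambda>s. (A y - A x) * L) = L * ((y - x) * (A y - A x))"
      using xy by (simp_all add: Ayx)
    ultimately show ?thesis unfolding J by linarith
  qed
  have est2: "\<bar>J y - J x\<bar> \<le> 2 * L * (\<bar>y - x\<bar> * \<bar>A y - A x\<bar>)" if "x \<in> {a..b}" "y \<in> {a..b}" for x y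
  proof (cases "x \<le> y")
    case True
    have "2 * L * ((y - x) * (A y - A x)) \<le> 2 * L * (\<bar>y - x\<bar> * \<bar>A y - A x\<bar>)"
      using L0 True mult_left_mono[of "A y - A x" "\<bar>A y - A x\<bar>" "y - x"] by (intro mult_left_mono) auto
    then show ?thesis using est[of x y] that True by auto
  next
    case False
    have "2 * L * ((x - y) * (A x - A y)) \<le> 2 * L * (\<bar>y - x\<bar> * \<bar>A y - A x\<bar>)"
      using L0 False mult_left_mono[of "A x - A y" "\<bar>A y - A x\<bar>" "x - y"] by (intro mult_left_mono) auto
    then show ?thesis using est[of y x] that False by (auto simp: abs_minus_commute)
  qed
  have "(J has_real_derivative 0) (at x within {a..b})" if x: "x \<in> {a..b}" for x
  proof -
    have "((\<lambda>y. (J y - J x) / (y - x)) \<longlongrightarrow> 0) (at x within {a..b})"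
    proof (rule Lim_null_comparison)
      show "\<forall>\<^sub>F y in at x within {a..b}. norm ((J y - J x) / (y - x)) \<le> 2 * L * \<bar>A y - A x\<bar>"
        unfolding eventually_at_filter
      proof (rule always_eventually, intro allI impI)
        fix y assume "y \<noteq> x" "y \<in> {a..b}"
        then show "norm ((J y - J x) / (y - x)) \<le> 2 * L * \<bar>A y - A x\<bar>"
          using est2[OF x, of y] by (simp add: abs_divide divide_le_eq mult_ac)
      qed
      have "(A \<longlongrightarrow> A x) (at x within {a..b})" using cA x by (simp add: continuous_on)
      then show "((\<lambda>y. 2 * L * \<bar>A y - A x\<bar>) \<longlongrightarrow> 0) (at x within {a..b})"
        by (auto intro!: tendsto_eq_intros)
    qed
    then show ?thesis by (simp add: has_field_derivative_iff)
  qed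
  then obtain c where "\<forall>x\<in>{a..b}. J x = c"
    using has_field_derivative_zero_constant[of "{a..b}" J] by auto
  then have "J b = J a" using ab by auto
  then show ?thesis by (simp add: J_def H_def)
qed

section \<open>The du Bois-Reymond lemma\<close>

lemma antiderivative_UNIV:
  fixes f :: "real \<Rightarrow> real"
  assumes "continuous_on UNIV f"
  obtains F where "\<And>x. (F has_real_derivative f x) (at x)" "F c = 0"
proof -
  have "isCont f x" for x using assms by (simp add: continuous_on_eq_continuous_at)
  then obtain F where F: "\<And>x. (F has_vector_derivative f x) (at x)"
    using einterval_antiderivative[of "-\<infinity>" "\<infinity>" f] by auto
  show ?thesis
    by (rule that[of "\<lambda>x. F x - F c"])
      (use F in \<open>auto intro!: derivative_eq_intros simp: has_real_derivative_iff_has_vector_derivative\<close>)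
qed

lemma continuous_bump: "l > 0 \<Longrightarrow> c < d \<Longrightarrow> continuous_on S (bump c d l)"
  using smooth_differentiable[OF smooth_bump]
  by (intro continuous_at_imp_continuous_on ballI differentiable_imp_continuous_within) auto

lemma integral_bump_tendsto:
  assumes f: "f absolutely_integrable_on {a..b}" and "a \<le> p" "p < q" "q \<le> b"
  shows "(\<lambda>k. integral {a..b} (\<lambda>x. f x * bump p q (real (Suc k)) x)) \<longlonglongrightarrow> integral {p..q} f"
proof -
  have "(\<lambda>k. integral {a..b} (\<lambda>x. f x * bump p q (real (Suc k)) x)) \<longlonglongrightarrow>
      integral {a..b} (\<lambda>x. f x * (if p < x \<and> x < q then 1 else 0))"
  proof (rule dominated_convergence[where h = "\<lambda>x. \<bar>f x\<bar>"])
    show "(\<lambda>x. f x * bump p q (real (Suc k)) x) integrable_on {a..b}" for k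
      using absolutely_integrable_mult_continuous[OF f continuous_bump[of "real (Suc k)" p q]] assms
      by (simp add: absolutely_integrable_on_def)
    show "(\<lambda>x. \<bar>f x\<bar>) integrable_on {a..b}" using f by (simp add: absolutely_integrable_on_def)
    show "norm (f x * bump p q (real (Suc k)) x) \<le> \<bar>f x\<bar>" for k x
      using mult_left_mono[of "bump p q (real (Suc k)) x" 1 "\<bar>f x\<bar>"] bump_bounds[of "real (Suc k)" p q x]
      by (simp add: abs_mult)
    show "(\<lambda>k. f x * bump p q (real (Suc k)) x) \<longlonglongrightarrow> f x * (if p < x \<and> x < q then 1 else 0)" for x
      by (intro tendsto_intros bump_tendsto)
  qed
  also have "integral {a..b} (\<lambda>x. f x * (if p < x \<and> x < q then 1 else 0)) =
      integral {a..b} (\<lambda>x. if x \<in> {p..q} then f x else 0)"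
    by (rule integral_spike[of "{p,q}"]) auto
  also have "\<dots> = integral ({p..q} \<inter> {a..b}) f" by (rule integral_restrict_Int)
  also have "{p..q} \<inter> {a..b} = {p..q}" using assms by auto
  finally show ?thesis .
qed

text \<open>The test functions are the primitives of \<open>bump p q k - c * \<beta>\<close> for one fixed bump \<open>\<beta>\<close>;
  letting \<open>k\<close> grow turns the first bump into the indicator of \<open>{p..q}\<close>.\<close>

lemma du_Bois_Reymond:
  assumes ab: "a < b" and g: "g absolutely_integrable_on {a..b}" and h: "h absolutely_integrable_on {a..b}"
    and w: "weak_deriv a b g h"
  obtains c where "negligible {x\<in>{a..b}. g x \<noteq> c + integral {a..x} h}"
proof -
  define H where "H x = integral {a..x} h" for x
  define f where "f x = g x - H x" for x
  have hi: "h integrable_on {a..b}" using h unfolding absolutely_integrable_on_def by auto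
  have cH: "continuous_on {a..b} H" unfolding H_def by (rule indefinite_integral_continuous_1[OF hi])
  have Ha: "H absolutely_integrable_on {a..b}" by (rule absolutely_integrable_continuous_real[OF cH])
  have fa: "f absolutely_integrable_on {a..b}"
    unfolding f_def by (rule set_integral_diff(1)[OF g Ha])
  have fi: "f integrable_on {a..b}" using fa unfolding absolutely_integrable_on_def by auto
  define p0 q0 where "p0 = (2*a+b)/3" and "q0 = (a+2*b)/3"
  have pq0: "a < p0" "p0 < q0" "q0 < b" using ab by (auto simp: p0_def q0_def)
  define \<beta> where "\<beta> = bump p0 q0 1"
  define I where "I = integral {a..b} \<beta>"
  have c\<beta>: "continuous_on S \<beta>" for S using continuous_bump[of 1 p0 q0] pq0 by (simp add: \<beta>_def)
  have "I \<noteq> 0"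
  proof
    assume "I = 0"
    then have "\<beta> ((p0+q0)/2) = 0"
      using integral_eq_0_iff[of a b \<beta>] c\<beta> ab pq0 bump_bounds[of 1 p0 q0] by (auto simp: I_def \<beta>_def)
    then show False using pq0 by (simp add: \<beta>_def bump_def)
  qed
  \<comment> \<open>If \<open>f\<close> is constant almost everywhere, its value must be its mean
    with respect to the weight \<open>\<beta>\<close>.\<close>
  define \<kappa> where "\<kappa> = integral {a..b} (\<lambda>x. f x * \<beta> x) / I"
  have fc: "(\<lambda>x. f x * \<psi> x) integrable_on {a..b}" if "continuous_on UNIV \<psi>" for \<psi>
    using absolutely_integrable_mult_continuous[OF fa continuous_on_subset[OF that]] by (simp add: absolutely_integrable_on_def)
  have key: "integral {a..b} (\<lambda>x. f x * bump p q (real (Suc k)) x) = integral {a..b} (\<lambda>x. 1 * bump p q (real (Suc k)) x) * \<kappa>"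
    if pq: "a < p" "p < q" "q < b" for p q k
  proof -
    define B where "B = bump p q (real (Suc k))"
    \<comment> \<open>This multiple of \<open>\<beta>\<close> gives \<open>\<psi>\<close> integral
      0, so that the primitive \<open>\<phi>\<close> vanishes to the right of both supports as well
      as to the left.\<close>
    define m where "m = integral {a..b} B / I"
    define \<psi> where "\<psi> x = B x - m * \<beta> x" for x
    have cB: "continuous_on S B" for S using continuous_bump[of "real (Suc k)" p q] pq by (simp add: B_def)
    have s\<psi>: "smooth \<psi>" unfolding \<psi>_def B_def \<beta>_def
      by (intro smooth_diff_cmult smooth_bump) (use pq pq0 in auto)
    have c\<psi>: "continuous_on S \<psi>" for S unfolding \<psi>_def by (intro continuous_intros cB c\<beta>)
    obtain \<phi> where \<phi>: "\<And>x. (\<phi> has_real_derivative \<psi> x) (at x)" "\<phi> a = 0"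
      using antiderivative_UNIV[OF c\<psi>] by blast
    have d\<phi>: "deriv \<phi> = \<psi>" using \<phi>(1) DERIV_imp_deriv by blast
    have s\<phi>: "smooth \<phi>" using smooth_antideriv[OF \<phi>(1) s\<psi>] .
    have "integral {a..b} \<psi> = integral {a..b} B - m * I"
      unfolding \<psi>_def I_def
      by (subst HK_integral_diff) (auto intro!: integrable_continuous_real continuous_intros cB c\<beta>)
    also have "\<dots> = 0" using \<open>I \<noteq> 0\<close> by (simp add: m_def)
    finally have i\<psi>: "integral {a..b} \<psi> = 0" .
    have "(\<psi> has_integral \<phi> b - \<phi> a) {a..b}"
      using ab \<phi>(1) by (intro fundamental_theorem_of_calculus)
        (auto simp: has_real_derivative_iff_has_vector_derivative intro: has_vector_derivative_at_within)
    then have \<phi>b: "\<phi> b = 0" using i\<psi> \<phi>(2) by (simp add: integral_unique)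
    have const: "\<phi> x = \<phi> y" if "\<And>z. z \<in> S \<Longrightarrow> \<psi> z = 0" "convex S" "x \<in> S" "y \<in> S" for S x y
    proof -
      have "\<exists>c. \<forall>x\<in>S. \<phi> x = c"
        using that \<phi>(1) by (intro has_field_derivative_zero_constant) (auto intro: has_field_derivative_at_within, metis has_field_derivative_at_within)
      then show ?thesis using that by auto
    qed
    have "\<phi> x = 0" if "x \<notin> {min p p0..max q q0}" for x
    proof (cases "x < min p p0")
      case True
      have "\<phi> x = \<phi> a" by (rule const[of "{..min p p0}"]) (use True pq pq0 in \<open>auto simp: \<psi>_def B_def \<beta>_def bump_def\<close>)
      then show ?thesis using \<phi>(2) by simp
    next
      case False
      then have "x > max q q0" using that by auto
      then have "\<phi> x = \<phi> b" by (intro const[of "{max q q0..}"]) (use pq pq0 in \<open>auto simp: \<psi>_def B_def \<beta>_def bump_def\<close>)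
      then show ?thesis using \<phi>b by simp
    qed
    moreover have "a < min p p0" "max q q0 < b" using pq pq0 by auto
    ultimately have "cc_test a b \<phi>" using s\<phi> unfolding cc_test_def smooth_def by blast
    then have "integral {a..b} (\<lambda>x. g x * \<psi> x) = - integral {a..b} (\<lambda>x. h x * \<phi> x)"
      using w unfolding weak_deriv_def d\<phi>[symmetric] by blast
    also have "integral {a..b} (\<lambda>x. h x * \<phi> x) = - integral {a..b} (\<lambda>x. H x * \<psi> x)"
      using integration_by_parts_indefinite[OF h _ has_field_derivative_at_within[OF \<phi>(1)] c\<psi>] ab \<phi>b
      by (simp add: H_def)
    finally have "integral {a..b} (\<lambda>x. g x * \<psi> x) - integral {a..b} (\<lambda>x. H x * \<psi> x) = 0" by simp
    then have "integral {a..b} (\<lambda>x. f x * \<psi> x) = 0"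
      unfolding f_def left_diff_distrib
      using absolutely_integrable_mult_continuous[OF g c\<psi>] absolutely_integrable_mult_continuous[OF Ha c\<psi>]
      by (subst HK_integral_diff) (auto simp: absolutely_integrable_on_def)
    moreover have "integral {a..b} (\<lambda>x. f x * \<psi> x) = integral {a..b} (\<lambda>x. f x * B x) - m * integral {a..b} (\<lambda>x. f x * \<beta> x)"
    proof -
      have "integral {a..b} (\<lambda>x. f x * \<psi> x) = integral {a..b} (\<lambda>x. f x * B x - m * (f x * \<beta> x))"
        unfolding \<psi>_def by (simp add: algebra_simps)
      also have "\<dots> = integral {a..b} (\<lambda>x. f x * B x) - integral {a..b} (\<lambda>x. m * (f x * \<beta> x))"
        by (intro HK_integral_diff integrable_on_mult_right fc cB c\<beta>)
      finally show ?thesis by simp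
    qed
    ultimately show ?thesis by (simp add: m_def \<kappa>_def B_def)
  qed
  have eq: "integral {p..q} f = (q - p) * \<kappa>" if pq: "a < p" "p < q" "q < b" for p q
  proof (rule LIMSEQ_unique)
    show "(\<lambda>k. integral {a..b} (\<lambda>x. f x * bump p q (real (Suc k)) x)) \<longlonglongrightarrow> integral {p..q} f"
      using pq by (intro integral_bump_tendsto fa) auto
    have "(\<lambda>k. integral {a..b} (\<lambda>x. 1 * bump p q (real (Suc k)) x) * \<kappa>) \<longlonglongrightarrow> integral {p..q} (\<lambda>x. 1) * \<kappa>"
      using pq by (intro tendsto_intros integral_bump_tendsto absolutely_integrable_continuous_real) auto
    then show "(\<lambda>k. integral {a..b} (\<lambda>x. f x * bump p q (real (Suc k)) x)) \<longlonglongrightarrow> (q - p) * \<kappa>"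
      unfolding key[OF pq] using pq by simp
  qed
  have fki: "(\<lambda>x. f x - \<kappa>) integrable_on {a..b}" by (intro integrable_diff fi) auto
  define F where "F x = integral {a..x} (\<lambda>x. f x - \<kappa>)" for x
  have cF: "continuous_on {a..b} F" unfolding F_def by (rule indefinite_integral_continuous_1[OF fki])
  have Fe: "F q = F p" if "a < p" "p < q" "q < b" for p q
  proof -
    have "F q - F p = integral {p..q} (\<lambda>x. f x - \<kappa>)"
      unfolding F_def using that by (intro integral_Icc_diff[OF fki]) auto
    also have "\<dots> = integral {p..q} f - (q - p) * \<kappa>"
      using integrable_subinterval_real[OF fi, of p q] that
      by (subst HK_integral_diff) auto
    finally show ?thesis using eq[OF that] by simp
  qed
  define m where "m = F ((a+b)/2)"
  have Fm: "F x = F ((a+b)/2)" if "x \<in> {a<..<b}" for x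
  proof (cases "x = (a+b)/2")
    case False
    then show ?thesis using Fe[of x "(a+b)/2"] Fe[of "(a+b)/2" x] that ab
      by (cases "x < (a+b)/2") auto
  qed (rule arg_cong)
  have Fc: "F x = F ((a+b)/2)" if "x \<in> {a..b}" for x
    by (rule continuous_constant_on_closure[of "{a<..<b}"]) (use cF Fm that ab in \<open>simp_all flip: m_def\<close>)
  have "negligible {x\<in>{a..b}. f x - \<kappa> \<noteq> 0}"
  proof (rule zero_integrals_negligible[OF fki])
    fix c d assume "a \<le> c" "c \<le> d" "d \<le> b"
    then show "integral {c..d} (\<lambda>x. f x - \<kappa>) = 0"
      using integral_Icc_diff[OF fki, of c d] Fc[of c] Fc[of d] by (simp add: F_def flip: m_def)
  qed
  moreover have "{x\<in>{a..b}. f x - \<kappa> \<noteq> 0} = {x\<in>{a..b}. g x \<noteq> \<kappa> + integral {a..x} h}"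
    by (auto simp: f_def H_def)
  ultimately show ?thesis using that by simp
qed

section \<open>Square-integrable functions and the Cauchy-Schwarz inequality\<close>

lemma L2fun_measurable: "L2fun a b g \<Longrightarrow> g \<in> borel_measurable (lebesgue_on {a..b})"
  by (simp add: L2fun_def measurable_on_iff_borel_measurable)

lemma L2fun_mult:
  assumes "L2fun a b g" "L2fun a b h"
  shows "(\<lambda>x. g x * h x) absolutely_integrable_on {a..b}"
proof (rule measurable_bounded_by_integrable_imp_absolutely_integrable[where g = "\<lambda>x. (g x)\<^sup>2 + (h x)\<^sup>2"])
  show "(\<lambda>x. g x * h x) \<in> borel_measurable (lebesgue_on {a..b})"
    using assms L2fun_measurable by (intro borel_measurable_times)
  show "(\<lambda>x. (g x)\<^sup>2 + (h x)\<^sup>2) integrable_on {a..b}"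
    using assms by (auto simp: L2fun_def intro: integrable_add)
  fix x
  have "0 \<le> (\<bar>g x\<bar> - \<bar>h x\<bar>)\<^sup>2" "0 \<le> \<bar>g x\<bar> * \<bar>h x\<bar>" by auto
  then show "norm (g x * h x) \<le> (g x)\<^sup>2 + (h x)\<^sup>2" unfolding real_norm_def abs_mult power2_diff power2_abs by linarith
qed auto

lemma L2fun_continuous: "continuous_on {a..b} g \<Longrightarrow> L2fun a b g"
  unfolding L2fun_def
  by (auto intro!: integrable_continuous_real continuous_intros continuous_imp_measurable_on_sets_lebesgue simp: measurable_on_iff_borel_measurable)

lemma L2fun_absolutely_integrable: "L2fun a b g \<Longrightarrow> g absolutely_integrable_on {a..b}"
  using L2fun_mult[of a b g "\<lambda>_. 1"] L2fun_continuous[of a b "\<lambda>_. 1"] by simp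

lemma L2fun_diff:
  assumes g: "L2fun a b g" and h: "L2fun a b h"
  shows "L2fun a b (\<lambda>x. g x - h x)"
proof -
  have "(\<lambda>x. (g x)\<^sup>2 + (h x)\<^sup>2 - 2 * (g x * h x)) integrable_on {a..b}"
    using L2fun_mult[OF g h] g h unfolding L2fun_def absolutely_integrable_on_def
    by (intro integrable_diff integrable_add integrable_on_mult_right) auto
  then show ?thesis using g h unfolding L2fun_def by (auto intro: measurable_on_diff simp: power2_diff algebra_simps)
qed

lemma quadratic_nonneg_discriminant:
  fixes A B C :: real
  assumes "A \<ge> 0" and pos: "\<And>t. 0 \<le> A * t\<^sup>2 + 2 * B * t + C"
  shows "B\<^sup>2 \<le> A * C"
proof (cases "A = 0")
  case True
  have "B = 0"
  proof (rule ccontr)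
    assume "B \<noteq> 0"
    then show False using pos[of "- (C + 1) / (2 * B)"] True by simp
  qed
  then show ?thesis using True by simp
next
  case False
  then have "A > 0" using \<open>A \<ge> 0\<close> by simp
  have "0 \<le> A * (A * (- B / A)\<^sup>2 + 2 * B * (- B / A) + C)"
    using pos[of "- B / A"] \<open>A > 0\<close> by (intro mult_nonneg_nonneg) auto
  also have "A * (A * (- B / A)\<^sup>2 + 2 * B * (- B / A) + C) = A * C - B\<^sup>2"
    using \<open>A > 0\<close> by (simp add: power2_eq_square distrib_left right_diff_distrib)
  finally show ?thesis by simp
qed

lemma Cauchy_Schwarz_L2:
  assumes g: "L2fun a b g" and h: "L2fun a b h"
  shows "(integral {a..b} (\<lambda>x. g x * h x))\<^sup>2 \<le> integral {a..b} (\<lambda>x. (g x)\<^sup>2) * integral {a..b} (\<lambda>x. (h x)\<^sup>2)"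
proof (rule quadratic_nonneg_discriminant)
  show "0 \<le> integral {a..b} (\<lambda>x. (g x)\<^sup>2)" using g by (intro integral_nonneg) (auto simp: L2fun_def)
  fix t
  have gi: "(\<lambda>x. (g x)\<^sup>2) integrable_on {a..b}" "(\<lambda>x. (h x)\<^sup>2) integrable_on {a..b}" "(\<lambda>x. g x * h x) integrable_on {a..b}"
    using g h L2fun_mult[OF g h] by (auto simp: L2fun_def absolutely_integrable_on_def)
  have "0 \<le> integral {a..b} (\<lambda>x. (g x)\<^sup>2 * t\<^sup>2 + 2 * (g x * h x) * t + (h x)\<^sup>2)"
  proof (rule integral_nonneg)
    show "(\<lambda>x. (g x)\<^sup>2 * t\<^sup>2 + 2 * (g x * h x) * t + (h x)\<^sup>2) integrable_on {a..b}"
      by (intro integrable_add integrable_on_mult_left integrable_on_mult_right gi)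
    fix x show "0 \<le> (g x)\<^sup>2 * t\<^sup>2 + 2 * (g x * h x) * t + (h x)\<^sup>2"
      using zero_le_power2[of "g x * t + h x"] by (simp add: power2_sum power_mult_distrib algebra_simps)
  qed
  also have "\<dots> = integral {a..b} (\<lambda>x. (g x)\<^sup>2) * t\<^sup>2 + 2 * integral {a..b} (\<lambda>x. g x * h x) * t + integral {a..b} (\<lambda>x. (h x)\<^sup>2)"
  proof (rule integral_unique)
    show "((\<lambda>x. (g x)\<^sup>2 * t\<^sup>2 + 2 * (g x * h x) * t + (h x)\<^sup>2) has_integral
       integral {a..b} (\<lambda>x. (g x)\<^sup>2) * t\<^sup>2 + 2 * integral {a..b} (\<lambda>x. g x * h x) * t + integral {a..b} (\<lambda>x. (h x)\<^sup>2)) {a..b}"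
      by (intro has_integral_add has_integral_mult_left has_integral_mult_right integrable_integral gi)
  qed
  finally show "0 \<le> integral {a..b} (\<lambda>x. (g x)\<^sup>2) * t\<^sup>2 + 2 * integral {a..b} (\<lambda>x. g x * h x) * t + integral {a..b} (\<lambda>x. (h x)\<^sup>2)" .
qed

lemma integral_abs_le_L2:
  assumes g: "L2fun a b g" and ab: "a \<le> b"
  shows "integral {a..b} (\<lambda>x. \<bar>g x\<bar>) \<le> sqrt (b - a) * sqrt (integral {a..b} (\<lambda>x. (g x)\<^sup>2))"
proof -
  have "L2fun a b (\<lambda>x. \<bar>g x\<bar>)"
    using g L2fun_absolutely_integrable[OF g]
    by (auto simp: L2fun_def measurable_on_iff_borel_measurable)
  from Cauchy_Schwarz_L2[OF this L2fun_continuous[of a b "\<lambda>_. 1"]]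
  have "(integral {a..b} (\<lambda>x. \<bar>g x\<bar>))\<^sup>2 \<le> integral {a..b} (\<lambda>x. (g x)\<^sup>2) * (b - a)"
    using ab by simp
  from real_sqrt_le_mono[OF this] show ?thesis by (simp add: real_sqrt_mult mult.commute)
qed

section \<open>Sobolev functions on an interval\<close>

text \<open>A strict violation at one point persists on a nondegenerate interval, which is not
  negligible.\<close>

lemma continuous_le_ae:
  fixes f :: "real \<Rightarrow> real"
  assumes "a < b" and cf: "continuous_on {a..b} f" and cg: "continuous_on {a..b} g"
    and neg: "negligible {x\<in>{a..b}. f x > g x}" and x: "x \<in> {a..b}"
  shows "f x \<le> g x"
proof (rule ccontr)
  assume "\<not> f x \<le> g x"
  then have "0 < f x - g x" by simp
  moreover have "continuous_on {a..b} (\<lambda>x. f x - g x)" by (intro continuous_intros cf cg)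
  ultimately obtain d where d: "d > 0" "\<And>y. y \<in> {a..b} \<Longrightarrow> dist y x < d \<Longrightarrow> dist (f y - g y) (f x - g x) < f x - g x"
    using x unfolding continuous_on_iff by metis
  have "{max a (x - d/2)..min b (x + d/2)} \<subseteq> {x\<in>{a..b}. f x > g x}"
  proof
    fix y assume y: "y \<in> {max a (x - d/2)..min b (x + d/2)}"
    then have "dist (f y - g y) (f x - g x) < f x - g x" using d by (intro d(2)) (auto simp: dist_real_def)
    then show "y \<in> {x\<in>{a..b}. f x > g x}" using y by (auto simp: dist_real_def)
  qed
  from negligible_subset[OF neg this]
  show False using x d(1) \<open>a < b\<close> negligible_interval(1)[of "max a (x - d/2)" "min b (x + d/2)"] by (auto simp: box_real)
qed

definition L2n :: "real \<Rightarrow> real \<Rightarrow> (real \<Rightarrow> real) \<Rightarrow> real" where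
  "L2n a b g = sqrt (integral {a..b} (\<lambda>x. (g x)\<^sup>2))"

text \<open>Holds for every \<open>g\<close>: a square that is not integrable has
  \<open>integral\<close> 0 by convention.\<close>

lemma L2n_nonneg: "0 \<le> L2n a b g"
  unfolding L2n_def by (metis integral_nonneg not_integrable_integral real_sqrt_ge_zero order_refl zero_le_power2)

lemma continuous_eq_ae:
  fixes f :: "real \<Rightarrow> real"
  assumes "a < b" "continuous_on {a..b} f" "continuous_on {a..b} g"
    and "negligible {x\<in>{a..b}. f x \<noteq> g x}" "x \<in> {a..b}"
  shows "f x = g x"
proof -
  have "negligible {x\<in>{a..b}. f x > g x}" "negligible {x\<in>{a..b}. g x > f x}"
    by (rule negligible_subset[OF assms(4)], auto)+
  then show ?thesis using continuous_le_ae[OF assms(1,2,3) _ assms(5)] continuous_le_ae[OF assms(1,3,2) _ assms(5)] by force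
qed

text \<open>One constant for both terms of the sup bound: \<open>1 / sqrt (b - a)\<close> arises
  from averaging the function, \<open>sqrt (b - a)\<close> from the Cauchy-Schwarz bound on its
  oscillation.\<close>

definition sobolev_const :: "real \<Rightarrow> real \<Rightarrow> real" where
  "sobolev_const a b = 1 / sqrt (b - a) + sqrt (b - a)"

lemma sobolev_const_pos: "a < b \<Longrightarrow> 0 < sobolev_const a b"
  by (simp add: sobolev_const_def add_pos_pos)

text \<open>The representative is the indefinite integral of \<open>h\<close> plus the du
  Bois-Reymond constant. Averaging \<open>|G x| \<le> |G y| + integral |h|\<close> over
  \<open>y\<close> and applying Cauchy-Schwarz to both terms yields the sup bound.\<close>

lemma H1_continuous_representative:
  assumes ab: "a < b" and g: "L2fun a b g" and h: "L2fun a b h" and w: "weak_deriv a b g h"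
  obtains G where "continuous_on {a..b} G" "negligible {x\<in>{a..b}. g x \<noteq> G x}"
    "\<And>x y. a \<le> x \<Longrightarrow> x \<le> y \<Longrightarrow> y \<le> b \<Longrightarrow> G y - G x = integral {x..y} h"
    "\<And>x. x \<in> {a..b} \<Longrightarrow> \<bar>G x\<bar> \<le> sobolev_const a b * (L2n a b g + L2n a b h)"
proof -
  note ga = L2fun_absolutely_integrable[OF g] and ha = L2fun_absolutely_integrable[OF h]
  obtain c where c: "negligible {x\<in>{a..b}. g x \<noteq> c + integral {a..x} h}"
    using du_Bois_Reymond[OF ab ga ha w] by blast
  define G where "G x = c + integral {a..x} h" for x
  have hi: "h integrable_on {a..b}" "(\<lambda>x. \<bar>h x\<bar>) integrable_on {a..b}" using ha unfolding absolutely_integrable_on_def by auto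
  have cG: "continuous_on {a..b} G" unfolding G_def
    by (intro continuous_intros indefinite_integral_continuous_1[OF hi(1)])
  have Gd: "G y - G x = integral {x..y} h" if "a \<le> x" "x \<le> y" "y \<le> b" for x y
    using integral_Icc_diff[OF hi(1) that] by (simp add: G_def)
  have Gd2: "\<bar>G y - G x\<bar> \<le> integral {a..b} (\<lambda>x. \<bar>h x\<bar>)" if "a \<le> x" "x \<le> y" "y \<le> b" for x y
  proof -
    have s: "{x..y} \<subseteq> {a..b}" using that by auto
    have hi': "h integrable_on {x..y}" "(\<lambda>x. \<bar>h x\<bar>) integrable_on {x..y}"
      using integrable_subinterval_real[OF hi(1) s] integrable_subinterval_real[OF hi(2) s] by auto
    have "\<bar>G y - G x\<bar> \<le> integral {x..y} (\<lambda>x. \<bar>h x\<bar>)"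
      unfolding Gd[OF that] using hi' by (intro integral_abs_bound_integral) auto
    also have "\<dots> \<le> integral {a..b} (\<lambda>x. \<bar>h x\<bar>)"
      using s hi hi' by (intro integral_subset_le) auto
    finally show ?thesis .
  qed
  have "\<bar>G x\<bar> \<le> sobolev_const a b * (L2n a b g + L2n a b h)" if x: "x \<in> {a..b}" for x
  proof -
    let ?h = "integral {a..b} (\<lambda>x. \<bar>h x\<bar>)"
    have "\<bar>G x\<bar> - ?h \<le> \<bar>G y\<bar>" if "y \<in> {a..b}" for y
      using Gd2[of x y] Gd2[of y x] x that by (cases "x \<le> y") auto
    then have "integral {a..b} (\<lambda>y. \<bar>G x\<bar> - ?h) \<le> integral {a..b} (\<lambda>y. \<bar>G y\<bar>)"
      by (intro integral_le integrable_continuous_real continuous_intros cG) auto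
    also have "integral {a..b} (\<lambda>y. \<bar>G y\<bar>) = integral {a..b} (\<lambda>y. \<bar>g y\<bar>)"
      by (rule integral_spike[OF c]) (auto simp: G_def)
    finally have "(b - a) * \<bar>G x\<bar> \<le> integral {a..b} (\<lambda>y. \<bar>g y\<bar>) + (b - a) * ?h"
      using ab by (simp add: algebra_simps)
    also have "\<dots> \<le> sqrt (b - a) * L2n a b g + (b - a) * (sqrt (b - a) * L2n a b h)"
      unfolding L2n_def using ab by (intro add_mono mult_left_mono integral_abs_le_L2 g h) auto
    finally have "(b - a) * \<bar>G x\<bar> \<le> (b - a) * (1 / sqrt (b - a) * L2n a b g + sqrt (b - a) * L2n a b h)"
      using ab real_div_sqrt[of "b - a"] by (simp add: distrib_left) (simp flip: times_divide_eq_left)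
    then have "\<bar>G x\<bar> \<le> 1 / sqrt (b - a) * L2n a b g + sqrt (b - a) * L2n a b h"
      using ab by (simp only: mult_le_cancel_left_pos diff_gt_0_iff_gt)
    also have "\<dots> \<le> sobolev_const a b * L2n a b g + sobolev_const a b * L2n a b h"
      using ab by (intro add_mono mult_right_mono L2n_nonneg) (auto simp: sobolev_const_def)
    finally show ?thesis by (simp add: distrib_left)
  qed
  then show ?thesis using that[OF cG _ Gd] c by (auto simp: G_def)
qed

lemma cc_test_continuous:
  assumes "cc_test a b \<phi>"
  shows "continuous_on S \<phi>" "continuous_on S (deriv \<phi>)"
proof -
  have s: "smooth \<phi>" using assms by (simp add: cc_test_def smooth_def)
  show "continuous_on S \<phi>" "continuous_on S (deriv \<phi>)"
    using smooth_differentiable[OF s] smooth_differentiable[OF smooth_deriv[OF s]]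
    by (auto intro!: continuous_at_imp_continuous_on differentiable_imp_continuous_within)
qed

lemma weak_deriv_diff:
  assumes g: "L2fun a b g" "L2fun a b h" "weak_deriv a b g h"
    and g': "L2fun a b g'" "L2fun a b h'" "weak_deriv a b g' h'"
  shows "weak_deriv a b (\<lambda>x. g x - g' x) (\<lambda>x. h x - h' x)"
  unfolding weak_deriv_def
proof (intro allI impI)
  fix \<phi> assume \<phi>: "cc_test a b \<phi>"
  have i: "(\<lambda>x. f x * \<psi> x) integrable_on {a..b}" if "L2fun a b f" "continuous_on {a..b} \<psi>" for f \<psi>
    using L2fun_mult[OF that(1) L2fun_continuous[OF that(2)]] by (simp add: absolutely_integrable_on_def)
  have "integral {a..b} (\<lambda>x. (g x - g' x) * deriv \<phi> x) = integral {a..b} (\<lambda>x. g x * deriv \<phi> x) - integral {a..b} (\<lambda>x. g' x * deriv \<phi> x)"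
    unfolding left_diff_distrib by (intro HK_integral_diff i g g' cc_test_continuous[OF \<phi>])
  moreover have "integral {a..b} (\<lambda>x. (h x - h' x) * \<phi> x) = integral {a..b} (\<lambda>x. h x * \<phi> x) - integral {a..b} (\<lambda>x. h' x * \<phi> x)"
    unfolding left_diff_distrib by (intro HK_integral_diff i g g' cc_test_continuous[OF \<phi>])
  ultimately show "integral {a..b} (\<lambda>x. (g x - g' x) * deriv \<phi> x) = - integral {a..b} (\<lambda>x. (h x - h' x) * \<phi> x)"
    using g(3) g'(3) \<phi> unfolding weak_deriv_def by simp
qed

text \<open>Needed so that the sup bounds apply to time increments of the solution.\<close>

lemma in_H_diff:
  assumes "in_H a b k g" "in_H a b k g'"
  shows "in_H a b k (\<lambda>x. g x - g' x)"
proof -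
  obtain D D' where D: "Hders a b k g D" "Hders a b k g' D'" using assms by (auto simp: in_H_def)
  have "Hders a b k (\<lambda>x. g x - g' x) (\<lambda>j x. D j x - D' j x)"
    using D unfolding Hders_def by (auto intro!: L2fun_diff weak_deriv_diff)
  then show ?thesis by (auto simp: in_H_def)
qed

text \<open>Exposes the very family that \<open>Hnorm\<close> selects, so that the norm directly
  controls the weak derivatives in use.\<close>

lemma in_H_Hnorm:
  assumes "in_H a b k g"
  obtains D where "Hders a b k g D" "\<And>j. j \<le> k \<Longrightarrow> L2n a b (D j) \<le> Hnorm a b k g"
proof -
  define D where "D = (SOME D. Hders a b k g D)"
  have D: "Hders a b k g D" unfolding D_def using assms unfolding in_H_def by (rule someI_ex)
  have "L2n a b (D j) \<le> Hnorm a b k g" if "j \<le> k" for j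
    unfolding L2n_def Hnorm_def D_def[symmetric]
    using that L2n_nonneg[of a b "D _", unfolded L2n_def]
    by (intro real_sqrt_le_mono member_le_sum) auto
  then show ?thesis using that D by blast
qed

lemma H1_Hnorm_sup:
  assumes ab: "a < b" and g: "in_H a b 1 g"
  obtains G where "continuous_on {a..b} G" "negligible {x\<in>{a..b}. g x \<noteq> G x}"
    "\<And>x. x \<in> {a..b} \<Longrightarrow> \<bar>G x\<bar> \<le> 2 * sobolev_const a b * Hnorm a b 1 g"
proof -
  obtain D where D: "Hders a b 1 g D" and n: "\<And>j. j \<le> 1 \<Longrightarrow> L2n a b (D j) \<le> Hnorm a b 1 g"
    using in_H_Hnorm[OF g] by blast
  have "L2fun a b g" "L2fun a b (D 1)" "weak_deriv a b g (D 1)" "D 0 = g"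
    using D unfolding Hders_def by auto
  then obtain G where G: "continuous_on {a..b} G" "negligible {x\<in>{a..b}. g x \<noteq> G x}"
    "\<And>x. x \<in> {a..b} \<Longrightarrow> \<bar>G x\<bar> \<le> sobolev_const a b * (L2n a b g + L2n a b (D 1))"
    using H1_continuous_representative[OF ab, of g "D 1"] by metis
  have "sobolev_const a b * (L2n a b g + L2n a b (D 1)) \<le> sobolev_const a b * (2 * Hnorm a b 1 g)"
    using n[of 0] n[of 1] \<open>D 0 = g\<close> sobolev_const_pos[OF ab] by (intro mult_left_mono) auto
  then show ?thesis using that[OF G(1,2)] G(3) by (simp add: mult_ac) (meson order_trans)
qed

text \<open>The weak derivative \<open>h\<close> has a continuous representative \<open>H\<close>,
  and \<open>g\<close> equals \<open>g a\<close> plus the integral of \<open>H\<close> at every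
  point, both sides being continuous. Hence the pointwise derivative is \<open>H\<close>.\<close>

lemma H2_classical_derivative:
  assumes ab: "a < b" and g: "L2fun a b g" and h: "L2fun a b h" and k: "L2fun a b k"
    and w: "weak_deriv a b g h" "weak_deriv a b h k"
    and d: "\<And>x. x \<in> {a..b} \<Longrightarrow> (g has_real_derivative g' x) (at x within {a..b})"
  shows "continuous_on {a..b} g'" "negligible {x\<in>{a..b}. h x \<noteq> g' x}"
    "\<And>x. x \<in> {a..b} \<Longrightarrow> \<bar>g' x\<bar> \<le> sobolev_const a b * (L2n a b h + L2n a b k)"
proof -
  obtain G where G: "continuous_on {a..b} G" "negligible {x\<in>{a..b}. g x \<noteq> G x}"
    "\<And>x y. a \<le> x \<Longrightarrow> x \<le> y \<Longrightarrow> y \<le> b \<Longrightarrow> G y - G x = integral {x..y} h"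
    using H1_continuous_representative[OF ab g h w(1)] by metis
  obtain H where H: "continuous_on {a..b} H" "negligible {x\<in>{a..b}. h x \<noteq> H x}"
    "\<And>x. x \<in> {a..b} \<Longrightarrow> \<bar>H x\<bar> \<le> sobolev_const a b * (L2n a b h + L2n a b k)"
    using H1_continuous_representative[OF ab h k w(2)] by metis
  have gG: "g x = G x" if "x \<in> {a..b}" for x
    using continuous_eq_ae[OF ab _ G(1,2) that] d DERIV_continuous_on by blast
  have hH: "integral {a..x} h = integral {a..x} H" if "x \<in> {a..b}" for x
    by (rule integral_spike[OF H(2)]) (use that in auto)
  have "g' x = H x" if x: "x \<in> {a..b}" for x
  proof -
    have "((\<lambda>x. integral {a..x} H) has_real_derivative H x) (at x within {a..b})"
      using integral_has_real_derivative[OF H(1) x] by simp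
    then have "((\<lambda>x. g a + integral {a..x} H) has_real_derivative H x) (at x within {a..b})"
      by (auto intro!: derivative_eq_intros)
    then have "(g has_real_derivative H x) (at x within {a..b})"
    proof (rule has_field_derivative_transform_within[OF _ zero_less_one x])
      fix y assume "y \<in> {a..b}" "dist y x < 1"
      then show "g a + integral {a..y} H = g y"
        using gG[of y] gG[of a] G(3)[of a y] hH[of y] ab by auto
    qed
    then show ?thesis using d[OF x] x ab vector_derivative_unique_within_closed_interval[of a b x g]
      by (simp add: has_real_derivative_iff_has_vector_derivative)
  qed
  note eq = this
  show "continuous_on {a..b} g'" using H(1) continuous_on_cong[OF refl, of "{a..b}" g' H] eq by blast
  show "negligible {x\<in>{a..b}. h x \<noteq> g' x}" by (rule negligible_subset[OF H(2)]) (use eq in auto)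
  show "\<bar>g' x\<bar> \<le> sobolev_const a b * (L2n a b h + L2n a b k)" if "x \<in> {a..b}" for x
    using H(3) eq that by simp
qed

lemma weak_deriv_spike:
  assumes "weak_deriv a b g h" "negligible {x\<in>{a..b}. g x \<noteq> g' x}"
  shows "weak_deriv a b g' h"
proof -
  have "integral {a..b} (\<lambda>x. g' x * deriv \<phi> x) = integral {a..b} (\<lambda>x. g x * deriv \<phi> x)" for \<phi>
    by (rule integral_spike[OF assms(2)]) auto
  then show ?thesis using assms(1) by (simp add: weak_deriv_def)
qed

text \<open>The \<open>H^2\<close> argument twice: applied to \<open>g\<close> it identifies
  \<open>D 1\<close> with \<open>g'\<close> almost everywhere, after which \<open>g'\<close> may
  replace \<open>D 1\<close> as the function to be differentiated.\<close>

lemma H3_classical_derivatives: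
  assumes ab: "a < b" and g: "in_H a b 3 g"
    and d: "\<And>x. x \<in> {a..b} \<Longrightarrow> (g has_real_derivative g' x) (at x within {a..b})"
    and d2: "\<And>x. x \<in> {a..b} \<Longrightarrow> (g' has_real_derivative g'' x) (at x within {a..b})"
  shows "continuous_on {a..b} g''"
    "\<And>x. x \<in> {a..b} \<Longrightarrow> \<bar>g'' x\<bar> \<le> 2 * sobolev_const a b * Hnorm a b 3 g"
proof -
  obtain D where D: "Hders a b 3 g D" and n: "\<And>j. j \<le> 3 \<Longrightarrow> L2n a b (D j) \<le> Hnorm a b 3 g"
    using in_H_Hnorm[OF g] by blast
  have D': "D 0 = g" "L2fun a b (D 0)" "L2fun a b (D 1)" "L2fun a b (D 2)" "L2fun a b (D 3)"
    "weak_deriv a b (D 0) (D 1)" "weak_deriv a b (D 1) (D 2)" "weak_deriv a b (D 2) (D 3)"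
    using D unfolding Hders_def by (auto simp: eval_nat_numeral)
  have c1: "continuous_on {a..b} g'" "negligible {x\<in>{a..b}. D 1 x \<noteq> g' x}"
    using H2_classical_derivative(1,2)[OF ab D'(2,3,4,6,7), unfolded D'(1)] d by blast+
  have w: "weak_deriv a b g' (D 2)" by (rule weak_deriv_spike[OF D'(7) c1(2)])
  note c2 = H2_classical_derivative[OF ab L2fun_continuous[OF c1(1)] D'(4,5) w D'(8)]
  show "continuous_on {a..b} g''" using c2(1) d2 by blast
  have "sobolev_const a b * (L2n a b (D 2) + L2n a b (D 3)) \<le> sobolev_const a b * (2 * Hnorm a b 3 g)"
    using n[of 2] n[of 3] sobolev_const_pos[OF ab] by (intro mult_left_mono) auto
  then show "\<bar>g'' x\<bar> \<le> 2 * sobolev_const a b * Hnorm a b 3 g" if "x \<in> {a..b}" for x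
    using c2(3)[OF d2 that] by simp
qed

section \<open>Time increments and Fubini\<close>

text \<open>Freezing the second argument at the grid point below it, with mesh
  \<open>1 / (n + 1)\<close>, gives functions built from countably many measurable slices;
  continuity in the second variable makes them converge pointwise.\<close>

lemma borel_measurable_separately_continuous:
  fixes U :: "real \<Rightarrow> real \<Rightarrow> real"
  assumes c1: "\<And>s. continuous_on UNIV (\<lambda>x. U x s)" and c2: "\<And>x. continuous_on UNIV (U x)"
  shows "(\<lambda>p. U (fst p) (snd p)) \<in> borel_measurable (lborel \<Otimes>\<^sub>M lborel)"
proof (rule borel_measurable_LIMSEQ_real)
  fix p :: "real \<times> real"
  have "(\<lambda>n. of_int \<lfloor>real (Suc n) * snd p\<rfloor> / real (Suc n)) \<longlonglongrightarrow> snd p"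
  proof (rule LIMSEQ_I)
    fix e :: real assume "e > 0"
    then obtain N where N: "inverse (real (Suc N)) < e" using reals_Archimedean by blast
    have "norm (of_int \<lfloor>real (Suc n) * snd p\<rfloor> / real (Suc n) - snd p) < e" if "n \<ge> N" for n
    proof -
      have "\<bar>of_int \<lfloor>real (Suc n) * snd p\<rfloor> - real (Suc n) * snd p\<bar> \<le> 1" by linarith
      then have "\<bar>of_int \<lfloor>real (Suc n) * snd p\<rfloor> - real (Suc n) * snd p\<bar> / real (Suc n) \<le> inverse (real (Suc n))"
        by (simp add: divide_simps)
      moreover have "of_int \<lfloor>real (Suc n) * snd p\<rfloor> / real (Suc n) - snd p =
          (of_int \<lfloor>real (Suc n) * snd p\<rfloor> - real (Suc n) * snd p) / real (Suc n)"
        by (simp add: diff_divide_distrib del: of_nat_Suc)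
      moreover have "inverse (real (Suc n)) \<le> inverse (real (Suc N))" using that by simp
      ultimately show ?thesis using N by (simp only: real_norm_def abs_divide abs_of_nat)
    qed
    then show "\<exists>no. \<forall>n\<ge>no. norm (of_int \<lfloor>real (Suc n) * snd p\<rfloor> / real (Suc n) - snd p) < e" by blast
  qed
  moreover have "isCont (U (fst p)) (snd p)" using c2 by (simp add: continuous_on_eq_continuous_at)
  ultimately show "(\<lambda>n. U (fst p) (of_int \<lfloor>real (Suc n) * snd p\<rfloor> / real (Suc n))) \<longlonglongrightarrow> U (fst p) (snd p)"
    by (rule isCont_tendsto_compose[rotated])
next
  fix n
  have m: "(\<lambda>p. U (fst p) (of_int i / real (Suc n))) \<in> borel_measurable (lborel \<Otimes>\<^sub>M lborel)" for i :: int
  proof -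
    have "(\<lambda>x. U x (of_int i / real (Suc n))) \<in> borel_measurable lborel"
      using borel_measurable_continuous_onI[OF c1] by simp
    from measurable_compose[OF measurable_fst this] show ?thesis .
  qed
  show "(\<lambda>p. U (fst p) (of_int \<lfloor>real (Suc n) * snd p\<rfloor> / real (Suc n))) \<in> borel_measurable (lborel \<Otimes>\<^sub>M lborel)"
    by (rule measurable_compose_countable[where f = "\<lambda>i p. U (fst p) (of_int i / real (Suc n))", OF m]) measurable
qed

text \<open>Weak derivatives are compared up to negligible sets, while Fubini speaks of almost every
  point of \<open>lborel\<close>; this lemma and the next translate between the two.\<close>

lemma negligible_imp_AE_lborel:
  assumes "negligible {x\<in>S. \<not> P x}"
  shows "AE x in lborel. x \<in> S \<longrightarrow> P x"
proof -
  have "AE x in lebesgue. x \<notin> {x\<in>S. \<not> P x}"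
    using assms by (intro AE_not_in) (simp add: negligible_iff_null_sets)
  then have "AE x in lebesgue. x \<in> S \<longrightarrow> P x" by eventually_elim auto
  then show ?thesis by (simp add: AE_completion_iff)
qed

lemma AE_lborel_imp_negligible:
  assumes "AE x in lborel. x \<in> S \<longrightarrow> P x"
  shows "negligible {x\<in>S. \<not> P x}"
proof -
  obtain N where N: "{x \<in> space lborel. \<not> (x \<in> S \<longrightarrow> P x)} \<subseteq> N" "N \<in> null_sets lborel"
    using assms unfolding eventually_ae_filter by blast
  have "negligible N" unfolding negligible_iff_null_sets by (rule null_sets_completionI[OF N(2)])
  then show ?thesis by (rule negligible_subset) (use N(1) in \<open>simp add: subset_eq\<close>)
qed

text \<open>Fubini turns the bound for almost every \<open>x\<close> at each time into a bound for almost every time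
  at almost every \<open>x\<close>, which can be integrated in time.\<close>

lemma increment_bound_ae:
  fixes u ut :: "real \<Rightarrow> real \<Rightarrow> real"
  assumes ab: "a < b"
    and du: "\<And>x s. x \<in> {a..b} \<Longrightarrow> 0 \<le> s \<Longrightarrow> (u x has_real_derivative ut x s) (at s within {0..})"
    and cu: "\<And>s. 0 \<le> s \<Longrightarrow> continuous_on {a..b} (\<lambda>x. u x s)"
    and cG: "continuous_on {a..b} G"
    and ae: "\<And>s. s \<in> {s1..s2} \<Longrightarrow> negligible {x\<in>{a..b}. \<not> \<bar>ut x s - G x\<bar> \<le> \<eta>}"
    and s: "0 \<le> s1" "s1 \<le> s2" and x: "x \<in> {a..b}"
  shows "\<bar>u x s2 - u x s1 - (s2 - s1) * G x\<bar> \<le> \<eta> * (s2 - s1)"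
proof -
  \<comment> \<open>Clamping \<open>x\<close> to \<open>{a..b}\<close> and \<open>s\<close> to
    nonnegative times extends \<open>u\<close> to the whole plane with continuity in each variable,
    which yields joint measurability.\<close>
  define cl where "cl x = max a (min b x)" for x
  have cl: "cl x \<in> {a..b}" "continuous_on T cl" for x T
    unfolding cl_def using ab by (auto intro!: continuous_intros)
  have cl_id: "cl x = x" if "x \<in> {a..b}" for x using that by (auto simp: cl_def)
  define U where "U x s = u (cl x) (max s 0)" for x s
  have cU1: "continuous_on UNIV (\<lambda>x. U x s)" for s
    unfolding U_def by (rule continuous_on_compose2[OF cu cl(2)]) (use cl in auto)
  have cU2: "continuous_on UNIV (U x)" for x
  proof -
    have "continuous_on {0..} (u (cl x))" using du cl(1) DERIV_continuous_on by (metis atLeast_iff)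
    then show ?thesis unfolding U_def by (rule continuous_on_compose2) (auto intro!: continuous_intros)
  qed
  have mU: "(\<lambda>p. U (fst p) (snd p)) \<in> borel_measurable (lborel \<Otimes>\<^sub>M lborel)"
    by (rule borel_measurable_separately_continuous[OF cU1 cU2])
  \<comment> \<open>A jointly measurable version of \<open>ut\<close>: the limit of difference
    quotients along one fixed sequence. The increments are positive, so that \<open>s = 0\<close> is
    covered.\<close>
  define V where "V x s = lim (\<lambda>n. (U x (s + inverse (real (Suc n))) - U x s) / inverse (real (Suc n)))" for x s
  have V: "V x s = ut x s" if "x \<in> {a..b}" "0 \<le> s" for x s
  proof -
    have "((\<lambda>z. (u x z - u x s) / (z - s)) \<longlongrightarrow> ut x s) (at s within {0..})"
      using du[OF that] by (simp add: has_field_derivative_iff)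
    moreover have "filterlim (\<lambda>n. s + inverse (real (Suc n))) (at s within {0..}) sequentially"
      unfolding filterlim_at
    proof
      show "\<forall>\<^sub>F n in sequentially. s + inverse (real (Suc n)) \<in> {0..} \<and> s + inverse (real (Suc n)) \<noteq> s"
        using that by (intro always_eventually) (auto simp: add_nonneg_nonneg simp del: of_nat_Suc)
      show "(\<lambda>n. s + inverse (real (Suc n))) \<longlonglongrightarrow> s"
        using tendsto_add[OF tendsto_const LIMSEQ_inverse_real_of_nat, of s] by simp
    qed
    ultimately have "(\<lambda>n. (u x (s + inverse (real (Suc n))) - u x s) / (s + inverse (real (Suc n)) - s)) \<longlonglongrightarrow> ut x s"
      by (rule filterlim_compose)
    moreover have "max (s + inverse (real (Suc n))) 0 = s + inverse (real (Suc n))" for n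
      using that by (simp add: max_def) (smt (verit) inverse_nonnegative_iff_nonnegative of_nat_0_le_iff)
    ultimately show ?thesis using that unfolding V_def U_def
      by (intro limI) (simp add: cl_id)
  qed
  have mU': "(\<lambda>p. U (fst p) (snd p + c)) \<in> borel_measurable (lborel \<Otimes>\<^sub>M lborel)" for c
  proof -
    have "continuous_on UNIV (\<lambda>s. U x (s + c))" for x
      by (rule continuous_on_compose2[OF cU2]) (auto intro!: continuous_intros)
    from borel_measurable_separately_continuous[OF _ this] cU1 show ?thesis by simp
  qed
  have mV: "(\<lambda>p. V (fst p) (snd p)) \<in> borel_measurable (lborel \<Otimes>\<^sub>M lborel)"
    unfolding V_def by (intro borel_measurable_lim_metric borel_measurable_divide borel_measurable_diff mU mU' borel_measurable_const)
  define P where "P x s \<longleftrightarrow> (x \<in> {a..b} \<longrightarrow> s \<in> {s1..s2} \<longrightarrow> \<bar>V x s - G (cl x)\<bar> \<le> \<eta>)" for x s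
  have mG: "(\<lambda>p. G (cl (fst p))) \<in> borel_measurable (lborel \<Otimes>\<^sub>M lborel)"
  proof -
    have "continuous_on UNIV (\<lambda>x. G (cl x))"
      by (rule continuous_on_compose2[OF cG cl(2)]) (use cl in auto)
    then have "(\<lambda>x. G (cl x)) \<in> borel_measurable lborel"
      using borel_measurable_continuous_onI by simp
    from measurable_compose[OF measurable_fst this] show ?thesis .
  qed
  have "{p \<in> space (lborel \<Otimes>\<^sub>M lborel). P (fst p) (snd p)} \<in> sets (lborel \<Otimes>\<^sub>M lborel)"
  proof -
    let ?M = "lborel \<Otimes>\<^sub>M lborel :: (real \<times> real) measure"
    have "(\<lambda>p. \<bar>V (fst p) (snd p) - G (cl (fst p))\<bar>) \<in> borel_measurable ?M"
      by (intro borel_measurable_abs borel_measurable_diff mV mG)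
    then have "{p \<in> space ?M. \<bar>V (fst p) (snd p) - G (cl (fst p))\<bar> \<le> \<eta>} \<in> sets ?M"
      by (rule borel_measurable_le) simp
    moreover have "{a..b} \<times> {s1..s2} \<in> sets ?M" by (intro pair_measureI) auto
    ultimately have "{p \<in> space ?M. \<bar>V (fst p) (snd p) - G (cl (fst p))\<bar> \<le> \<eta>} \<union> (space ?M - {a..b} \<times> {s1..s2}) \<in> sets ?M"
      by blast
    also have "{p \<in> space ?M. \<bar>V (fst p) (snd p) - G (cl (fst p))\<bar> \<le> \<eta>} \<union> (space ?M - {a..b} \<times> {s1..s2})
        = {p \<in> space ?M. P (fst p) (snd p)}"
      by (auto simp: P_def)
    finally show ?thesis .
  qed
  then have comm: "(AE x in lborel. AE s in lborel. P x s) \<longleftrightarrow> (AE s in lborel. AE x in lborel. P x s)"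
    by (rule lborel_pair.AE_commute)
  have "AE x in lborel. P x s" for s
  proof (cases "s \<in> {s1..s2}")
    case True
    have "AE x in lborel. x \<in> {a..b} \<longrightarrow> \<bar>ut x s - G x\<bar> \<le> \<eta>"
      by (rule negligible_imp_AE_lborel[OF ae[OF True]])
    then show ?thesis by eventually_elim (use True assms(6,7) V cl_id s in \<open>auto simp: P_def\<close>)
  qed (auto simp: P_def intro!: AE_I2)
  then have "AE x in lborel. AE s in lborel. P x s" using comm by simp
  then have good: "AE x in lborel. x \<in> {a..b} \<longrightarrow> \<bar>u x s2 - u x s1 - (s2 - s1) * G x\<bar> \<le> \<eta> * (s2 - s1)"
  proof eventually_elim
    case (elim x)
    show ?case
    proof
      assume x: "x \<in> {a..b}"
      have "AE s in lborel. s \<in> {s1..s2} \<longrightarrow> \<bar>ut x s - G x\<bar> \<le> \<eta>"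
        using elim
      proof eventually_elim
        case (elim s)
        then show ?case using x V[OF x, of s] cl_id[OF x] \<open>0 \<le> s1\<close> by (auto simp: P_def)
      qed
      from AE_lborel_imp_negligible[OF this]
      have neg: "negligible {s \<in> {s1..s2}. \<not> \<bar>ut x s - G x\<bar> \<le> \<eta>}" .
      have "((\<lambda>s. ut x s - G x) has_integral (u x s2 - s2 * G x) - (u x s1 - s1 * G x)) {s1..s2}"
      proof (rule fundamental_theorem_of_calculus[OF s(2)])
        fix z assume z: "z \<in> {s1..s2}"
        have "(u x has_real_derivative ut x z) (at z within {s1..s2})"
          using du[OF x, of z] z s by (auto intro: has_field_derivative_subset)
        then show "((\<lambda>s. u x s - s * G x) has_vector_derivative ut x z - G x) (at z within {s1..s2})"
          unfolding has_real_derivative_iff_has_vector_derivative[symmetric]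
          by (auto intro!: derivative_eq_intros)
      qed
      then have "((\<lambda>s. if \<bar>ut x s - G x\<bar> \<le> \<eta> then ut x s - G x else 0) has_integral (u x s2 - s2 * G x) - (u x s1 - s1 * G x)) {s1..s2}"
        by (rule has_integral_spike[OF neg, rotated]) auto
      \<comment> \<open>Otherwise the exceptional set at time \<open>s1\<close> would be all of
        \<open>{a..b}\<close>.\<close>
      moreover have "0 \<le> \<eta>"
      proof (rule ccontr)
        assume "\<not> 0 \<le> \<eta>"
        then have "{x\<in>{a..b}. \<not> \<bar>ut x s1 - G x\<bar> \<le> \<eta>} = {a..b}" by auto
        then show False using ae[of s1] s negligible_interval(1)[of a b] ab by auto
      qed
      ultimately have "norm ((u x s2 - s2 * G x) - (u x s1 - s1 * G x)) \<le> \<eta> * measure lborel (cbox s1 s2)"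
        by (intro has_integral_bound) auto
      then show "\<bar>u x s2 - u x s1 - (s2 - s1) * G x\<bar> \<le> \<eta> * (s2 - s1)" using s by (simp add: algebra_simps)
    qed
  qed
  \<comment> \<open>The bound holds for almost every \<open>x\<close>, and its two sides are
    continuous in \<open>x\<close>.\<close>
  show ?thesis
  proof (rule continuous_le_ae[OF ab _ _ _ x, where g = "\<lambda>_. \<eta> * (s2 - s1)"])
    show "continuous_on {a..b} (\<lambda>x. \<bar>u x s2 - u x s1 - (s2 - s1) * G x\<bar>)"
      using s by (intro continuous_intros cu cG) auto
    show "negligible {x \<in> {a..b}. \<eta> * (s2 - s1) < \<bar>u x s2 - u x s1 - (s2 - s1) * G x\<bar>}"
      using AE_lborel_imp_negligible[OF good] by (simp add: not_le)
  qed auto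
qed

section \<open>Regularity of solutions\<close>

lemma tendsto_integral_uniform_limit:
  fixes f :: "'c \<Rightarrow> real \<Rightarrow> real"
  assumes u: "uniform_limit {a..b} f g F" and f: "\<forall>\<^sub>F n in F. continuous_on {a..b} (f n)"
    and g: "continuous_on {a..b} g" and ab: "a < b"
  shows "((\<lambda>n. integral {a..b} (f n)) \<longlongrightarrow> integral {a..b} g) F"
proof (rule tendstoI)
  fix e :: real assume "e > 0"
  then have "\<forall>\<^sub>F n in F. \<forall>x\<in>{a..b}. dist (f n x) (g x) < e / (2 * (b - a))"
    using ab by (intro uniform_limitD[OF u]) auto
  with f show "\<forall>\<^sub>F n in F. dist (integral {a..b} (f n)) (integral {a..b} g) < e"
  proof eventually_elim
    case (elim n)
    have i: "f n integrable_on {a..b}" "g integrable_on {a..b}" using elim g by (auto intro: integrable_continuous_real)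
    have "\<bar>integral {a..b} (\<lambda>x. f n x - g x)\<bar> \<le> integral {a..b} (\<lambda>x. e / (2 * (b - a)))"
      using elim i by (intro integral_abs_bound_integral integrable_diff) (auto simp: dist_real_def less_imp_le)
    also have "\<dots> = (b - a) * (e / (2 * (b - a)))" using ab by simp
    also have "\<dots> = e / 2" using ab by (simp add: field_simps)
    finally show ?case using i \<open>e > 0\<close> by (simp add: dist_real_def HK_integral_diff)
  qed
qed

lemma uniform_limit_mult_continuous:
  fixes f g :: "'c \<Rightarrow> real \<Rightarrow> real"
  assumes "uniform_limit {a..b} f l F" "uniform_limit {a..b} g m F"
    and "continuous_on {a..b} l" "continuous_on {a..b} m"
  shows "uniform_limit {a..b} (\<lambda>n x. f n x * g n x) (\<lambda>x. l x * m x) F"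
  using assms by (intro uniform_lim_mult compact_imp_bounded compact_continuous_image compact_Icc) auto

text \<open>By the mean value theorem each quotient is a value \<open>f' x \<xi>\<close> with
  \<open>\<xi>\<close> between \<open>s\<close> and \<open>t\<close>. The point \<open>\<xi>\<close>
  depends on \<open>x\<close>, but its distance from \<open>t\<close> is at most that of
  \<open>s\<close>.\<close>

lemma uniform_limit_quotient:
  fixes f f' :: "real \<Rightarrow> real \<Rightarrow> real"
  assumes d: "\<And>x s. x \<in> S \<Longrightarrow> 0 \<le> s \<Longrightarrow> (f x has_real_derivative f' x s) (at s within {0..})"
    and t: "0 \<le> t"
    and u: "uniform_limit S (\<lambda>s x. f' x s) (\<lambda>x. f' x t) (at t within {0..})"
  shows "uniform_limit S (\<lambda>s x. (f x s - f x t) / (s - t)) (\<lambda>x. f' x t) (at t within {0..})"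
proof (rule uniform_limitI)
  fix e :: real assume "e > 0"
  from uniform_limitD[OF u this] obtain \<delta> where \<delta>: "\<delta> > 0"
    "\<And>s x. 0 \<le> s \<Longrightarrow> s \<noteq> t \<Longrightarrow> dist s t < \<delta> \<Longrightarrow> x \<in> S \<Longrightarrow> dist (f' x s) (f' x t) < e"
    unfolding eventually_at by (metis atLeast_iff)
  have "dist ((f x s - f x t) / (s - t)) (f' x t) < e" if s: "0 \<le> s" "s \<noteq> t" "dist s t < \<delta>" and x: "x \<in> S" for s x
  proof -
    have "\<exists>\<xi>. min s t < \<xi> \<and> \<xi> < max s t \<and> f x (max s t) - f x (min s t) = (max s t - min s t) * f' x \<xi>"
    proof -
      have "\<exists>z>min s t. z < max s t \<and> f x (max s t) - f x (min s t) = (max s t - min s t) * f' x z"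
      proof -
        have "(f x has_derivative (*) (f' x z)) (at z within {min s t..max s t})"
          if "min s t \<le> z" "z \<le> max s t" for z
          unfolding has_field_derivative_def[symmetric]
          using s t that by (intro has_field_derivative_subset[OF d[OF x, of z]]) auto
        moreover have "min s t < max s t" using s by auto
        ultimately show ?thesis using mvt_simple[of "min s t" "max s t" "f x" "\<lambda>z. (*) (f' x z)"]
          by (auto simp: mult.commute)
      qed
      then show ?thesis by blast
    qed
    then obtain \<xi> where \<xi>: "min s t < \<xi>" "\<xi> < max s t" "f x (max s t) - f x (min s t) = (max s t - min s t) * f' x \<xi>" by blast
    then have "(f x s - f x t) / (s - t) = f' x \<xi>"
      using s by (cases "s < t") (auto simp: divide_simps algebra_simps)
    then show ?thesis using \<delta>(2)[of \<xi> x] \<xi> s t x by (auto simp: dist_real_def)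
  qed
  then show "\<forall>\<^sub>F s in at t within {0..}. \<forall>x\<in>S. dist ((f x s - f x t) / (s - t)) (f' x t) < e"
    using \<delta>(1) unfolding eventually_at by auto
qed

lemma C3_D:
  assumes "C3 W"
  shows "(W has_real_derivative deriv W x) (at x)" "(deriv W has_real_derivative deriv (deriv W) x) (at x)"
    "continuous_on S W" "continuous_on S (deriv W)" "continuous_on S (deriv (deriv W))"
proof -
  have *: "(f has_real_derivative deriv f x) (at x)" if "f differentiable (at x)" for f :: "real \<Rightarrow> real" and x
    using that DERIV_deriv_iff_real_differentiable by blast
  show "(W has_real_derivative deriv W x) (at x)" "(deriv W has_real_derivative deriv (deriv W) x) (at x)"
    using assms by (auto simp: C3_def intro: *)
  show "continuous_on S W" "continuous_on S (deriv W)" "continuous_on S (deriv (deriv W))"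
    using assms by (auto simp: C3_def intro!: continuous_at_imp_continuous_on differentiable_imp_continuous_within)
qed

section \<open>Pointwise regularity in space and uniform continuity in time\<close>

locale hyperbolic_Cahn_Hilliard =
  fixes tau eps a b :: real and W :: "real \<Rightarrow> real" and u ux uxx ut :: "real \<Rightarrow> real \<Rightarrow> real"
  assumes ab: "a < b" and tau: "0 < tau" and eps: "0 < eps" and C3: "C3 W"
    and sol: "solution tau W eps a b u ux uxx ut"
    and mass0: "integral {a..b} (\<lambda>x. ut x 0) = 0"
begin

lemma
  shows du_t: "x \<in> {a..b} \<Longrightarrow> 0 \<le> t \<Longrightarrow> (u x has_real_derivative ut x t) (at t within {0..})"
    and du_x: "x \<in> {a..b} \<Longrightarrow> 0 \<le> t \<Longrightarrow> ((\<lambda>y. u y t) has_real_derivative ux x t) (at x within {a..b})"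
    and dux_x: "x \<in> {a..b} \<Longrightarrow> 0 \<le> t \<Longrightarrow> ((\<lambda>y. ux y t) has_real_derivative uxx x t) (at x within {a..b})"
    and ux_bdry: "0 \<le> t \<Longrightarrow> ux a t = 0" "0 \<le> t \<Longrightarrow> ux b t = 0"
    and u_H: "0 \<le> t \<Longrightarrow> in_H a b 3 (\<lambda>x. u x t)" and ut_H: "0 \<le> t \<Longrightarrow> in_H a b 1 (\<lambda>x. ut x t)"
    and u_Hnorm: "0 \<le> t \<Longrightarrow> ((\<lambda>s. Hnorm a b 3 (\<lambda>x. u x s - u x t)) \<longlongrightarrow> 0) (at t within {0..})"
    and ut_Hnorm: "0 \<le> t \<Longrightarrow> ((\<lambda>s. Hnorm a b 1 (\<lambda>x. ut x s - ut x t)) \<longlongrightarrow> 0) (at t within {0..})"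
    and weak_form: "neumann_test a b \<phi> \<Longrightarrow> 0 \<le> t \<Longrightarrow>
        ((\<lambda>s. integral {a..b} (\<lambda>x. ut x s * \<phi> x)) has_real_derivative
           (integral {a..b} (\<lambda>x. (- (eps^2) * uxx x t + deriv W (u x t)) * deriv (deriv \<phi>) x)
            - integral {a..b} (\<lambda>x. ut x t * \<phi> x)) / tau) (at t within {0..})"
  using sol unfolding solution_def by (elim conjE; simp)+

lemma continuous_u: "0 \<le> t \<Longrightarrow> continuous_on {a..b} (\<lambda>x. u x t)"
  by (rule DERIV_continuous_on[OF du_x])

lemma continuous_ux: "0 \<le> t \<Longrightarrow> continuous_on {a..b} (\<lambda>x. ux x t)"
  by (rule DERIV_continuous_on[OF dux_x])

lemma continuous_uxx: "0 \<le> t \<Longrightarrow> continuous_on {a..b} (\<lambda>x. uxx x t)"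
  by (rule H3_classical_derivatives(1)[OF ab u_H du_x dux_x])

lemma uniform_limit_uxx:
  assumes t: "0 \<le> t"
  shows "uniform_limit {a..b} (\<lambda>s x. uxx x s) (\<lambda>x. uxx x t) (at t within {0..})"
proof (rule uniform_limitI)
  fix e :: real assume e: "e > 0"
  let ?C = "2 * sobolev_const a b"
  have C: "?C > 0" using sobolev_const_pos[OF ab] by simp
  have "\<forall>\<^sub>F s in at t within {0..}. Hnorm a b 3 (\<lambda>x. u x s - u x t) < e / ?C"
    using order_tendstoD(2)[OF u_Hnorm[OF t], of "e / ?C"] e C by simp
  moreover have "\<forall>\<^sub>F s in at t within {0..}. 0 \<le> s" by (simp add: eventually_at_filter)
  ultimately show "\<forall>\<^sub>F s in at t within {0..}. \<forall>x\<in>{a..b}. dist (uxx x s) (uxx x t) < e"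
  proof eventually_elim
    case (elim s)
    show ?case
    proof
      fix x assume x: "x \<in> {a..b}"
      have "\<bar>uxx x s - uxx x t\<bar> \<le> ?C * Hnorm a b 3 (\<lambda>x. u x s - u x t)"
        by (rule H3_classical_derivatives(2)[OF ab in_H_diff[OF u_H[OF elim(2)] u_H[OF t]]
              DERIV_diff[OF du_x[OF _ elim(2)] du_x[OF _ t]] DERIV_diff[OF dux_x[OF _ elim(2)] dux_x[OF _ t]]])
          (use x in simp_all)
      also have "\<dots> < e" using elim(1) C by (simp add: pos_less_divide_eq mult.commute)
      finally show "dist (uxx x s) (uxx x t) < e" by (simp add: dist_real_def)
    qed
  qed
qed

text \<open>The \<open>H^1\<close> norm controls only the continuous representative of the
  increment; until \<open>ut\<close> is known to be continuous in \<open>x\<close>, a null set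
  depending on \<open>s\<close> must be allowed.\<close>

lemma ut_ae_close:
  assumes t: "0 \<le> t" and e: "e > 0"
  shows "\<forall>\<^sub>F s in at t within {0..}. negligible {x\<in>{a..b}. \<not> \<bar>ut x s - ut x t\<bar> \<le> e}"
proof -
  let ?C = "2 * sobolev_const a b"
  have C: "?C > 0" using sobolev_const_pos[OF ab] by simp
  have "\<forall>\<^sub>F s in at t within {0..}. Hnorm a b 1 (\<lambda>x. ut x s - ut x t) < e / ?C"
    using order_tendstoD(2)[OF ut_Hnorm[OF t], of "e / ?C"] e C by simp
  moreover have "\<forall>\<^sub>F s in at t within {0..}. 0 \<le> s" by (simp add: eventually_at_filter)
  ultimately show ?thesis
  proof eventually_elim
    case (elim s)
    obtain G where "continuous_on {a..b} G" and G: "negligible {x\<in>{a..b}. ut x s - ut x t \<noteq> G x}"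
      "\<And>x. x \<in> {a..b} \<Longrightarrow> \<bar>G x\<bar> \<le> ?C * Hnorm a b 1 (\<lambda>x. ut x s - ut x t)"
      using H1_Hnorm_sup[OF ab in_H_diff[OF ut_H[OF elim(2)] ut_H[OF t]]] by blast
    have "\<bar>G x\<bar> \<le> e" if "x \<in> {a..b}" for x
      using G(2)[OF that] elim(1) C by (simp add: pos_less_divide_eq mult.commute)
    then show ?case by (intro negligible_subset[OF G(1)]) auto
  qed
qed

text \<open>Let \<open>G\<close> be the continuous representative at time \<open>t\<close>. For
  times near \<open>t\<close>, \<open>ut\<close> is within \<open>e\<close> of \<open>G\<close>
  almost everywhere, so by \<open>increment_bound_ae\<close> the difference quotient of
  \<open>u\<close> is within \<open>e\<close> of \<open>G x\<close> at every \<open>x\<close>. Its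
  limit \<open>ut x t\<close> is thus \<open>G x\<close> itself.\<close>

lemma continuous_ut:
  assumes t: "0 \<le> t"
  shows "continuous_on {a..b} (\<lambda>x. ut x t)"
proof -
  obtain G where G: "continuous_on {a..b} G" "negligible {x\<in>{a..b}. ut x t \<noteq> G x}"
    using H1_Hnorm_sup[OF ab ut_H[OF t]] by blast
  have "ut x t = G x" if x: "x \<in> {a..b}" for x
  proof -
    have c: "\<bar>ut x t - G x\<bar> \<le> e" if e: "e > 0" for e
    proof -
      obtain \<delta> where \<delta>: "\<delta> > 0" and
        n: "\<forall>s\<in>{0..}. s \<noteq> t \<and> dist s t < \<delta> \<longrightarrow> negligible {x\<in>{a..b}. \<not> \<bar>ut x s - ut x t\<bar> \<le> e}"
        using ut_ae_close[OF t e] unfolding eventually_at by blast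
      have n': "negligible {x\<in>{a..b}. \<not> \<bar>ut x s - G x\<bar> \<le> e}" if "0 \<le> s" "dist s t < \<delta>" for s
      proof (cases "s = t")
        case True
        show ?thesis by (rule negligible_subset[OF G(2)]) (use e True in auto)
      next
        case False
        have "negligible {x\<in>{a..b}. \<not> \<bar>ut x s - ut x t\<bar> \<le> e}" using n that False by simp
        from negligible_Un[OF this G(2)] show ?thesis by (rule negligible_subset) (use e in auto)
      qed
      have "\<bar>(u x s - u x t) / (s - t) - G x\<bar> \<le> e" if s: "t < s" "s < t + \<delta>" for s
      proof -
        have "\<bar>u x s - u x t - (s - t) * G x\<bar> \<le> e * (s - t)"
          using s t x by (intro increment_bound_ae[OF ab du_t continuous_u G(1) n']) (auto simp: dist_real_def)
        moreover have "(u x s - u x t) / (s - t) - G x = (u x s - u x t - (s - t) * G x) / (s - t)"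
          using s by (simp add: divide_simps)
        ultimately show ?thesis using s by (simp add: abs_divide pos_divide_le_eq)
      qed
      then have "\<forall>\<^sub>F s in at_right t. \<bar>(u x s - u x t) / (s - t) - G x\<bar> \<le> e"
        unfolding eventually_at_right_field using \<delta> by (intro exI[of _ "t + \<delta>"]) auto
      moreover have "((\<lambda>s. (u x s - u x t) / (s - t)) \<longlongrightarrow> ut x t) (at_right t)"
        using du_t[OF x t] unfolding has_field_derivative_iff
        by (rule tendsto_mono[rotated]) (rule at_le, use t in auto)
      then have "((\<lambda>s. \<bar>(u x s - u x t) / (s - t) - G x\<bar>) \<longlongrightarrow> \<bar>ut x t - G x\<bar>) (at_right t)"
        by (intro tendsto_intros)
      ultimately show ?thesis by (intro tendsto_upperbound[where F = "at_right t"]) auto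
    qed
    have "\<bar>ut x t - G x\<bar> \<le> 0" by (rule field_le_epsilon) (simp add: c)
    then show ?thesis by simp
  qed
  then show ?thesis using continuous_on_cong[OF refl, of "{a..b}" "\<lambda>x. ut x t" G] G(1) by blast
qed

text \<open>With continuity in \<open>x\<close> established, the almost everywhere bound holds
  everywhere.\<close>

lemma uniform_limit_ut:
  assumes t: "0 \<le> t"
  shows "uniform_limit {a..b} (\<lambda>s x. ut x s) (\<lambda>x. ut x t) (at t within {0..})"
proof (rule uniform_limitI)
  fix e :: real assume e: "e > 0"
  then have "\<forall>\<^sub>F s in at t within {0..}. negligible {x\<in>{a..b}. \<not> \<bar>ut x s - ut x t\<bar> \<le> e / 2}"
    by (intro ut_ae_close t) auto
  moreover have "\<forall>\<^sub>F s in at t within {0..}. 0 \<le> s" by (simp add: eventually_at_filter)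
  ultimately show "\<forall>\<^sub>F s in at t within {0..}. \<forall>x\<in>{a..b}. dist (ut x s) (ut x t) < e"
  proof eventually_elim
    case (elim s)
    have "\<bar>ut x s - ut x t\<bar> \<le> e / 2" if "x \<in> {a..b}" for x
    proof (rule continuous_le_ae[OF ab _ _ _ that, where g = "\<lambda>_. e / 2"])
      show "continuous_on {a..b} (\<lambda>x. \<bar>ut x s - ut x t\<bar>)"
        by (intro continuous_intros continuous_ut elim t)
      show "negligible {x \<in> {a..b}. e / 2 < \<bar>ut x s - ut x t\<bar>}" using elim(1) by (simp add: not_le)
    qed auto
    moreover have "e / 2 < e" using e by simp
    ultimately show ?case unfolding dist_real_def by (meson le_less_trans)
  qed
qed

lemma uniform_limit_du:
  "0 \<le> t \<Longrightarrow> uniform_limit {a..b} (\<lambda>s x. (u x s - u x t) / (s - t)) (\<lambda>x. ut x t) (at t within {0..})"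
  by (rule uniform_limit_quotient[OF du_t _ uniform_limit_ut])

lemma uniform_limit_u:
  assumes t: "0 \<le> t"
  shows "uniform_limit {a..b} (\<lambda>s x. u x s) (\<lambda>x. u x t) (at t within {0..})"
proof -
  have "uniform_limit {a..b} (\<lambda>s x. s - t) (\<lambda>x. 0) (at t within {0..})"
    by (rule uniform_limitI) (auto simp: dist_real_def eventually_at)
  from uniform_limit_mult_continuous[OF uniform_limit_du[OF t] this continuous_ut[OF t] continuous_on_const]
  have "uniform_limit {a..b} (\<lambda>s x. u x t + (u x s - u x t) / (s - t) * (s - t)) (\<lambda>x. u x t + 0) (at t within {0..})"
    by (intro uniform_limit_add uniform_limit_const) simp
  then show ?thesis
    by (rule uniform_limit_cong[THEN iffD1, rotated 2]) (auto simp: eventually_at_filter)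
qed

text \<open>For \<open>s\<close> near \<open>t\<close> the values \<open>u x s\<close> stay within 1
  of those at time \<open>t\<close>, hence in a compact interval on which \<open>g\<close> is
  uniformly continuous.\<close>

lemma uniform_limit_continuous_comp_u:
  assumes t: "0 \<le> t" and g: "continuous_on UNIV (g :: real \<Rightarrow> real)"
  shows "uniform_limit {a..b} (\<lambda>s x. g (u x s)) (\<lambda>x. g (u x t)) (at t within {0..})"
proof -
  obtain M where M: "\<And>x. x \<in> {a..b} \<Longrightarrow> \<bar>u x t\<bar> \<le> M"
    using compact_imp_bounded[OF compact_continuous_image[OF continuous_u[OF t] compact_Icc]]
    unfolding bounded_iff by (metis image_eqI real_norm_def)
  show ?thesis
  proof (rule uniform_limit_compose_uniformly_continuous_on[OF uniform_limit_u[OF t], where B = "{-(M+1)..M+1}"])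
    show "uniformly_continuous_on {-(M+1)..M+1} g"
      using g by (intro compact_uniformly_continuous) (auto intro: continuous_on_subset)
    show "\<forall>\<^sub>F s in at t within {0..}. \<forall>x\<in>{a..b}. u x s \<in> {-(M+1)..M+1}"
      using uniform_limitD[OF uniform_limit_u[OF t] zero_less_one]
    proof eventually_elim
      case (elim s)
      show ?case
      proof
        fix x assume x: "x \<in> {a..b}"
        have "\<bar>u x s - u x t\<bar> < 1" using elim x by (auto simp: dist_real_def)
        with M[OF x] show "u x s \<in> {-(M+1)..M+1}" unfolding atLeastAtMost_iff by linarith
      qed
    qed
  qed auto
qed

end

section \<open>Energy dissipation\<close>

lemma eventually_at_0_infinity: "(\<And>s. 0 \<le> s \<Longrightarrow> P s) \<Longrightarrow> \<forall>\<^sub>F s in at t within {0..}. P (s::real)"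
  by (simp add: eventually_at_filter)

lemma continuous_prim: "continuous_on {a..b} f \<Longrightarrow> continuous_on {a..b} (prim a f)"
  unfolding prim_def by (intro indefinite_integral_continuous_1 integrable_continuous_real)

lemma uniform_limit_prim:
  fixes f :: "'c \<Rightarrow> real \<Rightarrow> real"
  assumes u: "uniform_limit {a..b} f g F" and cf: "\<forall>\<^sub>F n in F. continuous_on {a..b} (f n)"
    and cg: "continuous_on {a..b} g" and ab: "a < b"
  shows "uniform_limit {a..b} (\<lambda>n. prim a (f n)) (prim a g) F"
proof (rule uniform_limitI)
  fix e :: real assume e: "e > 0"
  then have "\<forall>\<^sub>F n in F. \<forall>x\<in>{a..b}. dist (f n x) (g x) < e / (2 * (b - a))"
    using ab by (intro uniform_limitD[OF u]) auto
  with cf show "\<forall>\<^sub>F n in F. \<forall>x\<in>{a..b}. dist (prim a (f n) x) (prim a g x) < e"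
  proof eventually_elim
    case (elim n)
    show ?case
    proof
      fix x assume x: "x \<in> {a..b}"
      have i: "h integrable_on {a..x}" if "continuous_on {a..b} h" for h :: "real \<Rightarrow> real"
        using x by (intro integrable_continuous_real continuous_on_subset[OF that]) auto
      have "prim a (f n) x - prim a g x = integral {a..x} (\<lambda>y. f n y - g y)"
        unfolding prim_def by (intro HK_integral_diff[symmetric] i elim cg)
      also have "\<bar>\<dots>\<bar> \<le> integral {a..x} (\<lambda>y. e / (2 * (b - a)))"
        using elim x by (intro integral_abs_bound_integral integrable_diff i cg) (auto simp: dist_real_def less_imp_le)
      also have "\<dots> = (x - a) * (e / (2 * (b - a)))" using x by simp
      also have "\<dots> \<le> (b - a) * (e / (2 * (b - a)))"
        using x e ab by (intro mult_right_mono) auto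
      also have "\<dots> < e" using ab e by (simp add: field_simps)
      finally show "dist (prim a (f n) x) (prim a g x) < e" by (simp add: dist_real_def)
    qed
  qed
qed

context hyperbolic_Cahn_Hilliard
begin

text \<open>\<open>w t\<close> is the time derivative of \<open>U t\<close>, the primitive of the solution defined further below.\<close>

definition w :: "real \<Rightarrow> real \<Rightarrow> real" where "w t = prim a (\<lambda>x. ut x t)"

text \<open>The chemical potential; the equation reads
  \<open>tau * u_tt + u_t = chem_xx\<close>.\<close>

definition chem :: "real \<Rightarrow> real \<Rightarrow> real" where
  "chem t x = - (eps\<^sup>2) * uxx x t + deriv W (u x t)"

lemma continuous_w: "0 \<le> t \<Longrightarrow> continuous_on {a..b} (w t)"
  unfolding w_def prim_def by (intro indefinite_integral_continuous_1 integrable_continuous_real continuous_ut)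

lemma continuous_comp_u: "0 \<le> t \<Longrightarrow> continuous_on UNIV g \<Longrightarrow> continuous_on {a..b} (\<lambda>x. g (u x t))"
  by (rule continuous_on_compose2[OF _ continuous_u]) auto

lemma continuous_chem: "0 \<le> t \<Longrightarrow> continuous_on {a..b} (chem t)"
  unfolding chem_def by (intro continuous_intros continuous_uxx continuous_comp_u C3_D(4)[OF C3])

lemma uniform_limit_chem:
  assumes t: "0 \<le> t"
  shows "uniform_limit {a..b} chem (chem t) (at t within {0..})"
proof -
  have "uniform_limit {a..b} (\<lambda>s x. (- (eps\<^sup>2)) * uxx x s + deriv W (u x s)) (\<lambda>x. (- (eps\<^sup>2)) * uxx x t + deriv W (u x t)) (at t within {0..})"
    by (intro uniform_limit_add uniform_limit_mult_continuous uniform_limit_const uniform_limit_uxx[OF t]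
        continuous_on_const continuous_uxx[OF t] uniform_limit_continuous_comp_u[OF t] C3_D(4)[OF C3])
  then show ?thesis unfolding chem_def .
qed

lemma uniform_limit_w: "0 \<le> t \<Longrightarrow> uniform_limit {a..b} w (w t) (at t within {0..})"
  unfolding w_def by (intro uniform_limit_prim uniform_limit_ut eventually_at_0_infinity continuous_ut ab)

text \<open>Testing with the constant 1 gives \<open>tau * M' = - M\<close>, so
  \<open>M s * exp (s / tau)\<close> is constant, and it starts at 0.\<close>

lemma mass_zero:
  assumes t: "0 \<le> t"
  shows "integral {a..b} (\<lambda>x. ut x t) = 0"
proof -
  define M where "M s = integral {a..b} (\<lambda>x. ut x s)" for s
  have n: "neumann_test a b (\<lambda>_. 1)"
    unfolding neumann_test_def by (auto simp: deriv_const)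
  have d0: "deriv (deriv (\<lambda>_::real. 1::real)) = (\<lambda>_. 0)" by (simp add: fun_eq_iff)
  have dM: "(M has_real_derivative - M s / tau) (at s within {0..})" if "0 \<le> s" for s
    using weak_form[OF n that] unfolding M_def d0 by simp
  have "((\<lambda>s. M s * exp (s / tau)) has_real_derivative 0) (at s within {0..})" if "s \<in> {0..}" for s
    using dM[of s] that tau by (auto intro!: derivative_eq_intros)
  from has_field_derivative_zero_constant[OF _ this]
  obtain c where "\<forall>s\<in>{0..}. M s * exp (s / tau) = c" by auto
  then have "M t * exp (t / tau) = M 0 * exp (0 / tau)" using t by (metis atLeast_iff order_refl)
  then show ?thesis using mass0 by (simp add: M_def)
qed

lemma w_bdry: "w t a = 0" "0 \<le> t \<Longrightarrow> w t b = 0"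
  using mass_zero by (auto simp: w_def prim_def)

lemma integral_ut_by_parts:
  assumes t: "0 \<le> t" and d: "\<And>x. x \<in> {a..b} \<Longrightarrow> (\<phi> has_real_derivative \<phi>' x) (at x within {a..b})"
    and c: "continuous_on {a..b} \<phi>'"
  shows "integral {a..b} (\<lambda>x. ut x t * \<phi> x) = - integral {a..b} (\<lambda>x. w t x * \<phi>' x)"
  using integration_by_parts_indefinite[OF absolutely_integrable_continuous_real[OF continuous_ut[OF t]] _ d c]
    mass_zero[OF t] ab by (simp add: w_def prim_def)

text \<open>The once integrated equation. The test function is a second primitive
  \<open>\<phi>\<close> of \<open>g\<close>; its derivative \<open>prim a g\<close> vanishes at
  \<open>a\<close> by construction and at \<open>b\<close> because \<open>g\<close> has integral 0,
  which is the Neumann condition. Integrating by parts turns \<open>ut\<close> tested with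
  \<open>\<phi>\<close> into \<open>w\<close> tested with \<open>prim a g\<close>.\<close>

lemma weak_form_w:
  assumes t: "0 \<le> t" and g: "continuous_on {a..b} g" and gb: "integral {a..b} g = 0"
  shows "((\<lambda>s. integral {a..b} (\<lambda>x. w s x * prim a g x)) has_real_derivative
     - (integral {a..b} (\<lambda>x. chem t x * g x) + integral {a..b} (\<lambda>x. w t x * prim a g x)) / tau) (at t within {0..})"
proof -
  \<comment> \<open>Test functions live on the whole line, so \<open>g\<close> is extended by its
    boundary values.\<close>
  define G where "G x = g (max a (min b x))" for x
  have cG: "continuous_on UNIV G"
    unfolding G_def by (rule continuous_on_compose2[OF g]) (use ab in \<open>auto intro!: continuous_intros\<close>)
  have Gg: "G x = g x" if "x \<in> {a..b}" for x using that by (auto simp: G_def)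
  obtain F where F: "\<And>x. (F has_real_derivative G x) (at x)" "F a = 0"
    using antiderivative_UNIV[OF cG] by blast
  have cF: "continuous_on UNIV F"
    using F(1) by (intro continuous_at_imp_continuous_on) (auto intro: DERIV_isCont)
  obtain \<phi> where \<phi>: "\<And>x. (\<phi> has_real_derivative F x) (at x)"
    using antiderivative_UNIV[OF cF] by blast
  have dF: "deriv F = G" "deriv \<phi> = F" using F \<phi> DERIV_imp_deriv by blast+
  have Fp: "F x = prim a g x" if "x \<in> {a..b}" for x
  proof -
    have "(G has_integral F x - F a) {a..x}"
      using that F(1) by (intro fundamental_theorem_of_calculus)
        (auto simp: has_real_derivative_iff_has_vector_derivative intro: has_vector_derivative_at_within)
    then have "integral {a..x} G = F x" using F(2) by (simp add: integral_unique)
    moreover have "integral {a..x} G = integral {a..x} g"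
      by (rule integral_cong) (use Gg that in auto)
    ultimately show ?thesis by (simp add: prim_def)
  qed
  have n: "neumann_test a b \<phi>"
    unfolding neumann_test_def dF
    using F \<phi> cG Fp[of b] gb ab by (auto simp: prim_def real_differentiable_def)
  have s: "integral {a..b} (\<lambda>x. ut x s * \<phi> x) = - integral {a..b} (\<lambda>x. w s x * prim a g x)" if "0 \<le> s" for s
  proof -
    have "integral {a..b} (\<lambda>x. ut x s * \<phi> x) = - integral {a..b} (\<lambda>x. w s x * F x)"
      by (rule integral_ut_by_parts[OF that has_field_derivative_at_within[OF \<phi>] continuous_on_subset[OF cF]]) auto
    also have "integral {a..b} (\<lambda>x. w s x * F x) = integral {a..b} (\<lambda>x. w s x * prim a g x)"
      by (rule integral_cong) (use Fp in auto)
    finally show ?thesis .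
  qed
  have c: "integral {a..b} (\<lambda>x. (- (eps^2) * uxx x t + deriv W (u x t)) * G x) = integral {a..b} (\<lambda>x. chem t x * g x)"
    by (rule integral_cong) (use Gg in \<open>auto simp: chem_def\<close>)
  have "((\<lambda>s. - integral {a..b} (\<lambda>x. ut x s * \<phi> x)) has_real_derivative
     - ((integral {a..b} (\<lambda>x. chem t x * g x) - integral {a..b} (\<lambda>x. ut x t * \<phi> x)) / tau)) (at t within {0..})"
    using weak_form[OF n t] unfolding dF c by (rule DERIV_minus)
  then have "((\<lambda>s. integral {a..b} (\<lambda>x. w s x * prim a g x)) has_real_derivative
     - ((integral {a..b} (\<lambda>x. chem t x * g x) - integral {a..b} (\<lambda>x. ut x t * \<phi> x)) / tau)) (at t within {0..})"
    by (rule has_field_derivative_transform_within[OF _ zero_less_one]) (use t s in auto)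
  then show ?thesis unfolding s[OF t] by (simp add: minus_divide_left add.commute)
qed

lemma kinetic_derivative:
  assumes t: "0 \<le> t"
  shows "((\<lambda>s. integral {a..b} (\<lambda>x. (w s x)\<^sup>2)) has_real_derivative
    - 2 * (integral {a..b} (\<lambda>x. chem t x * ut x t) + integral {a..b} (\<lambda>x. (w t x)\<^sup>2)) / tau) (at t within {0..})"
proof -
  define K where "K s = integral {a..b} (\<lambda>x. (w s x)\<^sup>2)" for s
  define R where "R \<xi> s = integral {a..b} (\<lambda>x. chem \<xi> x * (ut x s + ut x t)) + integral {a..b} (\<lambda>x. w \<xi> x * (w s x + w t x))" for \<xi> s
  let ?F = "at t within {0..}"
  have ex: "\<exists>\<xi>. min s t < \<xi> \<and> \<xi> < max s t \<and> (K s - K t) / (s - t) = - R \<xi> s / tau" if s: "0 \<le> s" "s \<noteq> t" for s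
  proof -
    define g where "g x = ut x s + ut x t" for x
    have cg: "continuous_on {a..b} g" unfolding g_def by (intro continuous_intros continuous_ut s t)
    have i: "(\<lambda>y. ut y r) integrable_on {a..x}" if "0 \<le> r" "x \<in> {a..b}" for r x
      using that by (intro integrable_continuous_real continuous_on_subset[OF continuous_ut]) auto
    have pg: "prim a g x = w s x + w t x" if "x \<in> {a..b}" for x
      unfolding g_def w_def prim_def using i that s t by (intro HK_integral_add) auto
    have gb: "integral {a..b} g = 0" using pg[of b] w_bdry(2) s t ab by (simp add: prim_def)
    define N where "N \<sigma> = integral {a..b} (\<lambda>x. w \<sigma> x * prim a g x)" for \<sigma>
    define N' where "N' \<sigma> = - (integral {a..b} (\<lambda>x. chem \<sigma> x * g x) + integral {a..b} (\<lambda>x. w \<sigma> x * prim a g x)) / tau" for \<sigma>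
    have dN: "(N has_real_derivative N' \<sigma>) (at \<sigma> within {0..})" if "0 \<le> \<sigma>" for \<sigma>
      unfolding N_def N'_def by (rule weak_form_w[OF that cg gb])
    have "(N has_derivative (*) (N' z)) (at z within {min s t..max s t})" if "min s t \<le> z" "z \<le> max s t" for z
      unfolding has_field_derivative_def[symmetric]
      using s t that by (intro has_field_derivative_subset[OF dN]) auto
    moreover have "min s t < max s t" using s by auto
    ultimately obtain \<xi> where \<xi>: "min s t < \<xi>" "\<xi> < max s t" "N (max s t) - N (min s t) = N' \<xi> * (max s t - min s t)"
      using mvt_simple[of "min s t" "max s t" N "\<lambda>z. (*) (N' z)"] by auto
    then have "(N s - N t) / (s - t) = N' \<xi>"
      using s by (cases "s < t") (auto simp: divide_simps algebra_simps)
    moreover have Nw: "N \<sigma> = integral {a..b} (\<lambda>x. w \<sigma> x * (w s x + w t x))" for \<sigma>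
      unfolding N_def by (rule integral_cong) (simp add: pg)
    have "N s - N t = K s - K t"
    proof -
      have "N s - N t = integral {a..b} (\<lambda>x. w s x * (w s x + w t x) - w t x * (w s x + w t x))"
        unfolding Nw by (intro HK_integral_diff[symmetric] integrable_continuous_real continuous_intros continuous_w s t)
      also have "\<dots> = integral {a..b} (\<lambda>x. (w s x)\<^sup>2 - (w t x)\<^sup>2)"
        by (simp add: algebra_simps power2_eq_square)
      also have "\<dots> = K s - K t"
        unfolding K_def by (intro HK_integral_diff integrable_continuous_real continuous_intros continuous_w s t)
      finally show ?thesis .
    qed
    moreover have "N' \<xi> = - R \<xi> s / tau"
      using Nw[of \<xi>] unfolding N'_def R_def g_def N_def by simp
    ultimately show ?thesis using \<xi> by metis
  qed
  then obtain \<xi> where \<xi>: "\<And>s. 0 \<le> s \<Longrightarrow> s \<noteq> t \<Longrightarrow> min s t < \<xi> s \<and> \<xi> s < max s t \<and> (K s - K t) / (s - t) = - R (\<xi> s) s / tau"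
    by metis
  have ev: "\<forall>\<^sub>F s in ?F. 0 \<le> s \<and> s \<noteq> t" by (simp add: eventually_at_filter)
  \<comment> \<open>Strict betweenness keeps \<open>\<xi> s\<close> different from \<open>t\<close>,
    so that the uniform limits at \<open>t\<close> may be composed with
    \<open>\<xi>\<close>.\<close>
  have f\<xi>: "filterlim \<xi> ?F ?F"
    unfolding filterlim_at
  proof
    show "\<forall>\<^sub>F s in ?F. \<xi> s \<in> {0..} \<and> \<xi> s \<noteq> t"
      using ev by eventually_elim (use \<xi> t in \<open>fastforce\<close>)
    show "(\<xi> \<longlongrightarrow> t) ?F"
    proof (rule Lim_transform)
      show "((\<lambda>s. s) \<longlongrightarrow> t) ?F" by (rule tendsto_ident_at)
      show "((\<lambda>s. \<xi> s - s) \<longlongrightarrow> 0) ?F"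
      proof (rule Lim_null_comparison)
        show "\<forall>\<^sub>F s in ?F. norm (\<xi> s - s) \<le> \<bar>s - t\<bar>"
          using ev by eventually_elim (use \<xi> in \<open>force simp: abs_if\<close>)
        show "((\<lambda>s. \<bar>s - t\<bar>) \<longlongrightarrow> 0) ?F" by (auto intro!: tendsto_eq_intros)
      qed
    qed
  qed
  have nonneg\<xi>: "\<forall>\<^sub>F s in ?F. 0 \<le> \<xi> s \<and> 0 \<le> s"
    using ev by eventually_elim (use \<xi> t in \<open>fastforce\<close>)
  have u2: "uniform_limit {a..b} (\<lambda>s x. ut x s + ut x t) (\<lambda>x. ut x t + ut x t) ?F"
    by (intro uniform_limit_add uniform_limit_const uniform_limit_ut t)
  have w2: "uniform_limit {a..b} (\<lambda>s x. w s x + w t x) (\<lambda>x. w t x + w t x) ?F"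
    by (intro uniform_limit_add uniform_limit_const uniform_limit_w t)
  have 1: "((\<lambda>s. integral {a..b} (\<lambda>x. chem (\<xi> s) x * (ut x s + ut x t))) \<longlongrightarrow> integral {a..b} (\<lambda>x. chem t x * (ut x t + ut x t))) ?F"
  proof (rule tendsto_integral_uniform_limit[OF _ _ _ ab])
    show "uniform_limit {a..b} (\<lambda>s x. chem (\<xi> s) x * (ut x s + ut x t)) (\<lambda>x. chem t x * (ut x t + ut x t)) ?F"
      by (intro uniform_limit_mult_continuous filterlim_compose[OF uniform_limit_chem[OF t] f\<xi>] u2
          continuous_intros continuous_chem continuous_ut t)
    show "\<forall>\<^sub>F s in ?F. continuous_on {a..b} (\<lambda>x. chem (\<xi> s) x * (ut x s + ut x t))"
      using nonneg\<xi> by eventually_elim (intro continuous_intros continuous_chem continuous_ut t, auto)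
  qed (intro continuous_intros continuous_chem continuous_ut t)
  have 2: "((\<lambda>s. integral {a..b} (\<lambda>x. w (\<xi> s) x * (w s x + w t x))) \<longlongrightarrow> integral {a..b} (\<lambda>x. w t x * (w t x + w t x))) ?F"
  proof (rule tendsto_integral_uniform_limit[OF _ _ _ ab])
    show "uniform_limit {a..b} (\<lambda>s x. w (\<xi> s) x * (w s x + w t x)) (\<lambda>x. w t x * (w t x + w t x)) ?F"
      by (intro uniform_limit_mult_continuous filterlim_compose[OF uniform_limit_w[OF t] f\<xi>] w2
          continuous_intros continuous_w t)
    show "\<forall>\<^sub>F s in ?F. continuous_on {a..b} (\<lambda>x. w (\<xi> s) x * (w s x + w t x))"
      using nonneg\<xi> by eventually_elim (intro continuous_intros continuous_w t, auto)
  qed (intro continuous_intros continuous_w t)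
  have "((\<lambda>s. - R (\<xi> s) s / tau) \<longlongrightarrow> - (integral {a..b} (\<lambda>x. chem t x * (ut x t + ut x t)) + integral {a..b} (\<lambda>x. w t x * (w t x + w t x))) / tau) ?F"
    unfolding R_def using tau by (intro tendsto_intros 1 2) auto
  also have "integral {a..b} (\<lambda>x. chem t x * (ut x t + ut x t)) = 2 * integral {a..b} (\<lambda>x. chem t x * ut x t)"
    by (simp flip: integral_mult_right mult_2 add: mult.left_commute)
  also have "integral {a..b} (\<lambda>x. w t x * (w t x + w t x)) = 2 * integral {a..b} (\<lambda>x. (w t x)\<^sup>2)"
    by (simp flip: integral_mult_right mult_2 add: mult.left_commute power2_eq_square)
  finally have "((\<lambda>s. - R (\<xi> s) s / tau) \<longlongrightarrow> - 2 * (integral {a..b} (\<lambda>x. chem t x * ut x t) + integral {a..b} (\<lambda>x. (w t x)\<^sup>2)) / tau) ?F"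
    by (simp add: algebra_simps)
  then have "((\<lambda>s. (K s - K t) / (s - t)) \<longlongrightarrow> - 2 * (integral {a..b} (\<lambda>x. chem t x * ut x t) + integral {a..b} (\<lambda>x. (w t x)\<^sup>2)) / tau) ?F"
    by (rule Lim_transform_eventually) (use ev \<xi> in \<open>auto elim!: eventually_mono\<close>)
  then show ?thesis unfolding has_field_derivative_iff K_def .
qed

definition potential :: "real \<Rightarrow> real" where
  "potential t = integral {a..b} (\<lambda>x. eps / 2 * (ux x t)\<^sup>2 + W (u x t) / eps)"

text \<open>The mixed derivative \<open>u_xt\<close> is avoided by integrating the quotient itself
  by parts: the difference of the squares of \<open>ux\<close> factors, and the Neumann condition
  moves the derivative from \<open>ux x s - ux x t\<close> onto the sum. Only difference quotients
  of \<open>u\<close> and \<open>W (u)\<close> remain, and these converge uniformly.\<close>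

lemma potential_derivative:
  assumes t: "0 \<le> t"
  shows "(potential has_real_derivative integral {a..b} (\<lambda>x. chem t x * ut x t) / eps) (at t within {0..})"
proof -
  let ?F = "at t within {0..}"
  define q where "q s x = - (eps / 2) * ((u x s - u x t) / (s - t) * (uxx x s + uxx x t))
     + 1 / eps * ((W (u x s) - W (u x t)) / (s - t))" for s x
  have dW: "((\<lambda>s. W (u x s)) has_real_derivative deriv W (u x s) * ut x s) (at s within {0..})"
    if "x \<in> {a..b}" "0 \<le> s" for x s
    using DERIV_chain2[OF C3_D(1)[OF C3] du_t[OF that]] .
  have uW: "uniform_limit {a..b} (\<lambda>s x. (W (u x s) - W (u x t)) / (s - t)) (\<lambda>x. deriv W (u x t) * ut x t) ?F"
    by (rule uniform_limit_quotient[OF dW t])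
      (auto intro!: uniform_limit_mult_continuous uniform_limit_continuous_comp_u uniform_limit_ut continuous_comp_u continuous_ut C3_D[OF C3] t)
  have uxx2: "uniform_limit {a..b} (\<lambda>s x. uxx x s + uxx x t) (\<lambda>x. uxx x t + uxx x t) ?F"
    by (intro uniform_limit_add uniform_limit_const uniform_limit_uxx t)
  have uq: "uniform_limit {a..b} q (\<lambda>x. - (eps / 2) * (ut x t * (uxx x t + uxx x t)) + 1 / eps * (deriv W (u x t) * ut x t)) ?F"
    unfolding q_def
    by (intro uniform_limit_add uniform_limit_mult_continuous uniform_limit_const uniform_limit_du uW uxx2 t
        continuous_intros continuous_ut continuous_uxx continuous_comp_u C3_D[OF C3])
  have ev: "\<forall>\<^sub>F s in ?F. 0 \<le> s \<and> s \<noteq> t" by (simp add: eventually_at_filter)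
  have lim: "((\<lambda>s. integral {a..b} (q s)) \<longlongrightarrow> integral {a..b} (\<lambda>x. - (eps / 2) * (ut x t * (uxx x t + uxx x t)) + 1 / eps * (deriv W (u x t) * ut x t))) ?F"
  proof (rule tendsto_integral_uniform_limit[OF uq _ _ ab])
    show "\<forall>\<^sub>F s in ?F. continuous_on {a..b} (q s)"
      using ev unfolding q_def
      by eventually_elim (intro continuous_intros continuous_u continuous_uxx continuous_comp_u C3_D[OF C3] t; simp)
  qed (intro continuous_intros continuous_ut continuous_uxx continuous_comp_u C3_D[OF C3] t)
  have eq: "(potential s - potential t) / (s - t) = integral {a..b} (q s)" if s: "0 \<le> s" "s \<noteq> t" for s
  proof -
    note ci = integrable_continuous_real continuous_intros continuous_u continuous_ux continuous_uxx continuous_comp_u C3_D[OF C3] t s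
    have bp: "integral {a..b} (\<lambda>x. (ux x s + ux x t) * (ux x s - ux x t)) = - integral {a..b} (\<lambda>x. (u x s - u x t) * (uxx x s + uxx x t))"
    proof -
      have "((\<lambda>x. (u x s - u x t) * (ux x s + ux x t)) has_real_derivative
          (ux x s + ux x t) * (ux x s - ux x t) + (u x s - u x t) * (uxx x s + uxx x t)) (at x within {a..b})"
        if "x \<in> {a..b}" for x
        using that s t by (auto intro!: derivative_eq_intros du_x dux_x simp: algebra_simps)
      then have "((\<lambda>x. (ux x s + ux x t) * (ux x s - ux x t) + (u x s - u x t) * (uxx x s + uxx x t)) has_integral
          (u b s - u b t) * (ux b s + ux b t) - (u a s - u a t) * (ux a s + ux a t)) {a..b}"
        using ab by (intro fundamental_theorem_of_calculus) (auto simp: has_real_derivative_iff_has_vector_derivative)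
      then have "integral {a..b} (\<lambda>x. (ux x s + ux x t) * (ux x s - ux x t) + (u x s - u x t) * (uxx x s + uxx x t)) = 0"
        using ux_bdry s t by (simp add: integral_unique)
      then show ?thesis
        by (subst (asm) HK_integral_add; (intro ci)?) simp
    qed
    have "potential s - potential t = integral {a..b} (\<lambda>x. (eps / 2 * (ux x s)\<^sup>2 + W (u x s) / eps) - (eps / 2 * (ux x t)\<^sup>2 + W (u x t) / eps))"
      unfolding potential_def using eps
      by (intro HK_integral_diff[symmetric] ci) auto
    also have "\<dots> = integral {a..b} (\<lambda>x. eps / 2 * ((ux x s + ux x t) * (ux x s - ux x t)) + 1 / eps * (W (u x s) - W (u x t)))"
      by (rule integral_cong) (simp add: algebra_simps power2_eq_square diff_divide_distrib)
    also have "\<dots> = eps / 2 * integral {a..b} (\<lambda>x. (ux x s + ux x t) * (ux x s - ux x t)) + 1 / eps * integral {a..b} (\<lambda>x. W (u x s) - W (u x t))"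
      by (subst HK_integral_add; (intro ci)?) simp_all
    also have "\<dots> = integral {a..b} (\<lambda>x. - (eps / 2) * ((u x s - u x t) * (uxx x s + uxx x t)) + 1 / eps * (W (u x s) - W (u x t)))"
      unfolding bp by (subst HK_integral_add; (intro ci)?) simp_all
    finally have "(potential s - potential t) / (s - t) = integral {a..b} (\<lambda>x. - (eps / 2) * ((u x s - u x t) * (uxx x s + uxx x t)) + 1 / eps * (W (u x s) - W (u x t))) / (s - t)"
      by simp
    also have "\<dots> = integral {a..b} (\<lambda>x. (- (eps / 2) * ((u x s - u x t) * (uxx x s + uxx x t)) + 1 / eps * (W (u x s) - W (u x t))) / (s - t))"
      by (rule integral_divide[symmetric])
    also have "\<dots> = integral {a..b} (q s)"
    proof -
      have "(- (eps / 2) * (A * B) + 1 / eps * C) / d = - (eps / 2) * (A / d * B) + 1 / eps * (C / d)" for A B C d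
        using eps by (cases "d = 0") (simp_all add: field_simps)
      then show ?thesis unfolding q_def by presburger
    qed
    finally show ?thesis .
  qed
  have "((\<lambda>s. (potential s - potential t) / (s - t)) \<longlongrightarrow> integral {a..b} (\<lambda>x. - (eps / 2) * (ut x t * (uxx x t + uxx x t)) + 1 / eps * (deriv W (u x t) * ut x t))) ?F"
    by (rule Lim_transform_eventually[OF lim]) (use ev eq in \<open>auto elim!: eventually_mono\<close>)
  also have "integral {a..b} (\<lambda>x. - (eps / 2) * (ut x t * (uxx x t + uxx x t)) + 1 / eps * (deriv W (u x t) * ut x t))
     = integral {a..b} (\<lambda>x. chem t x * ut x t / eps)"
    by (rule integral_cong) (use eps in \<open>simp add: chem_def field_simps power2_eq_square\<close>)
  finally show ?thesis unfolding has_field_derivative_iff by simp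
qed

definition en :: "real \<Rightarrow> real" where
  "en t = energy tau W a b eps (\<lambda>x. u x t) (\<lambda>x. ux x t) (w t)"

text \<open>The terms in \<open>chem * ut\<close> from the kinetic and the potential part
  cancel.\<close>

lemma energy_derivative:
  assumes t: "0 \<le> t"
  shows "(en has_real_derivative - integral {a..b} (\<lambda>x. (w t x)\<^sup>2) / eps) (at t within {0..})"
proof -
  have "((\<lambda>s. tau / (2 * eps) * integral {a..b} (\<lambda>x. (w s x)\<^sup>2) + potential s) has_real_derivative
     - integral {a..b} (\<lambda>x. (w t x)\<^sup>2) / eps) (at t within {0..})"
    by (rule derivative_eq_intros kinetic_derivative[OF t] potential_derivative[OF t] refl)+
      (use tau eps in \<open>simp add: field_simps\<close>)
  then show ?thesis unfolding en_def energy_def potential_def .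
qed

end

section \<open>Displacement of the primitive\<close>

lemma nonincreasing_on_0_infinity:
  fixes f f' :: "real \<Rightarrow> real"
  assumes d: "\<And>s. 0 \<le> s \<Longrightarrow> (f has_real_derivative f' s) (at s within {0..})"
    and neg: "\<And>s. 0 \<le> s \<Longrightarrow> f' s \<le> 0" and t: "0 \<le> t1" "t1 \<le> t2"
  shows "f t2 \<le> f t1"
proof (cases "t1 = t2")
  case False
  then have lt: "t1 < t2" using t by simp
  have "(f has_derivative (*) (f' z)) (at z within {t1..t2})" if "t1 \<le> z" "z \<le> t2" for z
    unfolding has_field_derivative_def[symmetric]
    using t that by (intro has_field_derivative_subset[OF d]) auto
  then obtain z where "z \<in> {t1<..<t2}" "f t2 - f t1 = f' z * (t2 - t1)"
    using mvt_simple[of t1 t2 f "\<lambda>z. (*) (f' z)", OF lt] by auto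
  then show ?thesis using neg[of z] t lt mult_nonpos_nonneg[of "f' z" "t2 - t1"] by auto
qed simp

lemma L1dist_le_L2:
  assumes "continuous_on {a..b} f" "continuous_on {a..b} g" "a \<le> b"
  shows "L1dist a b f g \<le> sqrt (b - a) * sqrt (integral {a..b} (\<lambda>x. (f x - g x)\<^sup>2))"
  unfolding L1dist_def using assms by (intro integral_abs_le_L2 L2fun_continuous continuous_intros)

context hyperbolic_Cahn_Hilliard
begin

definition U :: "real \<Rightarrow> real \<Rightarrow> real" where "U t = prim a (\<lambda>x. u x t)"

lemma continuous_U: "0 \<le> t \<Longrightarrow> continuous_on {a..b} (U t)"
  unfolding U_def by (intro continuous_prim continuous_u)

lemma integral_u_derivative:
  assumes t: "0 \<le> t" and c: "continuous_on {a..b} c"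
  shows "((\<lambda>s. integral {a..b} (\<lambda>x. u x s * c x)) has_real_derivative integral {a..b} (\<lambda>x. ut x t * c x)) (at t within {0..})"
proof -
  let ?F = "at t within {0..}"
  have ev: "\<forall>\<^sub>F s in ?F. 0 \<le> s \<and> s \<noteq> t" by (simp add: eventually_at_filter)
  have lim: "((\<lambda>s. integral {a..b} (\<lambda>x. (u x s - u x t) / (s - t) * c x)) \<longlongrightarrow> integral {a..b} (\<lambda>x. ut x t * c x)) ?F"
  proof (rule tendsto_integral_uniform_limit[OF _ _ _ ab])
    show "uniform_limit {a..b} (\<lambda>s x. (u x s - u x t) / (s - t) * c x) (\<lambda>x. ut x t * c x) ?F"
      by (intro uniform_limit_mult_continuous uniform_limit_du uniform_limit_const continuous_ut c t)
    show "\<forall>\<^sub>F s in ?F. continuous_on {a..b} (\<lambda>x. (u x s - u x t) / (s - t) * c x)"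
      using ev by eventually_elim (intro continuous_intros continuous_u c t; simp)
  qed (intro continuous_intros continuous_ut c t)
  have eq: "integral {a..b} (\<lambda>x. (u x s - u x t) / (s - t) * c x)
     = (integral {a..b} (\<lambda>x. u x s * c x) - integral {a..b} (\<lambda>x. u x t * c x)) / (s - t)" if "0 \<le> s" for s
  proof -
    have "integral {a..b} (\<lambda>x. u x s * c x) - integral {a..b} (\<lambda>x. u x t * c x) = integral {a..b} (\<lambda>x. u x s * c x - u x t * c x)"
      by (intro HK_integral_diff[symmetric] integrable_continuous_real continuous_intros continuous_u c t that)
    then show ?thesis by (simp add: left_diff_distrib flip: integral_divide)
  qed
  show ?thesis unfolding has_field_derivative_iff
    by (rule Lim_transform_eventually[OF lim]) (use ev eq in \<open>auto elim!: eventually_mono\<close>)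
qed

lemma mass_conserved:
  assumes t: "0 \<le> t"
  shows "integral {a..b} (\<lambda>x. u x t) = integral {a..b} (\<lambda>x. u x 0)"
proof -
  have "((\<lambda>s. integral {a..b} (\<lambda>x. u x s)) has_real_derivative 0) (at s within {0..})" if "s \<in> {0..}" for s
    using integral_u_derivative[of s "\<lambda>_. 1"] mass_zero[of s] that by simp
  from has_field_derivative_zero_constant[OF _ this] show ?thesis using t
    by (metis atLeast_iff order_refl convex_real_interval(1))
qed

text \<open>Integration by parts expresses \<open>U\<close> tested with \<open>c\<close> through
  \<open>u\<close> tested with 1 and with \<open>prim a c\<close>, where the derivative is
  known.\<close>

lemma integral_U_derivative:
  assumes t: "0 \<le> t" and c: "continuous_on {a..b} c"
  shows "((\<lambda>s. integral {a..b} (\<lambda>x. U s x * c x)) has_real_derivative integral {a..b} (\<lambda>x. w t x * c x)) (at t within {0..})"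
proof -
  have dc: "(prim a c has_real_derivative c x) (at x within {a..b})" if "x \<in> {a..b}" for x
    unfolding prim_def by (rule integral_has_real_derivative[OF c that])
  have bp: "integral {a..b} (\<lambda>x. prim a f x * c x) = integral {a..b} f * prim a c b - integral {a..b} (\<lambda>x. f x * prim a c x)"
    if "continuous_on {a..b} f" for f
    using integration_by_parts_indefinite[OF absolutely_integrable_continuous_real[OF that] _ dc c] ab
    by (simp add: prim_def)
  have "((\<lambda>s. integral {a..b} (\<lambda>x. u x s * 1) * prim a c b - integral {a..b} (\<lambda>x. u x s * prim a c x)) has_real_derivative
     integral {a..b} (\<lambda>x. ut x t * 1) * prim a c b - integral {a..b} (\<lambda>x. ut x t * prim a c x)) (at t within {0..})"
    by (intro DERIV_diff DERIV_cmult_right integral_u_derivative continuous_prim continuous_intros c t)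
  note D = this
  have "integral {a..b} (\<lambda>x. u x s * 1) * prim a c b - integral {a..b} (\<lambda>x. u x s * prim a c x) = integral {a..b} (\<lambda>x. U s x * c x)"
    if "0 \<le> s" for s using that by (simp add: U_def bp continuous_u)
  then have "((\<lambda>s. integral {a..b} (\<lambda>x. U s x * c x)) has_real_derivative
     integral {a..b} (\<lambda>x. ut x t * 1) * prim a c b - integral {a..b} (\<lambda>x. ut x t * prim a c x)) (at t within {0..})"
    by (intro has_field_derivative_transform_within[OF D zero_less_one]) (use t in auto)
  then show ?thesis by (simp add: w_def bp continuous_ut t)
qed

lemma uniform_limit_U: "0 \<le> t \<Longrightarrow> uniform_limit {a..b} U (U t) (at t within {0..})"
  unfolding U_def by (intro uniform_limit_prim uniform_limit_u eventually_at_0_infinity continuous_u ab)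

lemma continuous_L1dist_U:
  assumes V: "continuous_on {a..b} V"
  shows "continuous_on {0..} (\<lambda>t. L1dist a b (U t) V)"
  unfolding continuous_on
proof
  fix t :: real assume "t \<in> {0..}"
  then have t: "0 \<le> t" by simp
  show "((\<lambda>t. L1dist a b (U t) V) \<longlongrightarrow> L1dist a b (U t) V) (at t within {0..})"
    unfolding L1dist_def
  proof (rule tendsto_integral_uniform_limit[OF _ _ _ ab])
    have "uniform_limit {a..b} (\<lambda>s x. norm (U s x - V x)) (\<lambda>x. norm (U t x - V x)) (at t within {0..})"
      by (intro uniform_limit_norm uniform_limit_minus uniform_limit_const uniform_limit_U t)
    then show "uniform_limit {a..b} (\<lambda>s x. \<bar>U s x - V x\<bar>) (\<lambda>x. \<bar>U t x - V x\<bar>) (at t within {0..})" by simp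
    show "\<forall>\<^sub>F s in at t within {0..}. continuous_on {a..b} (\<lambda>x. \<bar>U s x - V x\<bar>)"
      by (intro eventually_at_0_infinity continuous_intros continuous_U V)
  qed (intro continuous_intros continuous_U V t)
qed

lemma energy_mono: "0 \<le> t1 \<Longrightarrow> t1 \<le> t2 \<Longrightarrow> en t2 \<le> en t1"
  by (rule nonincreasing_on_0_infinity[OF energy_derivative])
    (use eps in \<open>auto intro!: divide_nonneg_pos integral_nonneg integrable_continuous_real continuous_intros continuous_w\<close>)

lemma integral_displacement:
  assumes t: "0 \<le> t"
  shows "integral {a..b} (\<lambda>x. U t x * (U t x - U 0 x)) - integral {a..b} (\<lambda>x. U 0 x * (U t x - U 0 x))
    = integral {a..b} (\<lambda>x. (U t x - U 0 x)\<^sup>2)"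
proof -
  have "integral {a..b} (\<lambda>x. (U t x - U 0 x)\<^sup>2)
      = integral {a..b} (\<lambda>x. U t x * (U t x - U 0 x) - U 0 x * (U t x - U 0 x))"
    by (simp add: power2_eq_square left_diff_distrib)
  also have "\<dots> = integral {a..b} (\<lambda>x. U t x * (U t x - U 0 x)) - integral {a..b} (\<lambda>x. U 0 x * (U t x - U 0 x))"
    by (intro HK_integral_diff integrable_continuous_real continuous_intros continuous_U t order_refl)
  finally show ?thesis by simp
qed

text \<open>This is the Cauchy-Schwarz inequality in time, combined with
  \<open>\<parallel>w\<parallel>^2 = - eps * en'\<close>. It is phrased as monotonicity in
  \<open>s\<close> of a functional that tests \<open>U s\<close> with the final displacement
  \<open>\<psi>\<close>, so that only scalar functions of time are differentiated.\<close>

lemma displacement_dissipation: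
  assumes t: "0 \<le> t"
  shows "integral {a..b} (\<lambda>x. (U t x - U 0 x)\<^sup>2) \<le> t * eps * (en 0 - en t)"
proof (cases "t = 0")
  case False
  then have tp: "t > 0" using t by simp
  define \<psi> where "\<psi> x = U t x - U 0 x" for x
  have c\<psi>: "continuous_on {a..b} \<psi>" unfolding \<psi>_def by (intro continuous_intros continuous_U t order_refl)
  define S where "S = integral {a..b} (\<lambda>x. (\<psi> x)\<^sup>2)"
  define m where "m s = integral {a..b} (\<lambda>x. U s x * \<psi> x)" for s
  \<comment> \<open>The weights come from
    \<open>w * \<psi> \<le> t / 2 * w^2 + \<psi>^2 / (2 * t)\<close>: the first term is paid for by
    the energy, and over time \<open>t\<close> the second consumes half of \<open>S\<close>.\<close>
  define f where "f s = m s + t * eps / 2 * en s - s * (S / (2 * t))" for s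
  have "f t \<le> f 0"
  proof (rule nonincreasing_on_0_infinity[OF _ _ order_refl t])
    fix s :: real assume s: "0 \<le> s"
    show "(f has_real_derivative (integral {a..b} (\<lambda>x. w s x * \<psi> x) - t / 2 * integral {a..b} (\<lambda>x. (w s x)\<^sup>2) - S / (2 * t))) (at s within {0..})"
      unfolding f_def m_def
      by (rule derivative_eq_intros integral_U_derivative[OF s c\<psi>] energy_derivative[OF s] refl)+
        (use eps in \<open>simp add: field_simps\<close>)
    have "integral {a..b} (\<lambda>x. w s x * \<psi> x) \<le> integral {a..b} (\<lambda>x. t / 2 * (w s x)\<^sup>2 + (1 / (2 * t)) * (\<psi> x)\<^sup>2)"
    proof (rule integral_le)
      fix x
      have "0 \<le> (t * w s x - \<psi> x)\<^sup>2" by simp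
      then have "2 * t * (w s x * \<psi> x) \<le> t * t * (w s x)\<^sup>2 + (\<psi> x)\<^sup>2"
        by (simp add: power2_eq_square algebra_simps)
      then show "w s x * \<psi> x \<le> t / 2 * (w s x)\<^sup>2 + (1 / (2 * t)) * (\<psi> x)\<^sup>2"
        using tp by (simp add: field_simps)
    qed (intro integrable_continuous_real continuous_intros continuous_w s c\<psi>)+
    also have "\<dots> = t / 2 * integral {a..b} (\<lambda>x. (w s x)\<^sup>2) + (1 / (2 * t)) * S"
      unfolding S_def by (subst HK_integral_add; (intro integrable_continuous_real continuous_intros continuous_w s c\<psi>)?) simp
    finally show "integral {a..b} (\<lambda>x. w s x * \<psi> x) - t / 2 * integral {a..b} (\<lambda>x. (w s x)\<^sup>2) - S / (2 * t) \<le> 0" by simp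
  qed
  moreover have "m t - m 0 = S"
    unfolding m_def S_def \<psi>_def by (rule integral_displacement[OF t])
  ultimately have "S - S / 2 \<le> t * eps / 2 * (en 0 - en t)"
    unfolding f_def using tp by (simp add: algebra_simps)
  then show ?thesis unfolding S_def \<psi>_def by simp
qed simp

end

section \<open>Bounds by the initial energy for a nonnegative potential\<close>

locale hyperbolic_Cahn_Hilliard_nonneg = hyperbolic_Cahn_Hilliard +
  assumes W_nonneg: "0 \<le> W s"
begin

lemma potential_nonneg: "0 \<le> t \<Longrightarrow> 0 \<le> potential t"
  unfolding potential_def using eps W_nonneg
  by (intro integral_nonneg integrable_continuous_real continuous_intros continuous_ux continuous_comp_u C3_D[OF C3]) auto

lemma kinetic_le_energy: "0 \<le> t \<Longrightarrow> integral {a..b} (\<lambda>x. (w t x)\<^sup>2) \<le> 2 * eps / tau * en t"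
  using potential_nonneg[of t] eps tau unfolding en_def energy_def potential_def[symmetric]
  by (simp add: field_simps)

lemma potential_le_energy: "0 \<le> t \<Longrightarrow> potential t \<le> en t"
proof -
  assume t: "0 \<le> t"
  have "0 \<le> integral {a..b} (\<lambda>x. (w t x)\<^sup>2)"
    by (intro integral_nonneg integrable_continuous_real continuous_intros continuous_w t) auto
  then show ?thesis using eps tau unfolding en_def energy_def potential_def[symmetric] by simp
qed

lemma energy_nonneg: "0 \<le> t \<Longrightarrow> 0 \<le> en t"
  using potential_nonneg potential_le_energy by force

lemma gradient_le_energy:
  assumes t: "0 \<le> t"
  shows "integral {a..b} (\<lambda>x. (ux x t)\<^sup>2) \<le> 2 / eps * en t"
proof -
  have "integral {a..b} (\<lambda>x. eps / 2 * (ux x t)\<^sup>2) \<le> potential t"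
    unfolding potential_def using eps W_nonneg
    by (intro integral_le integrable_continuous_real continuous_intros continuous_ux continuous_comp_u C3_D[OF C3] t) auto
  then show ?thesis using potential_le_energy[OF t] eps by (simp add: field_simps)
qed

text \<open>The norm of \<open>w\<close> never exceeds \<open>sqrt (2 * eps / tau * en 0)\<close>,
  so \<open>U\<close> moves at bounded speed. The growth in \<open>t\<close> is worse than in
  \<open>displacement_dissipation\<close>, but for short times this is the stronger bound.\<close>

lemma displacement_kinetic:
  assumes t: "0 \<le> t"
  shows "integral {a..b} (\<lambda>x. (U t x - U 0 x)\<^sup>2) \<le> t\<^sup>2 * (2 * eps / tau * en 0)"
proof -
  define \<psi> where "\<psi> x = U t x - U 0 x" for x
  have c\<psi>: "continuous_on {a..b} \<psi>" unfolding \<psi>_def by (intro continuous_intros continuous_U t order_refl)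
  define S where "S = integral {a..b} (\<lambda>x. (\<psi> x)\<^sup>2)"
  have S0: "0 \<le> S" unfolding S_def by (intro integral_nonneg integrable_continuous_real continuous_intros c\<psi>) auto
  define m where "m s = integral {a..b} (\<lambda>x. U s x * \<psi> x)" for s
  define k where "k = 2 * eps / tau * en 0"
  have k0: "0 \<le> k" unfolding k_def using eps tau energy_nonneg[of 0] by simp
  define f where "f s = m s - s * (sqrt k * sqrt S)" for s
  have "f t \<le> f 0"
  proof (rule nonincreasing_on_0_infinity[OF _ _ order_refl t])
    fix s :: real assume s: "0 \<le> s"
    show "(f has_real_derivative (integral {a..b} (\<lambda>x. w s x * \<psi> x) - sqrt k * sqrt S)) (at s within {0..})"
      unfolding f_def m_def
      by (rule derivative_eq_intros integral_U_derivative[OF s c\<psi>] refl)+ simp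
    have "(integral {a..b} (\<lambda>x. w s x * \<psi> x))\<^sup>2 \<le> integral {a..b} (\<lambda>x. (w s x)\<^sup>2) * S"
      unfolding S_def by (intro Cauchy_Schwarz_L2 L2fun_continuous continuous_w s c\<psi>)
    also have "\<dots> \<le> k * S"
    proof (rule mult_right_mono[OF _ S0])
      have "integral {a..b} (\<lambda>x. (w s x)\<^sup>2) \<le> 2 * eps / tau * en s" by (rule kinetic_le_energy[OF s])
      also have "\<dots> \<le> k" unfolding k_def using energy_mono[of 0 s] s eps tau by (intro mult_left_mono) auto
      finally show "integral {a..b} (\<lambda>x. (w s x)\<^sup>2) \<le> k" .
    qed
    finally have "\<bar>integral {a..b} (\<lambda>x. w s x * \<psi> x)\<bar> \<le> sqrt (k * S)"
      by (rule real_le_rsqrt[of "\<bar>_\<bar>", simplified])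
    then show "integral {a..b} (\<lambda>x. w s x * \<psi> x) - sqrt k * sqrt S \<le> 0" by (simp add: real_sqrt_mult)
  qed
  moreover have "m t - m 0 = S"
    unfolding m_def S_def \<psi>_def by (rule integral_displacement[OF t])
  ultimately have "sqrt S * sqrt S \<le> (t * sqrt k) * sqrt S" using S0 by (simp add: f_def mult_ac)
  then have "sqrt S \<le> t * sqrt k" if "S \<noteq> 0"
    by (rule mult_right_le_imp_le) (use S0 that in simp)
  then have "sqrt S \<le> t * sqrt k" using t k0 by (cases "S = 0") auto
  then have "(sqrt S)\<^sup>2 \<le> (t * sqrt k)\<^sup>2" using S0 by (intro power_mono) auto
  then show ?thesis using S0 k0 unfolding S_def[symmetric] \<psi>_def[symmetric] k_def[symmetric] by (simp add: power_mult_distrib)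
qed

text \<open>The increment of \<open>U\<close> vanishes at \<open>b\<close> by conservation of mass,
  so integrating \<open>(u x t - u x 0)^2\<close> by parts leaves only the increment of
  \<open>U\<close> against that of \<open>ux\<close>. The 8 collects a factor 2 from the square of a
  difference, the two times involved, and the 2 of the gradient bound.\<close>

lemma displacement_interpolation:
  assumes t: "0 \<le> t"
  shows "integral {a..b} (\<lambda>x. (u x t - u x 0)\<^sup>2)
    \<le> sqrt (integral {a..b} (\<lambda>x. (U t x - U 0 x)\<^sup>2)) * sqrt (8 / eps * en 0)"
proof -
  let ?d = "\<lambda>x. u x t - u x 0" and ?dx = "\<lambda>x. ux x t - ux x 0"
  note ci = continuous_intros continuous_u continuous_ux continuous_U t order_refl
  have i: "(\<lambda>y. u y r) integrable_on {a..x}" if "0 \<le> r" "x \<in> {a..b}" for r x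
    using that by (intro integrable_continuous_real continuous_on_subset[OF continuous_u]) auto
  have Ud: "integral {a..x} ?d = U t x - U 0 x" if "x \<in> {a..b}" for x
    unfolding U_def prim_def by (intro HK_integral_diff i that t order_refl)
  have "integral {a..b} ?d = 0" using Ud[of b] mass_conserved[OF t] ab by (simp add: U_def prim_def)
  have "integral {a..b} (\<lambda>x. ?d x * ?d x) = - integral {a..b} (\<lambda>x. integral {a..x} ?d * ?dx x)"
  proof -
    have c: "continuous_on {a..b} ?d" "continuous_on {a..b} ?dx" by (intro ci)+
    have "(?d has_real_derivative ?dx x) (at x within {a..b})" if "x \<in> {a..b}" for x
      by (intro DERIV_diff du_x that t order_refl)
    from integration_by_parts_indefinite[OF absolutely_integrable_continuous_real[OF c(1)] less_imp_le[OF ab] this c(2)]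
    show ?thesis using \<open>integral {a..b} ?d = 0\<close> by simp
  qed
  also have "integral {a..b} (\<lambda>x. integral {a..x} ?d * ?dx x) = integral {a..b} (\<lambda>x. (U t x - U 0 x) * ?dx x)"
    by (rule integral_cong) (simp add: Ud)
  finally have eq: "integral {a..b} (\<lambda>x. (?d x)\<^sup>2) = - integral {a..b} (\<lambda>x. (U t x - U 0 x) * ?dx x)"
    by (simp add: power2_eq_square)
  have "(integral {a..b} (\<lambda>x. (U t x - U 0 x) * ?dx x))\<^sup>2
    \<le> integral {a..b} (\<lambda>x. (U t x - U 0 x)\<^sup>2) * integral {a..b} (\<lambda>x. (?dx x)\<^sup>2)"
    by (intro Cauchy_Schwarz_L2 L2fun_continuous ci)
  also have "\<dots> \<le> integral {a..b} (\<lambda>x. (U t x - U 0 x)\<^sup>2) * (8 / eps * en 0)"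
  proof (rule mult_left_mono)
    have "integral {a..b} (\<lambda>x. (?dx x)\<^sup>2) \<le> integral {a..b} (\<lambda>x. 2 * (ux x t)\<^sup>2 + 2 * (ux x 0)\<^sup>2)"
    proof (rule integral_le)
      fix x
      have "0 \<le> (ux x t + ux x 0)\<^sup>2" by simp
      then show "(?dx x)\<^sup>2 \<le> 2 * (ux x t)\<^sup>2 + 2 * (ux x 0)\<^sup>2" by (simp add: power2_eq_square algebra_simps)
    qed (intro integrable_continuous_real ci)+
    also have "\<dots> = 2 * integral {a..b} (\<lambda>x. (ux x t)\<^sup>2) + 2 * integral {a..b} (\<lambda>x. (ux x 0)\<^sup>2)"
      by (subst HK_integral_add; (intro integrable_continuous_real ci)?) simp
    also have "\<dots> \<le> 2 * (2 / eps * en 0) + 2 * (2 / eps * en 0)"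
    proof (intro add_mono mult_left_mono)
      have "integral {a..b} (\<lambda>x. (ux x t)\<^sup>2) \<le> 2 / eps * en t" by (rule gradient_le_energy[OF t])
      also have "\<dots> \<le> 2 / eps * en 0" using energy_mono[of 0 t] t eps by (intro mult_left_mono) auto
      finally show "integral {a..b} (\<lambda>x. (ux x t)\<^sup>2) \<le> 2 / eps * en 0" .
    qed (use gradient_le_energy[of 0] in auto)
    finally show "integral {a..b} (\<lambda>x. (?dx x)\<^sup>2) \<le> 8 / eps * en 0" by simp
    show "0 \<le> integral {a..b} (\<lambda>x. (U t x - U 0 x)\<^sup>2)"
      by (intro integral_nonneg integrable_continuous_real ci) auto
  qed
  finally have "\<bar>integral {a..b} (\<lambda>x. (U t x - U 0 x) * ?dx x)\<bar> \<le> sqrt (integral {a..b} (\<lambda>x. (U t x - U 0 x)\<^sup>2) * (8 / eps * en 0))"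
    by (rule real_le_rsqrt[of "\<bar>_\<bar>", simplified])
  then show ?thesis unfolding eq real_sqrt_mult by linarith
qed

end

section \<open>Lower bounds for the Ginzburg-Landau energy\<close>

text \<open>To leading order at the well, \<open>W s\<close> is
  \<open>W''(1) / 2 * (1 - s)^2\<close> and \<open>\<Phi> 1 - \<Phi> s\<close> is
  \<open>sqrt (W''(1)) / 2 * (1 - s)^2\<close>; their ratio forces
  \<open>k > 1 / sqrt (W''(1))\<close>. The rigorous version compares derivatives twice:
  \<open>(k * W')^2 - 2 * W\<close> and then \<open>k * W + \<Phi>\<close> decrease towards the
  well.\<close>

lemma double_well_slope:
  assumes C3: "C3 W" and W1: "W 1 = 0" "deriv W 1 = 0"
    and k: "0 < k" "1 < k\<^sup>2 * deriv (deriv W) 1"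
    and nonneg: "\<And>s. 0 \<le> W s"
    and \<Phi>: "\<And>s. (\<Phi> has_real_derivative sqrt (2 * W s)) (at s)"
  obtains \<rho> where "0 < \<rho>" "\<rho> < 1" "\<And>s. 1 - \<rho> \<le> s \<Longrightarrow> s \<le> 1 \<Longrightarrow> \<Phi> 1 - \<Phi> s \<le> k * W s"
proof -
  have "isCont (\<lambda>s. k\<^sup>2 * deriv (deriv W) s) 1"
    using C3_D(5)[OF C3, of UNIV] by (auto simp: continuous_on_eq_continuous_at intro!: continuous_intros)
  then obtain d where d: "d > 0" "\<And>s. dist s 1 < d \<Longrightarrow> dist (k\<^sup>2 * deriv (deriv W) s) (k\<^sup>2 * deriv (deriv W) 1) < k\<^sup>2 * deriv (deriv W) 1 - 1"
    using k unfolding continuous_at_eps_delta by (metis diff_gt_0_iff_gt)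
  define \<rho> where "\<rho> = min (d/2) (1/2)"
  have \<rho>: "0 < \<rho>" "\<rho> < 1" "\<rho> < d" using d(1) by (auto simp: \<rho>_def min_def)
  have W2: "1 < k\<^sup>2 * deriv (deriv W) s" if "1 - \<rho> \<le> s" "s \<le> 1" for s
    using d(2)[of s] that \<rho> by (auto simp: dist_real_def)
  have W2p: "0 < deriv (deriv W) s" if "1 - \<rho> \<le> s" "s \<le> 1" for s
    using W2[OF that] k by (smt (verit) mult_nonneg_nonpos zero_le_power2)
  have W'neg: "deriv W s \<le> 0" if "1 - \<rho> \<le> s" "s \<le> 1" for s
    using DERIV_nonneg_imp_nondecreasing[OF that(2), of "deriv W"] C3_D(2)[OF C3] W2p that W1
    by (smt (verit))
  have h: "2 * W s \<le> (k * deriv W s)\<^sup>2" if s: "1 - \<rho> \<le> s" "s \<le> 1" for s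
  proof -
    have "(k * deriv W 1)\<^sup>2 - 2 * W 1 \<le> (k * deriv W s)\<^sup>2 - 2 * W s"
    proof (rule DERIV_nonpos_imp_nonincreasing[OF s(2)])
      fix x assume x: "s \<le> x" "x \<le> 1"
      have "((\<lambda>s. (k * deriv W s)\<^sup>2 - 2 * W s) has_real_derivative 2 * deriv W x * (k\<^sup>2 * deriv (deriv W) x - 1)) (at x)"
        by (auto intro!: derivative_eq_intros C3_D(1,2)[OF C3] simp: power2_eq_square algebra_simps)
      moreover have "2 * deriv W x * (k\<^sup>2 * deriv (deriv W) x - 1) \<le> 0"
        using W'neg[of x] W2[of x] x s by (intro mult_nonpos_nonneg[of "2 * deriv W x"]) auto
      ultimately show "\<exists>y. ((\<lambda>s. (k * deriv W s)\<^sup>2 - 2 * W s) has_real_derivative y) (at x) \<and> y \<le> 0" by blast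
    qed
    then show ?thesis using W1 by simp
  qed
  have "\<Phi> 1 - \<Phi> s \<le> k * W s" if s: "1 - \<rho> \<le> s" "s \<le> 1" for s
  proof -
    have "k * W 1 + \<Phi> 1 \<le> k * W s + \<Phi> s"
    proof (rule DERIV_nonpos_imp_nonincreasing[OF s(2), where f = "\<lambda>s. k * W s + \<Phi> s"])
      fix x assume x: "s \<le> x" "x \<le> 1"
      have "((\<lambda>s. k * W s + \<Phi> s) has_real_derivative k * deriv W x + sqrt (2 * W x)) (at x)"
        by (auto intro!: derivative_eq_intros C3_D(1)[OF C3] \<Phi>)
      moreover have "sqrt (2 * W x) \<le> \<bar>k * deriv W x\<bar>"
        using real_sqrt_le_mono[OF h[of x]] x s by simp
      then have "k * deriv W x + sqrt (2 * W x) \<le> 0"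
        using W'neg[of x] x s k by (simp add: abs_mult)
      ultimately show "\<exists>y. ((\<lambda>s. k * W s + \<Phi> s) has_real_derivative y) (at x) \<and> y \<le> 0" by blast
    qed
    then show ?thesis using W1 by simp
  qed
  then show ?thesis using that \<rho> by blast
qed

text \<open>The Ginzburg-Landau energy of a profile \<open>z\<close> with derivative \<open>z'\<close>.\<close>

definition GL :: "(real \<Rightarrow> real) \<Rightarrow> real \<Rightarrow> (real \<Rightarrow> real) \<Rightarrow> (real \<Rightarrow> real) \<Rightarrow> real \<Rightarrow> real \<Rightarrow> real" where
  "GL W e z z' p q = integral {p..q} (\<lambda>x. e / 2 * (z' x)\<^sup>2 + W (z x) / e)"

lemma GL_integrable:
  assumes "continuous_on UNIV W" "continuous_on {p..q} z'"
    "\<And>x. x \<in> {p..q} \<Longrightarrow> (z has_real_derivative z' x) (at x within {p..q})" "0 < e"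
  shows "(\<lambda>x. e / 2 * (z' x)\<^sup>2 + W (z x) / e) integrable_on {p..q}"
proof -
  have "continuous_on {p..q} z" using assms(3) by (rule DERIV_continuous_on)
  then have "continuous_on {p..q} (\<lambda>x. W (z x))"
    by (rule continuous_on_compose2[OF assms(1)]) auto
  then show ?thesis using assms by (intro integrable_continuous_real continuous_intros) auto
qed

text \<open>Calibration: \<open>T\<close> plays the role of a subsolution of the Hamilton-Jacobi equation evaluated along \<open>z\<close>.\<close>

lemma GL_calibration:
  assumes cW: "continuous_on UNIV W" and pq: "p \<le> q" and e: "0 < e" and z': "continuous_on {p..q} z'"
    and z: "\<And>x. x \<in> {p..q} \<Longrightarrow> (z has_real_derivative z' x) (at x within {p..q})"
    and T: "\<And>x. x \<in> {p..q} \<Longrightarrow> (T has_real_derivative T' x) (at x within {p..q})"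
    and le: "\<And>x. x \<in> {p..q} \<Longrightarrow> T' x \<le> e / 2 * (z' x)\<^sup>2 + W (z x) / e"
  shows "T q - T p \<le> GL W e z z' p q"
proof -
  have "(T' has_integral T q - T p) {p..q}"
    using pq T by (intro fundamental_theorem_of_calculus) (auto simp: has_real_derivative_iff_has_vector_derivative)
  then show ?thesis unfolding GL_def
    by (rule has_integral_le[OF _ integrable_integral[OF GL_integrable[OF cW z' z e]]]) (use le in auto)
qed

text \<open>The weight \<open>t\<close> lets the gradient term be estimated with only the share
  \<open>t^2\<close> of the potential; the tail calibration spends the share \<open>1 - t^2\<close>
  elsewhere.\<close>

lemma weighted_AM_GM:
  fixes e x y :: real
  assumes "0 < e" "0 \<le> y"
  shows "sqrt (2 * y) * \<bar>x\<bar> * t \<le> e / 2 * x\<^sup>2 + t\<^sup>2 * (y / e)"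
proof -
  have "0 \<le> (e * \<bar>x\<bar> - t * sqrt (2 * y))\<^sup>2" by simp
  also have "\<dots> = e\<^sup>2 * x\<^sup>2 + t\<^sup>2 * (2 * y) - 2 * e * (sqrt (2 * y) * \<bar>x\<bar> * t)"
    using assms by (simp add: power2_diff power_mult_distrib algebra_simps)
  finally have "2 * e * (sqrt (2 * y) * \<bar>x\<bar> * t) \<le> 2 * e * (e / 2 * x\<^sup>2 + t\<^sup>2 * (y / e))"
    using assms by (simp add: power2_eq_square algebra_simps)
  then show ?thesis using assms by (simp only: mult_le_cancel_left_pos)
qed

text \<open>The calibrations are \<open>\<Phi> (z x)\<close> and its negative, with the weight 1 in
  \<open>weighted_AM_GM\<close>.\<close>

lemma GL_Modica_Mortola:
  assumes cW: "continuous_on UNIV W" and nonneg: "\<And>s. 0 \<le> W s" and e: "0 < e"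
    and \<Phi>: "\<And>s. (\<Phi> has_real_derivative sqrt (2 * W s)) (at s)"
    and pq: "p \<le> q" and z': "continuous_on {p..q} z'"
    and z: "\<And>x. x \<in> {p..q} \<Longrightarrow> (z has_real_derivative z' x) (at x within {p..q})"
  shows "\<bar>\<Phi> (z q) - \<Phi> (z p)\<bar> \<le> GL W e z z' p q"
proof -
  have D: "((\<lambda>x. \<Phi> (z x)) has_real_derivative sqrt (2 * W (z x)) * z' x) (at x within {p..q})" if "x \<in> {p..q}" for x
    by (rule DERIV_chain2[OF \<Phi> z[OF that]])
  have le: "\<bar>sqrt (2 * W (z x)) * z' x\<bar> \<le> e / 2 * (z' x)\<^sup>2 + W (z x) / e" for x
    using weighted_AM_GM[OF e nonneg, of "z x" "z' x" 1] nonneg by (simp add: abs_mult)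
  have "\<Phi> (z q) - \<Phi> (z p) \<le> GL W e z z' p q"
    by (rule GL_calibration[OF cW pq e z' z D]) (use le in \<open>force simp: abs_le_iff\<close>)+
  moreover have "(- \<Phi> (z q)) - (- \<Phi> (z p)) \<le> GL W e z z' p q"
    by (rule GL_calibration[OF cW pq e z' z DERIV_minus[OF D]]) (use le in \<open>force simp: abs_le_iff\<close>)+
  ultimately show ?thesis by linarith
qed

lemma GL_nonneg:
  assumes "continuous_on UNIV W" "\<And>s. 0 \<le> W s" "continuous_on {p..q} z'"
    "\<And>x. x \<in> {p..q} \<Longrightarrow> (z has_real_derivative z' x) (at x within {p..q})" "0 < e"
  shows "0 \<le> GL W e z z' p q"
  unfolding GL_def by (intro integral_nonneg GL_integrable) (use assms in auto)

lemma GL_split: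
  assumes cW: "continuous_on UNIV W" and z': "continuous_on {p..q} z'"
    and z: "\<And>x. x \<in> {p..q} \<Longrightarrow> (z has_real_derivative z' x) (at x within {p..q})" and e: "0 < e"
    and m: "p \<le> m" "m \<le> q"
  shows "GL W e z z' p q = GL W e z z' p m + GL W e z z' m q"
  unfolding GL_def
  by (rule HK_integral_combine[OF m GL_integrable[OF cW z' z e], symmetric])

lemma tanh_ge: "1 - 2 * exp (- 2 * y) \<le> tanh (y::real)"
proof -
  have "tanh y = (1 - exp (- 2 * y)) / (1 + exp (- 2 * y))" by (rule tanh_real_altdef)
  moreover have "(1 - 2 * exp (- 2 * y)) * (1 + exp (- 2 * y)) \<le> 1 - exp (- 2 * y)"
    by (simp add: algebra_simps)
  ultimately show ?thesis by (simp add: pos_le_divide_eq add_pos_pos)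
qed

text \<open>Far from the layer the profile may stop short of the well, which saves at most an exponentially
  small amount of energy: while \<open>z\<close> stays near \<open>1\<close>, the calibration is
  \<open>-(\<Phi> 1 - \<Phi> z) tanh ((q - x) / (e k))\<close>.\<close>

lemma GL_tail:
  assumes C3: "C3 W" and W1: "W 1 = 0" "deriv W 1 = 0" "0 < deriv (deriv W) 1"
    and nonneg: "\<And>s. 0 \<le> W s" and pos: "\<And>s. \<bar>s\<bar> < 1 \<Longrightarrow> 0 < W s"
    and \<Phi>: "\<And>s. (\<Phi> has_real_derivative sqrt (2 * W s)) (at s)"
    and A: "0 < A" "A < 2 * l * sqrt (deriv (deriv W) 1)"
  obtains \<rho> C where "0 < \<rho>" "\<rho> < 1" "0 \<le> C"
    "\<And>e p q z z'. \<lbrakk>0 < e; l \<le> q - p; continuous_on {p..q} z';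
      \<And>x. x \<in> {p..q} \<Longrightarrow> (z has_real_derivative z' x) (at x within {p..q}); 1 - \<rho> \<le> z p\<rbrakk>
      \<Longrightarrow> \<Phi> 1 - \<Phi> (z p) - C * exp (- A / e) \<le> GL W e z z' p q"
proof -
  have cW: "continuous_on UNIV W" using C3_D(3)[OF C3] .
  have l: "0 < l" using A W1(3) by (smt (verit) mult_nonpos_nonneg real_sqrt_gt_zero)
  \<comment> \<open>On a tail of length \<open>l\<close> the calibration loses a multiple of
    \<open>exp (- 2 * l / (e * k))\<close>. Matching this with \<open>exp (- A / e)\<close> fixes
    \<open>k\<close>, and the bound on \<open>A\<close> becomes the condition on \<open>k\<close> in
    \<open>double_well_slope\<close>.\<close>
  define k where "k = 2 * l / A"
  have k: "0 < k" using A l by (simp add: k_def)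
  have "1 < k * sqrt (deriv (deriv W) 1)" using A unfolding k_def by (simp add: field_simps)
  then have "1 < (k * sqrt (deriv (deriv W) 1))\<^sup>2" by (simp add: one_less_power)
  then have "1 < k\<^sup>2 * deriv (deriv W) 1" using W1(3) by (simp add: power_mult_distrib)
  from double_well_slope[OF C3 W1(1,2) k this nonneg \<Phi>]
  obtain \<rho>' where \<rho>': "0 < \<rho>'" "\<rho>' < 1" "\<And>s. 1 - \<rho>' \<le> s \<Longrightarrow> s \<le> 1 \<Longrightarrow> \<Phi> 1 - \<Phi> s \<le> k * W s" by blast
  have mono: "\<Phi> x \<le> \<Phi> y" if "x \<le> y" for x y
    by (rule DERIV_nonneg_imp_nondecreasing[OF that]) (use \<Phi> nonneg in \<open>blast intro: real_sqrt_ge_zero mult_nonneg_nonneg zero_le_numeral\<close>)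
  \<comment> \<open>The cost of moving between the well and the edge of the neighbourhood in which
    the slope estimate holds.\<close>
  define D where "D = \<Phi> 1 - \<Phi> (1 - \<rho>')"
  have "\<Phi> (1 - \<rho>') < \<Phi> (1 - \<rho>'/2)"
    by (rule DERIV_pos_imp_increasing) (use \<rho>' \<Phi> pos in \<open>auto intro!: exI[of _ "sqrt (2 * W _)"]\<close>)
  then have D: "D > 0" using mono[of "1 - \<rho>'/2" 1] \<rho>' by (simp add: D_def)
  have "isCont \<Phi> 1" using \<Phi> DERIV_isCont by blast
  then obtain d where d: "d > 0" "\<And>s. dist s 1 < d \<Longrightarrow> dist (\<Phi> s) (\<Phi> 1) < D / 2"
    using D unfolding continuous_at_eps_delta by (metis half_gt_zero)
  \<comment> \<open>Starting this close to the well, \<open>z p\<close> is at most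
    \<open>D / 2\<close> away from it in terms of \<open>\<Phi>\<close>, so that leaving the larger
    neighbourhood costs more than reaching the well.\<close>
  define \<rho> where "\<rho> = min (d/2) (\<rho>'/2)"
  have \<rho>: "0 < \<rho>" "\<rho> < \<rho>'" "\<rho> < d" using d(1) \<rho>' by (auto simp: \<rho>_def min_def)
  have main: "\<Phi> 1 - \<Phi> (z p) - 2 * D * exp (- A / e) \<le> GL W e z z' p q"
    if e: "0 < e" and len: "l \<le> q - p" and z': "continuous_on {p..q} z'"
      and z: "\<And>x. x \<in> {p..q} \<Longrightarrow> (z has_real_derivative z' x) (at x within {p..q})" and zp: "1 - \<rho> \<le> z p"
    for e p q z z'
  proof -
    have pq: "p \<le> q" using l len by simp
    have zp2: "\<Phi> 1 - D / 2 \<le> \<Phi> (z p)"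
    proof -
      have "\<Phi> 1 - D / 2 \<le> \<Phi> (1 - \<rho>)" using d(2)[of "1 - \<rho>"] \<rho> unfolding dist_real_def by linarith
      then show ?thesis using mono[OF zp] by simp
    qed
    have ex: "0 \<le> D * exp (- A / e)" using D by simp
    have reach: "\<bar>\<Phi> (z x) - \<Phi> (z p)\<bar> \<le> GL W e z z' p q" if x: "x \<in> {p..q}" for x
    proof -
      have s: "continuous_on {p..x} z'" "continuous_on {x..q} z'"
        "\<And>y. y \<in> {p..x} \<Longrightarrow> (z has_real_derivative z' y) (at y within {p..x})"
        "\<And>y. y \<in> {x..q} \<Longrightarrow> (z has_real_derivative z' y) (at y within {x..q})"
        using x by (auto intro: continuous_on_subset[OF z'] has_field_derivative_subset[OF z])
      have "\<bar>\<Phi> (z x) - \<Phi> (z p)\<bar> \<le> GL W e z z' p x"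
        using x by (intro GL_Modica_Mortola[OF cW nonneg e \<Phi> _ s(1,3)]) auto
      moreover have "0 \<le> GL W e z z' x q" by (rule GL_nonneg[OF cW nonneg s(2,4) e])
      ultimately show ?thesis using GL_split[OF cW z' z e, of x] x by simp
    qed
    \<comment> \<open>Reaching the well pays the full amount; leaving the neighbourhood pays at
      least \<open>D / 2\<close>, which is no less than the full amount. Only a profile that stays
      in between can save energy.\<close>
    consider (a) x where "x \<in> {p..q}" "1 \<le> z x" | (b) x where "x \<in> {p..q}" "z x < 1 - \<rho>'"
      | (c) "\<And>x. x \<in> {p..q} \<Longrightarrow> 1 - \<rho>' \<le> z x \<and> z x \<le> 1" by force
    then show ?thesis
    proof cases
      case a
      then show ?thesis using reach[OF a(1)] mono[OF a(2)] ex by linarith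
    next
      case b
      then have "\<Phi> (z x) \<le> \<Phi> 1 - D" using mono[of "z x" "1 - \<rho>'"] by (simp add: D_def)
      then show ?thesis using reach[OF b(1)] ex zp2 by linarith
    next
      case c
      define \<theta> where "\<theta> x = tanh ((q - x) / (e * k))" for x
      define T where "T x = - ((\<Phi> 1 - \<Phi> (z x)) * \<theta> x)" for x
      define T' where "T' x = sqrt (2 * W (z x)) * z' x * \<theta> x + (\<Phi> 1 - \<Phi> (z x)) * ((1 - (\<theta> x)\<^sup>2) / (e * k))" for x
      have ek: "0 < e * k" using e k by simp
      have "T q - T p \<le> GL W e z z' p q"
      proof (rule GL_calibration[OF cW pq e z' z])
        fix x assume x: "x \<in> {p..q}"
        have d\<Phi>: "((\<lambda>x. \<Phi> (z x)) has_real_derivative sqrt (2 * W (z x)) * z' x) (at x within {p..q})"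
          by (rule DERIV_chain2[OF \<Phi> z[OF x]])
        have "((\<lambda>x. (q - x) / (e * k)) has_real_derivative (0 - 1) / (e * k)) (at x within {p..q})"
          by (intro DERIV_cdivide DERIV_diff DERIV_const DERIV_ident)
        from has_field_derivative_tanh[OF cosh_real_nonzero this]
        have d\<theta>: "(\<theta> has_real_derivative - ((1 - (\<theta> x)\<^sup>2) / (e * k))) (at x within {p..q})"
          unfolding \<theta>_def by simp
        show "(T has_real_derivative T' x) (at x within {p..q})"
          unfolding T_def T'_def
          by (rule derivative_eq_intros d\<Phi> d\<theta> refl)+ (simp add: algebra_simps)
        have \<theta>: "0 \<le> \<theta> x" "\<theta> x \<le> 1" unfolding \<theta>_def using x ek tanh_real_lt_1[of "(q - x) / (e * k)"]
          by (auto intro: divide_nonneg_pos less_imp_le)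
        then have \<theta>2: "0 \<le> 1 - (\<theta> x)\<^sup>2" by (simp add: power_le_one)
        \<comment> \<open>The derivative of \<open>tanh\<close> is charged to the share
          \<open>1 - \<theta>^2\<close> of the potential by the slope estimate; the remaining share
          \<open>\<theta>^2\<close> goes into \<open>weighted_AM_GM\<close> below.\<close>
        have "(\<Phi> 1 - \<Phi> (z x)) * ((1 - (\<theta> x)\<^sup>2) / (e * k)) \<le> (k * W (z x)) * ((1 - (\<theta> x)\<^sup>2) / (e * k))"
          using c[OF x] \<rho>'(3)[of "z x"] \<theta>2 ek by (intro mult_right_mono divide_nonneg_pos) auto
        also have "\<dots> = (1 - (\<theta> x)\<^sup>2) * (W (z x) / e)" using k e by (simp add: field_simps)
        finally have 1: "(\<Phi> 1 - \<Phi> (z x)) * ((1 - (\<theta> x)\<^sup>2) / (e * k)) \<le> (1 - (\<theta> x)\<^sup>2) * (W (z x) / e)" .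
        have "sqrt (2 * W (z x)) * z' x * \<theta> x \<le> sqrt (2 * W (z x)) * \<bar>z' x\<bar> * \<theta> x"
          using \<theta> nonneg by (intro mult_right_mono mult_left_mono) auto
        also have "\<dots> \<le> e / 2 * (z' x)\<^sup>2 + (\<theta> x)\<^sup>2 * (W (z x) / e)"
          by (rule weighted_AM_GM[OF e nonneg])
        finally show "T' x \<le> e / 2 * (z' x)\<^sup>2 + W (z x) / e"
          using 1 unfolding T'_def by (simp add: algebra_simps)
      qed
      moreover have "T q = 0" by (simp add: T_def \<theta>_def)
      moreover have "(\<Phi> 1 - \<Phi> (z p)) - 2 * D * exp (- A / e) \<le> (\<Phi> 1 - \<Phi> (z p)) * \<theta> p"
      proof -
        have G: "0 \<le> \<Phi> 1 - \<Phi> (z p)" "\<Phi> 1 - \<Phi> (z p) \<le> D"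
          using mono[of "z p" 1] c[of p] pq zp2 D by auto
        have "A / e \<le> 2 * ((q - p) / (e * k))"
        proof -
          have "A / e = 2 * (l / (e * k))" using A l e by (simp add: k_def field_simps)
          also have "\<dots> \<le> 2 * ((q - p) / (e * k))" using len ek by (intro mult_left_mono divide_right_mono) auto
          finally show ?thesis .
        qed
        then have "exp (- 2 * ((q - p) / (e * k))) \<le> exp (- A / e)"
          unfolding exp_le_cancel_iff minus_divide_left[symmetric] by linarith
        then have "1 - 2 * exp (- A / e) \<le> \<theta> p"
          unfolding \<theta>_def using tanh_ge[of "(q - p) / (e * k)"] by linarith
        from mult_left_mono[OF this G(1)] have "(\<Phi> 1 - \<Phi> (z p)) - 2 * ((\<Phi> 1 - \<Phi> (z p)) * exp (- A / e)) \<le> (\<Phi> 1 - \<Phi> (z p)) * \<theta> p"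
          by (simp add: algebra_simps)
        moreover have "(\<Phi> 1 - \<Phi> (z p)) * exp (- A / e) \<le> D * exp (- A / e)" using G by (intro mult_right_mono) auto
        ultimately show ?thesis by linarith
      qed
      moreover have "T p = - ((\<Phi> 1 - \<Phi> (z p)) * \<theta> p)" by (simp add: T_def)
      ultimately show ?thesis by linarith
    qed
  qed
  show ?thesis by (rule that[of \<rho> "2 * D"]) (use \<rho> \<rho>' D main in auto)
qed

section \<open>Symmetries of the double well and the cost of a complete layer\<close>

definition double_well :: "(real \<Rightarrow> real) \<Rightarrow> bool" where
  "double_well W \<longleftrightarrow> C3 W \<and> W 1 = 0 \<and> W (-1) = 0 \<and> deriv W 1 = 0 \<and> deriv W (-1) = 0
     \<and> deriv (deriv W) 1 > 0 \<and> deriv (deriv W) (-1) > 0 \<and> (\<forall>s. s \<noteq> 1 \<and> s \<noteq> -1 \<longrightarrow> W s > 0)"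

lemma double_well_nonneg: "double_well W \<Longrightarrow> 0 \<le> W s"
  unfolding double_well_def by (metis less_eq_real_def)

lemma double_well_pos: "double_well W \<Longrightarrow> \<bar>s\<bar> < 1 \<Longrightarrow> 0 < W s"
  unfolding double_well_def by (elim conjE allE[of _ s]) auto

lemma deriv_reflect:
  fixes f :: "real \<Rightarrow> real"
  assumes "\<And>x. f differentiable (at x)"
  shows "((\<lambda>x. f (- x)) has_real_derivative - deriv f (- x)) (at x)" "deriv (\<lambda>x. f (- x)) = (\<lambda>x. - deriv f (- x))"
proof -
  have "(f has_real_derivative deriv f y) (at y)" for y
    using assms DERIV_deriv_iff_real_differentiable by blast
  from DERIV_chain2[OF this DERIV_minus[OF DERIV_ident]]
  show *: "((\<lambda>x. f (- x)) has_real_derivative - deriv f (- x)) (at x)" for x by simp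
  show "deriv (\<lambda>x. f (- x)) = (\<lambda>x. - deriv f (- x))" using DERIV_imp_deriv[OF *] by blast
qed

lemma double_well_reflect:
  assumes "double_well W"
  shows "double_well (\<lambda>s. W (- s))" "deriv (deriv (\<lambda>s. W (- s))) = (\<lambda>s. deriv (deriv W) (- s))"
proof -
  let ?D = "deriv W" and ?DD = "deriv (deriv W)"
  have d: "W differentiable (at x)" "?D differentiable (at x)" "?DD differentiable (at x)"
    and c: "continuous_on UNIV (deriv ?DD)" for x
    using assms by (auto simp: double_well_def C3_def)
  have d1: "deriv (\<lambda>s. W (- s)) = (\<lambda>s. - ?D (- s))" by (rule deriv_reflect(2)[OF d(1)])
  have D2: "((\<lambda>s. - ?D (- s)) has_real_derivative ?DD (- x)) (at x)" for x
    using DERIV_minus[OF deriv_reflect(1)[OF d(2)]] by simp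
  then have d2: "deriv (\<lambda>s. - ?D (- s)) = (\<lambda>s. ?DD (- s))" using DERIV_imp_deriv by blast
  have d3: "deriv (\<lambda>s. ?DD (- s)) = (\<lambda>s. - deriv ?DD (- s))" by (rule deriv_reflect(2)[OF d(3)])
  show dd: "deriv (deriv (\<lambda>s. W (- s))) = (\<lambda>s. ?DD (- s))" unfolding d1 d2 ..
  have "continuous_on UNIV (\<lambda>s. - deriv ?DD (- s))"
    by (intro continuous_intros continuous_on_compose2[OF c]) auto
  then have "C3 (\<lambda>s. W (- s))"
    unfolding C3_def d1 d2 d3 using deriv_reflect(1)[OF d(1)] D2 deriv_reflect(1)[OF d(3)]
    by (auto simp: real_differentiable_def)
  then show "double_well (\<lambda>s. W (- s))"
    using assms unfolding double_well_def d1 d2 by (auto simp: minus_equation_iff)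
qed

text \<open>Reversing \<open>x\<close> and the sign of the profile turns the tail to the left of a
  layer, near -1, into a right tail near 1, to which \<open>GL_tail\<close> applies.\<close>

lemma GL_reflect: "GL W e z z' p q = GL (\<lambda>s. W (- s)) e (\<lambda>x. - z (- x)) (\<lambda>x. z' (- x)) (- q) (- p)"
  unfolding GL_def using Henstock_Kurzweil_Integration.integral_reflect_real[of q p "\<lambda>x. e / 2 * (z' x)\<^sup>2 + W (z x) / e"]
  by simp

lemma GL_negate: "GL W e z z' p q = GL (\<lambda>s. W (- s)) e (\<lambda>x. - z x) (\<lambda>x. - z' x) p q"
  unfolding GL_def by simp

text \<open>The interval is cut at \<open>x1\<close> and \<open>x2\<close>. The two tails are
  bounded by \<open>GL_tail\<close>, the left one after reflection, the middle by the Modica-Mortola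
  inequality; the increments of \<open>\<Phi>\<close> telescope.\<close>

lemma GL_layer_up:
  assumes W: "double_well W" and A: "0 < A" "A < 2 * l * sqrt (min (deriv (deriv W) 1) (deriv (deriv W) (-1)))"
    and \<Phi>: "\<And>s. (\<Phi> has_real_derivative sqrt (2 * W s)) (at s)"
  obtains \<rho> C where "0 < \<rho>" "0 \<le> C"
    "\<And>e p x1 x2 q z z'. \<lbrakk>0 < e; p \<le> x1 - l; x1 \<le> x2; x2 + l \<le> q; continuous_on {p..q} z';
      \<And>x. x \<in> {p..q} \<Longrightarrow> (z has_real_derivative z' x) (at x within {p..q}); z x1 \<le> -1 + \<rho>; 1 - \<rho> \<le> z x2\<rbrakk>
      \<Longrightarrow> \<Phi> 1 - \<Phi> (-1) - C * exp (- A / e) \<le> GL W e z z' p q"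
proof -
  let ?W = "\<lambda>s. W (- s)"
  note Wr = double_well_reflect[OF W]
  have l: "0 < l"
    using A W unfolding double_well_def by (smt (verit) mult_nonpos_nonneg real_sqrt_gt_zero)
  have le: "2 * l * sqrt (min (deriv (deriv W) 1) (deriv (deriv W) (-1))) \<le> 2 * l * sqrt (deriv (deriv W) s)"
    if "s = 1 \<or> s = -1" for s
    using l that by (intro mult_left_mono real_sqrt_le_mono) auto
  have A1: "A < 2 * l * sqrt (deriv (deriv W) 1)" using A(2) le[of 1] by linarith
  have A2: "A < 2 * l * sqrt (deriv (deriv ?W) 1)" using A(2) le[of "-1"] unfolding Wr(2) by linarith
  have W1: "C3 W" "W 1 = 0" "deriv W 1 = 0" "0 < deriv (deriv W) 1"
    using W unfolding double_well_def by auto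
  have W2: "C3 ?W" "?W 1 = 0" "deriv ?W 1 = 0" "0 < deriv (deriv ?W) 1"
    using Wr(1) W unfolding double_well_def by auto
  have \<Phi>r: "((\<lambda>s. - \<Phi> (- s)) has_real_derivative sqrt (2 * ?W s)) (at s)" for s
    using DERIV_minus[OF DERIV_chain2[OF \<Phi> DERIV_minus[OF DERIV_ident]]] by simp
  obtain \<rho>1 C1 where 1: "0 < \<rho>1" "0 \<le> C1"
    "\<And>e p q z z'. \<lbrakk>0 < e; l \<le> q - p; continuous_on {p..q} z';
      \<And>x. x \<in> {p..q} \<Longrightarrow> (z has_real_derivative z' x) (at x within {p..q}); 1 - \<rho>1 \<le> z p\<rbrakk>
      \<Longrightarrow> \<Phi> 1 - \<Phi> (z p) - C1 * exp (- A / e) \<le> GL W e z z' p q"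
    by (rule GL_tail[OF W1(1-4) double_well_nonneg[OF W] double_well_pos[OF W] \<Phi> A(1) A1]) blast+
  obtain \<rho>2 C2 where 2: "0 < \<rho>2" "0 \<le> C2"
    "\<And>e p q z z'. \<lbrakk>0 < e; l \<le> q - p; continuous_on {p..q} z';
      \<And>x. x \<in> {p..q} \<Longrightarrow> (z has_real_derivative z' x) (at x within {p..q}); 1 - \<rho>2 \<le> z p\<rbrakk>
      \<Longrightarrow> - \<Phi> (- 1) - - \<Phi> (- z p) - C2 * exp (- A / e) \<le> GL ?W e z z' p q"
    by (rule GL_tail[OF W2(1-4) double_well_nonneg[OF Wr(1)] double_well_pos[OF Wr(1)] \<Phi>r A(1) A2]) blast+
  have cW: "continuous_on UNIV W" by (rule C3_D(3)[OF W1(1)])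
  have main: "\<Phi> 1 - \<Phi> (-1) - (C1 + C2) * exp (- A / e) \<le> GL W e z z' p q"
    if e: "0 < e" and x: "p \<le> x1 - l" "x1 \<le> x2" "x2 + l \<le> q" and z': "continuous_on {p..q} z'"
      and z: "\<And>x. x \<in> {p..q} \<Longrightarrow> (z has_real_derivative z' x) (at x within {p..q})"
      and zx: "z x1 \<le> -1 + min \<rho>1 \<rho>2" "1 - min \<rho>1 \<rho>2 \<le> z x2"
    for e p x1 x2 q z z'
  proof -
    have s: "continuous_on {c..d} z'" "\<And>x. x \<in> {c..d} \<Longrightarrow> (z has_real_derivative z' x) (at x within {c..d})"
      if "p \<le> c" "d \<le> q" for c d
      using that by (auto intro: continuous_on_subset[OF z'] has_field_derivative_subset[OF z])
    have right: "\<Phi> 1 - \<Phi> (z x2) - C1 * exp (- A / e) \<le> GL W e z z' x2 q"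
      using x zx l by (intro 1(3) e s) auto
    have mid: "\<bar>\<Phi> (z x2) - \<Phi> (z x1)\<bar> \<le> GL W e z z' x1 x2"
      using x l by (intro GL_Modica_Mortola[OF cW double_well_nonneg[OF W] e \<Phi>] s) auto
    have "- \<Phi> (- 1) - - \<Phi> (- (- z (- (- x1)))) - C2 * exp (- A / e) \<le> GL ?W e (\<lambda>x. - z (- x)) (\<lambda>x. z' (- x)) (- x1) (- p)"
    proof (rule 2(3)[OF e])
      show "continuous_on {- x1..- p} (\<lambda>x. z' (- x))"
        by (rule continuous_on_compose2[OF z']) (use x l in \<open>auto intro!: continuous_intros\<close>)
      fix y assume y: "y \<in> {- x1..- p}"
      have "(z has_real_derivative z' (- y)) (at (- y) within uminus ` {- x1..- p})"
        by (rule has_field_derivative_subset[OF z]) (use x l y in auto)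
      from DERIV_image_chain[OF this DERIV_minus[OF DERIV_ident]]
      have "((\<lambda>x. z (- x)) has_real_derivative z' (- y) * - 1) (at y within {- x1..- p})" by (simp add: o_def)
      from DERIV_minus[OF this]
      show "((\<lambda>x. - z (- x)) has_real_derivative z' (- y)) (at y within {- x1..- p})" by simp
    qed (use x l zx in auto)
    then have left: "\<Phi> (z x1) - \<Phi> (-1) - C2 * exp (- A / e) \<le> GL W e z z' p x1"
      unfolding GL_reflect[of W e z z' p x1] by simp
    have "GL W e z z' p q = GL W e z z' p x1 + (GL W e z z' x1 x2 + GL W e z z' x2 q)"
      using GL_split[OF cW z' z e, of x1] GL_split[OF cW s e, of x1 q x2] x l by auto
    then show ?thesis using left mid right by (simp add: algebra_simps abs_le_iff)
  qed
  show ?thesis by (rule that[of "min \<rho>1 \<rho>2" "C1 + C2"]) (use 1(1,2) 2(1,2) main in auto)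
qed

text \<open>A descending layer is an ascending one for the negated profile and the reflected
  potential, whose transition cost is the same.\<close>

lemma GL_layer:
  assumes W: "double_well W" and A: "0 < A" "A < 2 * l * sqrt (min (deriv (deriv W) 1) (deriv (deriv W) (-1)))"
  obtains \<rho> C where "0 < \<rho>" "0 \<le> C"
    "\<And>e p x1 x2 q z z'. \<lbrakk>0 < e; p \<le> x1 - l; x1 \<le> x2; x2 + l \<le> q; continuous_on {p..q} z';
      \<And>x. x \<in> {p..q} \<Longrightarrow> (z has_real_derivative z' x) (at x within {p..q});
      z x1 \<le> -1 + \<rho> \<and> 1 - \<rho> \<le> z x2 \<or> 1 - \<rho> \<le> z x1 \<and> z x2 \<le> -1 + \<rho>\<rbrakk>
      \<Longrightarrow> integral {-1..1} (\<lambda>s. sqrt (2 * W s)) - C * exp (- A / e) \<le> GL W e z z' p q"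
proof -
  let ?W = "\<lambda>s. W (- s)"
  note Wr = double_well_reflect[OF W]
  have "continuous_on UNIV (\<lambda>s. sqrt (2 * W s))"
    using W unfolding double_well_def by (intro continuous_intros C3_D(3)) auto
  then obtain \<Phi> where \<Phi>: "\<And>s. (\<Phi> has_real_derivative sqrt (2 * W s)) (at s)"
    using antiderivative_UNIV by blast
  have "((\<lambda>s. sqrt (2 * W s)) has_integral \<Phi> 1 - \<Phi> (-1)) {-1..1}"
    using \<Phi> by (intro fundamental_theorem_of_calculus)
      (auto simp: has_real_derivative_iff_has_vector_derivative intro: has_vector_derivative_at_within)
  then have c0: "integral {-1..1} (\<lambda>s. sqrt (2 * W s)) = \<Phi> 1 - \<Phi> (-1)" by (rule integral_unique)
  have \<Phi>r: "((\<lambda>s. - \<Phi> (- s)) has_real_derivative sqrt (2 * ?W s)) (at s)" for s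
    using DERIV_minus[OF DERIV_chain2[OF \<Phi> DERIV_minus[OF DERIV_ident]]] by simp
  have Ar: "A < 2 * l * sqrt (min (deriv (deriv ?W) 1) (deriv (deriv ?W) (-1)))"
    using A(2) unfolding Wr(2) by (simp add: min.commute)
  obtain \<rho>1 C1 where 1: "0 < \<rho>1" "0 \<le> C1"
    "\<And>e p x1 x2 q z z'. \<lbrakk>0 < e; p \<le> x1 - l; x1 \<le> x2; x2 + l \<le> q; continuous_on {p..q} z';
      \<And>x. x \<in> {p..q} \<Longrightarrow> (z has_real_derivative z' x) (at x within {p..q}); z x1 \<le> -1 + \<rho>1; 1 - \<rho>1 \<le> z x2\<rbrakk>
      \<Longrightarrow> \<Phi> 1 - \<Phi> (-1) - C1 * exp (- A / e) \<le> GL W e z z' p q"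
    by (rule GL_layer_up[OF W A \<Phi>]) blast+
  obtain \<rho>2 C2 where 2: "0 < \<rho>2" "0 \<le> C2"
    "\<And>e p x1 x2 q z z'. \<lbrakk>0 < e; p \<le> x1 - l; x1 \<le> x2; x2 + l \<le> q; continuous_on {p..q} z';
      \<And>x. x \<in> {p..q} \<Longrightarrow> (z has_real_derivative z' x) (at x within {p..q}); z x1 \<le> -1 + \<rho>2; 1 - \<rho>2 \<le> z x2\<rbrakk>
      \<Longrightarrow> - \<Phi> (- 1) - - \<Phi> (- (- 1)) - C2 * exp (- A / e) \<le> GL ?W e z z' p q"
    by (rule GL_layer_up[OF Wr(1) A(1) Ar \<Phi>r]) blast+
  have main: "\<Phi> 1 - \<Phi> (-1) - max C1 C2 * exp (- A / e) \<le> GL W e z z' p q"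
    if e: "0 < e" and x: "p \<le> x1 - l" "x1 \<le> x2" "x2 + l \<le> q" and z': "continuous_on {p..q} z'"
      and z: "\<And>x. x \<in> {p..q} \<Longrightarrow> (z has_real_derivative z' x) (at x within {p..q})"
      and zx: "z x1 \<le> -1 + min \<rho>1 \<rho>2 \<and> 1 - min \<rho>1 \<rho>2 \<le> z x2 \<or> 1 - min \<rho>1 \<rho>2 \<le> z x1 \<and> z x2 \<le> -1 + min \<rho>1 \<rho>2"
    for e p x1 x2 q z z'
    using zx
  proof
    assume "z x1 \<le> -1 + min \<rho>1 \<rho>2 \<and> 1 - min \<rho>1 \<rho>2 \<le> z x2"
    then have "\<Phi> 1 - \<Phi> (-1) - C1 * exp (- A / e) \<le> GL W e z z' p q"
      by (intro 1(3)[OF e x z' z]) auto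
    moreover have "C1 * exp (- A / e) \<le> max C1 C2 * exp (- A / e)" by (intro mult_right_mono) auto
    ultimately show ?thesis by linarith
  next
    assume "1 - min \<rho>1 \<rho>2 \<le> z x1 \<and> z x2 \<le> -1 + min \<rho>1 \<rho>2"
    then have "- \<Phi> (- 1) - - \<Phi> (- (- 1)) - C2 * exp (- A / e) \<le> GL ?W e (\<lambda>x. - z x) (\<lambda>x. - z' x) p q"
      by (intro 2(3)[OF e x continuous_on_minus[OF z'] DERIV_minus[OF z]]) auto
    moreover have "C2 * exp (- A / e) \<le> max C1 C2 * exp (- A / e)" by (intro mult_right_mono) auto
    moreover have "- \<Phi> (- 1) - - \<Phi> (- (- 1)) = \<Phi> 1 - \<Phi> (- 1)" by simp
    ultimately show ?thesis unfolding GL_negate[of W e z z' p q] by linarith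
  qed
  show ?thesis unfolding c0[symmetric]
    by (rule that[of "min \<rho>1 \<rho>2" "max C1 C2", unfolded c0]) (use 1(1,2) 2(1,2) main in auto)
qed

section \<open>Distance between primitives as a detector of separated functions\<close>

lemma L1dist_commute: "L1dist a b f g = L1dist a b g f"
  by (simp add: L1dist_def abs_minus_commute)

text \<open>Testing \<open>prim a f - prim a g\<close>, which has slope at least \<open>\<rho>\<close>, against \<open>x - (c + d) / 2\<close>.\<close>

lemma L1dist_prim_ge:
  assumes f: "f integrable_on {a..b}" and g: "g integrable_on {a..b}"
    and cd: "a \<le> c" "c < d" "d \<le> b" and \<rho>: "0 \<le> \<rho>"
    and fg: "\<And>x. c < x \<Longrightarrow> x < d \<Longrightarrow> \<rho> \<le> f x - g x"
  shows "\<rho> * (d - c)\<^sup>2 / 6 \<le> L1dist a b (prim a f) (prim a g)"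
proof -
  define D where "D x = prim a f x - prim a g x" for x
  have cp: "continuous_on {a..b} (prim a k)" if "k integrable_on {a..b}" for k :: "real \<Rightarrow> real"
    unfolding prim_def using that by (rule indefinite_integral_continuous_1)
  have cD: "continuous_on {a..b} D" unfolding D_def by (intro continuous_intros cp f g)
  have slope: "\<rho> * (y - x) \<le> D y - D x" if xy: "c \<le> x" "x \<le> y" "y \<le> d" for x y
  proof -
    have i: "f integrable_on {x..y}" "g integrable_on {x..y}"
      using xy cd integrable_subinterval_real[OF f, of x y] integrable_subinterval_real[OF g, of x y] by auto
    then have i2: "(\<lambda>s. f s - g s) integrable_on {x..y}" by (rule integrable_diff)
    have "D y - D x = integral {x..y} f - integral {x..y} g"
      using integral_Icc_diff[OF f, of x y] integral_Icc_diff[OF g, of x y] xy cd by (simp add: D_def prim_def)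
    also have "\<dots> = integral {x..y} (\<lambda>s. f s - g s)"
      using i by (simp add: HK_integral_diff)
    \<comment> \<open>The lower bound on \<open>f - g\<close> is known only in the open interval, so
      the two endpoint values are replaced.\<close>
    also have "\<dots> = integral {x..y} (\<lambda>s. if s \<in> {c,d} then \<rho> else f s - g s)"
      by (rule integral_spike[of "{c,d}"]) auto
    also have "\<dots> \<ge> integral {x..y} (\<lambda>s. \<rho>)"
    proof (rule integral_le)
      show "(\<lambda>s. if s \<in> {c,d} then \<rho> else f s - g s) integrable_on {x..y}"
        by (rule integrable_spike[OF i2, of "{c,d}"]) auto
      show "\<rho> \<le> (if s \<in> {c,d} then \<rho> else f s - g s)" if "s \<in> {x..y}" for s
        using fg[of s] that xy by auto
    qed auto
    finally show ?thesis using xy by (simp add: mult.commute)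
  qed
  define m where "m = (c + d) / 2"
  have m: "c \<le> m" "m \<le> d" using cd by (auto simp: m_def)
  \<comment> \<open>Once integrated over \<open>{c..d}\<close>, the term
    \<open>D m * (x - m)\<close> drops out by symmetry about the midpoint, so the unknown value
    \<open>D m\<close> does not matter. The remaining \<open>\<rho> * (d - c)^3 / 12\<close>,
    divided by \<open>(d - c) / 2\<close>, yields the 6 in the claim.\<close>
  have pt: "D m * (x - m) + \<rho> * (x - m)\<^sup>2 \<le> (d - c) / 2 * \<bar>D x\<bar>" if x: "x \<in> {c..d}" for x
  proof -
    have "\<rho> * (x - m)\<^sup>2 \<le> (D x - D m) * (x - m)"
    proof (cases "m \<le> x")
      case True
      then show ?thesis using mult_right_mono[OF slope[of m x], of "x - m"] m x by (simp add: power2_eq_square mult_ac)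
    next
      case False
      then show ?thesis using mult_right_mono[OF slope[of x m], of "m - x"] m x by (simp add: power2_eq_square algebra_simps)
    qed
    moreover have "D x * (x - m) \<le> \<bar>D x\<bar> * ((d - c) / 2)"
    proof -
      have "D x * (x - m) \<le> \<bar>D x\<bar> * \<bar>x - m\<bar>" by (metis abs_ge_self abs_mult)
      also have "\<dots> \<le> \<bar>D x\<bar> * ((d - c) / 2)" using x by (intro mult_left_mono) (auto simp: m_def abs_le_iff field_simps)
      finally show ?thesis .
    qed
    ultimately show ?thesis by (simp add: algebra_simps)
  qed
  have "((\<lambda>x. D m * (x - m) + \<rho> * (x - m)\<^sup>2) has_integral
      (D m * (d - m)\<^sup>2 / 2 + \<rho> * (d - m)^3 / 3) - (D m * (c - m)\<^sup>2 / 2 + \<rho> * (c - m)^3 / 3)) {c..d}"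
    using cd by (intro fundamental_theorem_of_calculus)
      (auto simp: has_real_derivative_iff_has_vector_derivative[symmetric] power2_eq_square eval_nat_numeral field_simps
        intro!: derivative_eq_intros)
  moreover have "(D m * (d - m)\<^sup>2 / 2 + \<rho> * (d - m)^3 / 3) - (D m * (c - m)\<^sup>2 / 2 + \<rho> * (c - m)^3 / 3) = \<rho> * (d - c)^3 / 12"
  proof -
    define L where "L = d - m"
    have "c - m = - L" "d - c = 2 * L" by (auto simp: m_def L_def field_simps)
    then show ?thesis unfolding L_def[symmetric] by (simp add: power_mult_distrib)
  qed
  ultimately have "((\<lambda>x. D m * (x - m) + \<rho> * (x - m)\<^sup>2) has_integral \<rho> * (d - c)^3 / 12) {c..d}" by simp
  moreover have "continuous_on {c..d} D" using cD by (rule continuous_on_subset) (use cd in auto)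
  then have iD: "(\<lambda>x. \<bar>D x\<bar>) integrable_on {c..d}" "(\<lambda>x. \<bar>D x\<bar>) integrable_on {a..b}"
    using cD by (auto intro!: integrable_continuous_real continuous_intros)
  have "((\<lambda>x. (d - c) / 2 * \<bar>D x\<bar>) has_integral (d - c) / 2 * integral {c..d} (\<lambda>x. \<bar>D x\<bar>)) {c..d}"
    by (intro has_integral_mult_right integrable_integral iD)
  ultimately have "\<rho> * (d - c)^3 / 12 \<le> (d - c) / 2 * integral {c..d} (\<lambda>x. \<bar>D x\<bar>)"
    by (rule has_integral_le) (rule pt)
  then have "(d - c) / 2 * (\<rho> * (d - c)\<^sup>2 / 6) \<le> (d - c) / 2 * integral {c..d} (\<lambda>x. \<bar>D x\<bar>)"
    by (simp add: eval_nat_numeral mult_ac)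
  then have "\<rho> * (d - c)\<^sup>2 / 6 \<le> integral {c..d} (\<lambda>x. \<bar>D x\<bar>)" using cd by simp
  also have "\<dots> \<le> integral {a..b} (\<lambda>x. \<bar>D x\<bar>)"
    using cd by (intro integral_subset_le iD) auto
  finally show ?thesis by (simp add: L1dist_def D_def)
qed

section \<open>Profiles with jumps\<close>

locale jump_profile =
  fixes a b r :: real and v :: "real \<Rightarrow> real" and N :: nat and h :: "nat \<Rightarrow> real"
  assumes ab: "a < b" and N: "N \<ge> 1"
    and h: "a < h 1" "\<forall>i. 1 \<le> i \<and> i < N \<longrightarrow> h i < h (Suc i)" "h N < b"
    and v_vals: "\<forall>x\<in>{a..b}. v x = 1 \<or> v x = -1"
    and v_const: "\<forall>i\<le>N. \<forall>x y. x \<in> {node a b N h i<..<node a b N h (Suc i)}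
                    \<longrightarrow> y \<in> {node a b N h i<..<node a b N h (Suc i)} \<longrightarrow> v x = v y"
    and v_jump: "\<forall>i. 1 \<le> i \<and> i \<le> N \<longrightarrow> (\<forall>x y. x \<in> {node a b N h (i - 1)<..<node a b N h i}
                    \<longrightarrow> y \<in> {node a b N h i<..<node a b N h (Suc i)} \<longrightarrow> v x \<noteq> v y)"
    and r: "r > 0"
      "\<forall>i j. 1 \<le> i \<and> i < j \<and> j \<le> N \<longrightarrow> {h i - r<..<h i + r} \<inter> {h j - r<..<h j + r} = {}"
      "a \<le> h 1 - r" "h N + r \<le> b"
begin

abbreviation nd :: "nat \<Rightarrow> real" where "nd \<equiv> node a b N h"

text \<open>Otherwise the midpoint between the two jumps would lie in both intervals.\<close>

lemma layer_gap:
  assumes i: "1 \<le> i" "i < N"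
  shows "h i + r \<le> h (Suc i) - r"
proof (rule ccontr)
  assume *: "\<not> h i + r \<le> h (Suc i) - r"
  have lt: "h i < h (Suc i)" using h(2) i by blast
  have "(h i + h (Suc i)) / 2 \<in> {h i - r<..<h i + r} \<inter> {h (Suc i) - r<..<h (Suc i) + r}"
    using * lt r(1) by (auto simp: field_simps)
  moreover have "{h i - r<..<h i + r} \<inter> {h (Suc i) - r<..<h (Suc i) + r} = {}" using r(2) i by simp
  ultimately show False by blast
qed

lemma nd_0: "nd 0 = a" and nd_Suc_N: "nd (Suc N) = b" and nd_h: "1 \<le> i \<Longrightarrow> i \<le> N \<Longrightarrow> nd i = h i"
  by (auto simp: node_def)

lemma nd_right: "1 \<le> i \<Longrightarrow> i \<le> N \<Longrightarrow> h i + r \<le> nd (Suc i)"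
  using layer_gap[of i] r by (cases "i = N") (auto simp: node_def)

lemma nd_left: "1 \<le> i \<Longrightarrow> i \<le> N \<Longrightarrow> nd (i - 1) \<le> h i - r"
proof (cases "i = 1")
  case False
  assume "1 \<le> i" "i \<le> N"
  with False obtain j where "i = Suc j" "1 \<le> j" "j < N" by (cases i) auto
  then show ?thesis using layer_gap[of j] r(1) by (simp add: node_def)
qed (use r in \<open>simp add: node_def\<close>)

lemma nd_less: "i \<le> N \<Longrightarrow> nd i < nd (Suc i)"
  using nd_right[of i] r h(1) N by (cases "i = 0") (auto simp: nd_h, auto simp: node_def)

lemma nd_mono: "i \<le> j \<Longrightarrow> j \<le> Suc N \<Longrightarrow> nd i \<le> nd j"
proof (induction j rule: dec_induct)
  case (step j)
  then show ?case using nd_less[of j] by simp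
qed simp

lemma nd_bounds: "i \<le> Suc N \<Longrightarrow> a \<le> nd i \<and> nd i \<le> b"
  using nd_mono[of 0 i] nd_mono[of i "Suc N"] by (simp add: nd_0 nd_Suc_N)

lemma layer_bounds: "1 \<le> i \<Longrightarrow> i \<le> N \<Longrightarrow> a \<le> h i - r \<and> h i + r \<le> b"
  using nd_left[of i] nd_right[of i] nd_bounds[of "i - 1"] nd_bounds[of "Suc i"] by force

lemma v_integrable: "v integrable_on {a..b}"
proof -
  have "v integrable_on {a..nd i}" if "i \<le> Suc N" for i
    using that
  proof (induction i)
    case 0
    then show ?case using integrable_on_refl[of v a] by (simp add: nd_0)
  next
    case (Suc i)
    have lt: "nd i < nd (Suc i)" using Suc nd_less by simp
    define c where "c = v ((nd i + nd (Suc i)) / 2)"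
    have "v integrable_on {nd i..nd (Suc i)}"
    proof (rule integrable_spike)
      show "(\<lambda>_. c) integrable_on {nd i..nd (Suc i)}" by (rule integrable_const_ivl)
      show "negligible {nd i, nd (Suc i)}" by simp
      fix x assume "x \<in> {nd i..nd (Suc i)} - {nd i, nd (Suc i)}"
      then have "x \<in> {nd i<..<nd (Suc i)}" "(nd i + nd (Suc i)) / 2 \<in> {nd i<..<nd (Suc i)}"
        using lt by auto
      from v_const[rule_format, OF _ this] show "v x = c" unfolding c_def using Suc.prems by simp
    qed
    then show ?case
      using Suc lt nd_bounds[of i]
      by (intro Henstock_Kurzweil_Integration.integrable_combine[of a "nd i" "nd (Suc i)" v]) auto
  qed
  from this[of "Suc N"] show ?thesis by (simp add: nd_Suc_N)
qed

lemma v_absolutely_integrable: "v absolutely_integrable_on {a..b}"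
proof (rule absolutely_integrable_integrable_bound[where g = "\<lambda>_. 1"])
  show "norm (v x) \<le> 1" if "x \<in> {a..b}" for x using v_vals that by fastforce
qed (use v_integrable in auto)

lemma v_layer:
  assumes i: "1 \<le> i" "i \<le> N"
  obtains \<sigma> where "\<sigma> = 1 \<or> \<sigma> = -1" "\<And>x. h i - r < x \<Longrightarrow> x < h i \<Longrightarrow> v x = - \<sigma>"
    "\<And>x. h i < x \<Longrightarrow> x < h i + r \<Longrightarrow> v x = \<sigma>"
proof -
  define p q where "p = h i - r / 2" and "q = h i + r / 2"
  have L: "x \<in> {nd (i - 1)<..<nd (Suc (i - 1))}" if "h i - r < x" "x < h i" for x
    using nd_left[OF i] that i by (simp add: nd_h)
  have R: "x \<in> {nd i<..<nd (Suc i)}" if "h i < x" "x < h i + r" for x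
    using nd_right[OF i] that i by (simp add: nd_h)
  have pq: "h i - r < p" "p < h i" "h i < q" "q < h i + r" using r(1) by (auto simp: p_def q_def)
  have "v p \<noteq> v q" using v_jump i L[OF pq(1,2)] R[OF pq(3,4)] by auto
  have "p \<in> {a..b}" "q \<in> {a..b}" using layer_bounds[OF i] pq by auto
  then have s: "v q = 1 \<or> v q = -1" "v p = 1 \<or> v p = -1" using v_vals by blast+
  then have "v p = - v q" using \<open>v p \<noteq> v q\<close> by auto
  have "v x = v p" if "h i - r < x" "x < h i" for x
    using v_const[rule_format, OF _ L[OF that] L[OF pq(1,2)]] i by simp
  moreover have "v x = v q" if "h i < x" "x < h i + r" for x
    using v_const[rule_format, OF _ R[OF that] R[OF pq(3,4)]] i by simp
  ultimately show ?thesis using that[of "v q"] s(1) \<open>v p = - v q\<close> by simp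
qed

lemma sum_layers_le:
  assumes f: "f integrable_on {a..b}" and nonneg: "\<And>x. x \<in> {a..b} \<Longrightarrow> 0 \<le> f x"
  shows "(\<Sum>i=1..N. integral {h i - r..h i + r} f) \<le> integral {a..b} (f :: real \<Rightarrow> real)"
proof -
  have sub: "f integrable_on {x..y}" if "a \<le> x" "y \<le> b" for x y
    using integrable_subinterval_real[OF f, of x y] that by auto
  have nn: "0 \<le> integral {x..y} f" if "a \<le> x" "y \<le> b" for x y
    using that by (intro integral_nonneg sub nonneg) auto
  have "(\<Sum>i=1..n. integral {h i - r..h i + r} f) \<le> integral {a..h n + r} f" if "1 \<le> n" "n \<le> N" for n
    using that
  proof (induction n rule: dec_induct)
    case base
    have "integral {a..h 1 - r} f + integral {h 1 - r..h 1 + r} f = integral {a..h 1 + r} f"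
      using layer_bounds[of 1] N r(1)
      by (intro HK_integral_combine sub) auto
    then show ?case using nn[of a "h 1 - r"] layer_bounds[of 1] N r(1) by simp
  next
    case (step n)
    note b1 = layer_bounds[of n] and b2 = layer_bounds[of "Suc n"]
    have g: "h n + r \<le> h (Suc n) - r" using layer_gap[of n] step by simp
    have "integral {a..h n + r} f + integral {h n + r..h (Suc n) - r} f = integral {a..h (Suc n) - r} f"
      using b1 b2 g r(1) step by (intro HK_integral_combine sub) auto
    moreover have "integral {a..h (Suc n) - r} f + integral {h (Suc n) - r..h (Suc n) + r} f = integral {a..h (Suc n) + r} f"
      using b1 b2 g r(1) step by (intro HK_integral_combine sub) auto
    moreover have "0 \<le> integral {h n + r..h (Suc n) - r} f" using b1 b2 step r(1) by (intro nn) auto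
    moreover have "(\<Sum>i=1..Suc n. integral {h i - r..h i + r} f) = (\<Sum>i=1..n. integral {h i - r..h i + r} f) + integral {h (Suc n) - r..h (Suc n) + r} f"
      by simp
    ultimately show ?case using step by linarith
  qed
  from this[of N] have "(\<Sum>i=1..N. integral {h i - r..h i + r} f) \<le> integral {a..h N + r} f" using N by simp
  also have "\<dots> \<le> integral {a..b} f"
    by (intro integral_subset_le sub) (use r(4) nonneg in auto)
  finally show ?thesis .
qed

text \<open>If the primitives are close, \<open>z\<close> must come near the value of
  \<open>v\<close> at some point shortly before and some point shortly after each jump. Each of the
  disjoint intervals around the jumps then contains a complete layer with long tails, and the costs
  add up.\<close>

lemma GL_lower_bound:
  assumes W: "double_well W" and A: "0 < A" "A < r * sqrt (2 * min (deriv (deriv W) 1) (deriv (deriv W) (-1)))"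
  obtains \<delta> C where "0 < \<delta>" "0 \<le> C"
    "\<And>e z z'. \<lbrakk>0 < e; continuous_on {a..b} z';
      \<And>x. x \<in> {a..b} \<Longrightarrow> (z has_real_derivative z' x) (at x within {a..b}); L1dist a b (prim a z) (prim a v) < \<delta>\<rbrakk>
      \<Longrightarrow> N * integral {-1..1} (\<lambda>s. sqrt (2 * W s)) - C * exp (- A / e) \<le> GL W e z z' a b"
proof -
  \<comment> \<open>The half-width \<open>r\<close> is split into \<open>s\<close> for finding a
    point near the well and \<open>l\<close> for the tail. The proportion is chosen so that
    \<open>2 * l = 9 / 5 * r\<close> still exceeds \<open>sqrt 2 * r\<close>.\<close>
  define l s where "l = 9 / 10 * r" and "s = r / 10"
  let ?m = "min (deriv (deriv W) 1) (deriv (deriv W) (-1))"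
  have "sqrt 2 \<le> 9 / 5" by (rule real_le_lsqrt) (auto simp: power2_eq_square)
  have "0 \<le> sqrt ?m" using W by (auto simp: double_well_def)
  have "r * sqrt (2 * ?m) = r * (sqrt 2 * sqrt ?m)" by (simp add: real_sqrt_mult)
  also have "\<dots> \<le> r * (9 / 5 * sqrt ?m)"
    using r(1) \<open>sqrt 2 \<le> 9 / 5\<close> \<open>0 \<le> sqrt ?m\<close> by (intro mult_left_mono mult_right_mono) auto
  finally have A': "A < 2 * l * sqrt ?m" using A(2) by (simp add: l_def)
  obtain \<rho> C where \<rho>: "0 < \<rho>" "0 \<le> C"
    and layer: "\<And>e p x1 x2 q z z'. \<lbrakk>0 < e; p \<le> x1 - l; x1 \<le> x2; x2 + l \<le> q; continuous_on {p..q} z';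
      \<And>x. x \<in> {p..q} \<Longrightarrow> (z has_real_derivative z' x) (at x within {p..q});
      z x1 \<le> -1 + \<rho> \<and> 1 - \<rho> \<le> z x2 \<or> 1 - \<rho> \<le> z x1 \<and> z x2 \<le> -1 + \<rho>\<rbrakk>
      \<Longrightarrow> integral {-1..1} (\<lambda>s. sqrt (2 * W s)) - C * exp (- A / e) \<le> GL W e z z' p q"
    by (rule GL_layer[OF W A(1) A']) blast
  define \<delta> where "\<delta> = \<rho> * s\<^sup>2 / 6"
  have s: "0 < s" "s < r" "s + l = r" using r(1) by (auto simp: s_def l_def)
  have \<delta>: "0 < \<delta>" using \<rho> s by (simp add: \<delta>_def)
  have cW: "continuous_on UNIV W" using W C3_D(3) by (auto simp: double_well_def)
  have main: "N * integral {-1..1} (\<lambda>s. sqrt (2 * W s)) - (N * C) * exp (- A / e) \<le> GL W e z z' a b"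
    if e: "0 < e" and z': "continuous_on {a..b} z'"
      and z: "\<And>x. x \<in> {a..b} \<Longrightarrow> (z has_real_derivative z' x) (at x within {a..b})"
      and close: "L1dist a b (prim a z) (prim a v) < \<delta>"
    for e z z'
  proof -
    have zi: "z integrable_on {a..b}" using DERIV_continuous_on[OF z] by (rule integrable_continuous_real)
    \<comment> \<open>Without such a point, \<open>z\<close> and \<open>v\<close> would differ by at
      least \<open>\<rho>\<close> with one sign on an interval of length \<open>s\<close>, and
      \<open>L1dist_prim_ge\<close> would give a distance of at least
      \<open>\<delta>\<close>.\<close>
    have near: "\<exists>x. c < x \<and> x < c + s \<and> (if \<sigma> = 1 then 1 - \<rho> \<le> z x else z x \<le> -1 + \<rho>)"
      if c: "a \<le> c" "c + s \<le> b" and \<sigma>: "\<sigma> = 1 \<or> \<sigma> = -1" and v\<sigma>: "\<And>x. c < x \<Longrightarrow> x < c + s \<Longrightarrow> v x = \<sigma>" for c \<sigma>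
    proof (rule ccontr)
      assume neg: "\<not> ?thesis"
      have "\<delta> \<le> L1dist a b (prim a z) (prim a v)"
      proof (cases "\<sigma> = 1")
        case True
        have "\<rho> * (c + s - c)\<^sup>2 / 6 \<le> L1dist a b (prim a v) (prim a z)"
          by (rule L1dist_prim_ge[OF v_integrable zi]) (use c s \<rho> neg v\<sigma> True in \<open>force+\<close>)
        then show ?thesis by (simp add: \<delta>_def L1dist_commute[of a b "prim a z"])
      next
        case False
        have "\<rho> * (c + s - c)\<^sup>2 / 6 \<le> L1dist a b (prim a z) (prim a v)"
          by (rule L1dist_prim_ge[OF zi v_integrable]) (use c s \<rho> neg v\<sigma> \<sigma> False in \<open>force+\<close>)
        then show ?thesis by (simp add: \<delta>_def)
      qed
      then show False using close by simp
    qed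
    have one: "integral {-1..1} (\<lambda>s. sqrt (2 * W s)) - C * exp (- A / e) \<le> GL W e z z' (h i - r) (h i + r)"
      if i: "1 \<le> i" "i \<le> N" for i
    proof -
      obtain \<sigma> where \<sigma>: "\<sigma> = 1 \<or> \<sigma> = -1" "\<And>x. h i - r < x \<Longrightarrow> x < h i \<Longrightarrow> v x = - \<sigma>"
        "\<And>x. h i < x \<Longrightarrow> x < h i + r \<Longrightarrow> v x = \<sigma>" using v_layer[OF i] by metis
      note bd = layer_bounds[OF i]
      obtain x2 where x2: "h i < x2" "x2 < h i + s" "if \<sigma> = 1 then 1 - \<rho> \<le> z x2 else z x2 \<le> -1 + \<rho>"
        using near[of "h i" \<sigma>] \<sigma> s bd by auto
      obtain x1 where x1: "h i - s < x1" "x1 < h i" "if - \<sigma> = 1 then 1 - \<rho> \<le> z x1 else z x1 \<le> -1 + \<rho>"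
        using near[of "h i - s" "- \<sigma>"] \<sigma> s bd by auto
      show ?thesis
      proof (rule layer[OF e, of _ x1 x2])
        show "continuous_on {h i - r..h i + r} z'" by (rule continuous_on_subset[OF z']) (use bd in auto)
        show "(z has_real_derivative z' x) (at x within {h i - r..h i + r})" if "x \<in> {h i - r..h i + r}" for x
          by (rule has_field_derivative_subset[OF z]) (use bd that in auto)
        show "z x1 \<le> -1 + \<rho> \<and> 1 - \<rho> \<le> z x2 \<or> 1 - \<rho> \<le> z x1 \<and> z x2 \<le> -1 + \<rho>"
          using \<sigma>(1) x1(3) x2(3) by auto
      qed (use x1 x2 s in auto)
    qed
    have "N * (integral {-1..1} (\<lambda>s. sqrt (2 * W s)) - C * exp (- A / e)) = (\<Sum>i=1..N. integral {-1..1} (\<lambda>s. sqrt (2 * W s)) - C * exp (- A / e))"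
      by simp
    also have "\<dots> \<le> (\<Sum>i=1..N. GL W e z z' (h i - r) (h i + r))"
      by (intro sum_mono one) auto
    also have "\<dots> \<le> GL W e z z' a b"
      unfolding GL_def
      by (intro sum_layers_le GL_integrable[OF cW z' z e]) (use e double_well_nonneg[OF W] in auto)
    finally show ?thesis by (simp add: algebra_simps)
  qed
  show ?thesis by (rule that[of \<delta> "N * C"]) (use \<delta> \<rho> main in auto)
qed

end

section \<open>Slow motion\<close>

lemma L1dist_triangle:
  assumes "f absolutely_integrable_on {a..b}" "g absolutely_integrable_on {a..b}" "k absolutely_integrable_on {a..b}"
  shows "L1dist a b f k \<le> L1dist a b f g + L1dist a b g k"
proof -
  have i: "(\<lambda>x. \<bar>p x - q x\<bar>) integrable_on {a..b}"
    if "p absolutely_integrable_on {a..b}" "q absolutely_integrable_on {a..b}" for p q :: "real \<Rightarrow> real"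
    using set_integral_diff(1)[OF that] by (simp add: absolutely_integrable_on_def)
  have "L1dist a b f k \<le> integral {a..b} (\<lambda>x. \<bar>f x - g x\<bar> + \<bar>g x - k x\<bar>)"
    unfolding L1dist_def by (intro integral_le integrable_add i assms) auto
  also have "\<dots> = L1dist a b f g + L1dist a b g k"
    unfolding L1dist_def by (intro HK_integral_add i assms)
  finally show ?thesis .
qed

lemma L1dist_prim_le:
  assumes "f absolutely_integrable_on {a..b}" "g absolutely_integrable_on {a..b}" "a \<le> b"
  shows "L1dist a b (prim a f) (prim a g) \<le> (b - a) * L1dist a b f g"
proof -
  have fi: "f integrable_on {a..b}" "g integrable_on {a..b}" using assms by (auto simp: absolutely_integrable_on_def)
  have i: "(\<lambda>x. \<bar>f x - g x\<bar>) integrable_on {a..b}"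
    using set_integral_diff(1)[OF assms(1,2)] by (simp add: absolutely_integrable_on_def)
  have "L1dist a b (prim a f) (prim a g) \<le> integral {a..b} (\<lambda>x. L1dist a b f g)"
    unfolding L1dist_def[of a b "prim a f"]
  proof (rule integral_le)
    have "continuous_on {a..b} (prim a f)" "continuous_on {a..b} (prim a g)"
      unfolding prim_def using fi by (auto intro: indefinite_integral_continuous_1)
    then show "(\<lambda>x. \<bar>prim a f x - prim a g x\<bar>) integrable_on {a..b}"
      by (intro integrable_continuous_real continuous_intros)
    fix x assume x: "x \<in> {a..b}"
    have s: "f integrable_on {a..x}" "g integrable_on {a..x}" "(\<lambda>x. \<bar>f x - g x\<bar>) integrable_on {a..x}"
      using x by (auto intro: integrable_subinterval_real[OF fi(1)] integrable_subinterval_real[OF fi(2)] integrable_subinterval_real[OF i])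
    have "\<bar>prim a f x - prim a g x\<bar> = \<bar>integral {a..x} (\<lambda>x. f x - g x)\<bar>"
      unfolding prim_def using s by (simp add: HK_integral_diff)
    also have "\<dots> \<le> integral {a..x} (\<lambda>x. \<bar>f x - g x\<bar>)"
      using s by (intro integral_abs_bound_integral integrable_diff) auto
    also have "\<dots> \<le> L1dist a b f g" unfolding L1dist_def
      using x by (intro integral_subset_le s i) auto
    finally show "\<bar>prim a f x - prim a g x\<bar> \<le> L1dist a b f g" .
  qed auto
  then show ?thesis using assms(3) by simp
qed

context hyperbolic_Cahn_Hilliard_nonneg
begin

text \<open>Continuity in time: as long as \<open>U t\<close> is \<open>\<delta>\<close>-close to \<open>V\<close>, the energy bound from below limits the
  dissipation, hence the displacement, so that \<open>U t\<close> never comes near distance \<open>\<delta>\<close>.\<close>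

lemma slow_motion:
  assumes V: "continuous_on {a..b} V"
    and lower: "\<And>t. 0 \<le> t \<Longrightarrow> L1dist a b (U t) V < \<delta> \<Longrightarrow> c - k \<le> potential t"
    and E0: "en 0 \<le> c + g" and g: "0 \<le> g" "0 \<le> k" and T: "T * (g + k) \<le> M"
    and small: "L1dist a b (U 0) V + sqrt (b - a) * sqrt (eps * M) < \<delta>"
    and t: "0 \<le> t" "t \<le> T"
  shows "L1dist a b (U t) V \<le> L1dist a b (U 0) V + sqrt (b - a) * sqrt (eps * M)"
    and "en 0 - en t \<le> g + k"
proof -
  have close: "L1dist a b (U s) V \<le> L1dist a b (U 0) V + sqrt (b - a) * sqrt (eps * M) \<and> en 0 - en s \<le> g + k"
    if s: "0 \<le> s" "s \<le> t" and d: "L1dist a b (U s) V < \<delta>" for s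
  proof -
    have E: "en 0 - en s \<le> g + k" using lower[OF s(1) d] potential_le_energy[OF s(1)] E0 by linarith
    have "integral {a..b} (\<lambda>x. (U s x - U 0 x)\<^sup>2) \<le> s * eps * (en 0 - en s)" by (rule displacement_dissipation[OF s(1)])
    also have "\<dots> \<le> s * eps * (g + k)" using s eps E by (intro mult_left_mono) auto
    also have "\<dots> \<le> T * eps * (g + k)" using s t eps g by (intro mult_right_mono) auto
    also have "\<dots> \<le> eps * M" using T eps by (simp add: mult_ac)
    finally have "sqrt (b - a) * sqrt (integral {a..b} (\<lambda>x. (U s x - U 0 x)\<^sup>2)) \<le> sqrt (b - a) * sqrt (eps * M)"
      using ab by (intro mult_left_mono real_sqrt_le_mono) auto
    with L1dist_le_L2[OF continuous_U[OF s(1)] continuous_U[OF order_refl] less_imp_le[OF ab]]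
    have "L1dist a b (U s) (U 0) \<le> sqrt (b - a) * sqrt (eps * M)" by linarith
    moreover have "L1dist a b (U s) V \<le> L1dist a b (U s) (U 0) + L1dist a b (U 0) V"
      by (intro L1dist_triangle absolutely_integrable_continuous_real continuous_U V s order_refl)
    ultimately show ?thesis using E by linarith
  qed
  have "L1dist a b (U t) V < \<delta>"
  proof (rule ccontr)
    assume far: "\<not> L1dist a b (U t) V < \<delta>"
    \<comment> \<open>The distance stays at or below \<open>m\<close> whenever it is below
      \<open>\<delta>\<close>, so it cannot cross the gap: if it did, it would attain the midpoint
      \<open>(m + \<delta>) / 2\<close> at an earlier time.\<close>
    define m where "m = L1dist a b (U 0) V + sqrt (b - a) * sqrt (eps * M)"
    have "0 \<le> M"
    proof -
      have "0 \<le> T * (g + k)" using t g by (intro mult_nonneg_nonneg) auto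
      then show ?thesis using T by linarith
    qed
    then have m: "L1dist a b (U 0) V \<le> m" "m < \<delta>" using small ab eps by (auto simp: m_def)
    have "continuous_on {0..t} (\<lambda>t. L1dist a b (U t) V)"
      by (rule continuous_on_subset[OF continuous_L1dist_U[OF V]]) auto
    then obtain s where s: "0 \<le> s" "s \<le> t" "L1dist a b (U s) V = (m + \<delta>) / 2"
      using IVT'[of "\<lambda>t. L1dist a b (U t) V" 0 "(m + \<delta>) / 2" t] far m t by auto
    then have "L1dist a b (U s) V < \<delta>" using m by simp
    with close[OF s(1,2)] s(3) m show False by (simp add: m_def)
  qed
  from close[OF t(1) order_refl this]
  show "L1dist a b (U t) V \<le> L1dist a b (U 0) V + sqrt (b - a) * sqrt (eps * M)" "en 0 - en t \<le> g + k" by auto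
qed

text \<open>The initial energy \<open>c + 1 / F\<close> may be large when \<open>F\<close> is small; then the kinetic bound on the
  displacement is the better one.\<close>

lemma displacement_bound:
  assumes E0: "en 0 \<le> c + 1 / F" and c: "0 \<le> c" and F: "0 < F" and C: "0 \<le> C"
    and t: "0 \<le> t" "t \<le> p * F" and p: "0 \<le> p" "p \<le> 1"
    and E: "en 0 - en t \<le> 1 / F + k" "t * (1 / F + k) \<le> p * (1 + C)"
  shows "L1dist a b (\<lambda>x. u x t) (\<lambda>x. u x 0)
    \<le> sqrt (b - a) * sqrt (sqrt (p * (8 * (1 + C) * (c + 1) + 16 * (c + 1)\<^sup>2 / tau)))"
proof -
  define S where "S = integral {a..b} (\<lambda>x. (U t x - U 0 x)\<^sup>2)"
  have S0: "0 \<le> S" unfolding S_def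
    by (intro integral_nonneg integrable_continuous_real continuous_intros continuous_U t order_refl) auto
  have en0: "0 \<le> en 0" by (rule energy_nonneg) simp
  \<comment> \<open>The quantity under the root in the interpolation. The factor \<open>eps\<close>
    in either displacement bound cancels the \<open>1 / eps\<close> of the gradient bound, so that
    \<open>p\<close> is the only small factor left.\<close>
  have "S * (8 / eps * en 0) \<le> p * (8 * (1 + C) * (c + 1) + 16 * (c + 1)\<^sup>2 / tau)"
  proof (cases "1 \<le> F")
    case True
    then have "en 0 \<le> c + 1" using E0 F by (smt (verit) divide_le_eq_1_pos)
    have "S \<le> t * eps * (en 0 - en t)" unfolding S_def by (rule displacement_dissipation[OF t(1)])
    also have "\<dots> \<le> t * eps * (1 / F + k)" using E(1) t eps by (intro mult_left_mono) auto
    also have "\<dots> = eps * (t * (1 / F + k))" by simp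
    also have "\<dots> \<le> eps * (p * (1 + C))" using E(2) eps by (intro mult_left_mono) auto
    finally have "S * (8 / eps * en 0) \<le> eps * (p * (1 + C)) * (8 / eps * (c + 1))"
      using \<open>en 0 \<le> c + 1\<close> eps p C c en0 by (intro mult_mono) auto
    also have "\<dots> = p * (8 * (1 + C) * (c + 1))" using eps by (simp add: field_simps)
    also have "\<dots> \<le> p * (8 * (1 + C) * (c + 1) + 16 * (c + 1)\<^sup>2 / tau)"
      using p tau by (intro mult_left_mono) auto
    finally show ?thesis .
  next
    case False
    \<comment> \<open>The initial energy may be of size \<open>1 / F\<close>, but
      \<open>t \<le> p * F\<close> compensates for it.\<close>
    have "t * en 0 \<le> (p * F) * (c + 1 / F)" using t E0 c F en0 p by (intro mult_mono) auto
    also have "\<dots> = p * (F * c + 1)" using F by (simp add: field_simps)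
    also have "\<dots> \<le> p * (c + 1)"
      using p False F c mult_right_mono[of F 1 c] by (intro mult_left_mono) auto
    finally have te: "t * en 0 \<le> p * (c + 1)" .
    have "S * (8 / eps * en 0) \<le> t\<^sup>2 * (2 * eps / tau * en 0) * (8 / eps * en 0)"
      unfolding S_def using displacement_kinetic[OF t(1)] eps en0 by (intro mult_right_mono) auto
    also have "\<dots> = 16 / tau * (t * en 0)\<^sup>2" using eps tau by (simp add: power2_eq_square field_simps)
    also have "\<dots> \<le> 16 / tau * (p * (c + 1))\<^sup>2"
      using te t en0 tau by (intro mult_left_mono power_mono) auto
    also have "\<dots> = (p * p) * (16 * (c + 1)\<^sup>2 / tau)" by (simp add: power2_eq_square)
    also have "\<dots> \<le> p * (16 * (c + 1)\<^sup>2 / tau)"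
      using p tau mult_left_mono[of p 1 p] by (intro mult_right_mono) auto
    also have "\<dots> \<le> p * (8 * (1 + C) * (c + 1) + 16 * (c + 1)\<^sup>2 / tau)"
      using p c C by (intro mult_left_mono) auto
    finally show ?thesis .
  qed
  then have "sqrt S * sqrt (8 / eps * en 0) \<le> sqrt (p * (8 * (1 + C) * (c + 1) + 16 * (c + 1)\<^sup>2 / tau))"
    by (simp add: real_sqrt_mult[symmetric])
  with displacement_interpolation[OF t(1)]
  have "integral {a..b} (\<lambda>x. (u x t - u x 0)\<^sup>2) \<le> sqrt (p * (8 * (1 + C) * (c + 1) + 16 * (c + 1)\<^sup>2 / tau))"
    unfolding S_def by linarith
  then have "sqrt (b - a) * sqrt (integral {a..b} (\<lambda>x. (u x t - u x 0)\<^sup>2))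
     \<le> sqrt (b - a) * sqrt (sqrt (p * (8 * (1 + C) * (c + 1) + 16 * (c + 1)\<^sup>2 / tau)))"
    using ab by (intro mult_left_mono real_sqrt_le_mono) auto
  with L1dist_le_L2[OF continuous_u[OF t(1)] continuous_u[OF order_refl] less_imp_le[OF ab]]
  show ?thesis by linarith
qed

end

theorem theorem2p8:
  fixes a b tau r A :: real and W v f :: "real \<Rightarrow> real" and N :: nat and h :: "nat \<Rightarrow> real"
    and u ux uxx ut :: "real \<Rightarrow> real \<Rightarrow> real \<Rightarrow> real"
  assumes ab: "a < b" and tau: "tau > 0"
    and W: "C3 W" "W 1 = 0" "W (-1) = 0" "deriv W 1 = 0" "deriv W (-1) = 0"
      "deriv (deriv W) 1 > 0" "deriv (deriv W) (-1) > 0"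
      "\<forall>s. s \<noteq> 1 \<and> s \<noteq> -1 \<longrightarrow> W s > 0"
    and N: "N \<ge> 1"
    and h: "a < h 1" "\<forall>i. 1 \<le> i \<and> i < N \<longrightarrow> h i < h (Suc i)" "h N < b"
    and v_vals: "\<forall>x\<in>{a..b}. v x = 1 \<or> v x = -1"
    and v_const: "\<forall>i\<le>N. \<forall>x y. x \<in> {node a b N h i<..<node a b N h (Suc i)}
                    \<longrightarrow> y \<in> {node a b N h i<..<node a b N h (Suc i)} \<longrightarrow> v x = v y"
    and v_jump: "\<forall>i. 1 \<le> i \<and> i \<le> N \<longrightarrow> (\<forall>x y. x \<in> {node a b N h (i - 1)<..<node a b N h i}
                    \<longrightarrow> y \<in> {node a b N h i<..<node a b N h (Suc i)} \<longrightarrow> v x \<noteq> v y)"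
    and r: "r > 0"
      "\<forall>i j. 1 \<le> i \<and> i < j \<and> j \<le> N \<longrightarrow> {h i - r<..<h i + r} \<inter> {h j - r<..<h j + r} = {}"
      "a \<le> h 1 - r" "h N + r \<le> b"
    and A: "0 < A" "A < r * sqrt (2 * min (deriv (deriv W) 1) (deriv (deriv W) (-1)))"
    and f: "\<forall>e>0. f e > 0"
    and sol: "\<forall>e>0. solution tau W e a b (u e) (ux e) (uxx e) (ut e)"
    and init_L1: "((\<lambda>e. L1dist a b (\<lambda>x. u e x 0) v) \<longlongrightarrow> 0) (at_right 0)"
    and init_mass: "\<forall>e>0. integral {a..b} (\<lambda>y. ut e y 0) = 0"
    and init_energy: "\<forall>\<^sub>F e in at_right 0.
        energy tau W a b e (\<lambda>x. u e x 0) (\<lambda>x. ux e x 0) (prim a (\<lambda>x. ut e x 0))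
          \<le> real N * integral {-1..1} (\<lambda>s. sqrt (2 * W s)) + 1 / f e"
  shows "(\<forall>\<delta>>0. \<forall>\<^sub>F e in at_right 0. \<forall>t\<in>{0..min (f e) (exp (A / e))}.
            L1dist a b (prim a (\<lambda>x. u e x t)) (prim a v) \<le> \<delta>)
       \<and> (\<forall>\<eta>. 0 < \<eta> \<and> \<eta> < 1 \<longrightarrow> (\<forall>\<delta>>0. \<forall>\<^sub>F e in at_right 0.
            \<forall>t\<in>{0..e powr \<eta> * min (f e) (exp (A / e))}. L1dist a b (\<lambda>x. u e x t) v \<le> \<delta>))"
proof -
  have dw: "double_well W" using W unfolding double_well_def by blast
  interpret J: jump_profile a b r v N h
    using ab N h v_vals v_const v_jump r by unfold_locales
  define c where "c = real N * integral {-1..1} (\<lambda>s. sqrt (2 * W s))"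
  have "continuous_on {-1..1} (\<lambda>s. sqrt (2 * W s))" by (intro continuous_intros C3_D(3)[OF W(1)])
  then have c0: "0 \<le> c"
    unfolding c_def using double_well_nonneg[OF dw]
    by (intro mult_nonneg_nonneg integral_nonneg integrable_continuous_real) auto
  obtain \<delta>0 C where \<delta>0: "0 < \<delta>0" and C: "0 \<le> C"
    and lower: "\<And>e z z'. \<lbrakk>0 < e; continuous_on {a..b} z';
      \<And>x. x \<in> {a..b} \<Longrightarrow> (z has_real_derivative z' x) (at x within {a..b}); L1dist a b (prim a z) (prim a v) < \<delta>0\<rbrakk>
      \<Longrightarrow> c - C * exp (- A / e) \<le> GL W e z z' a b"
    unfolding c_def by (rule J.GL_lower_bound[OF dw A]) blast
  have cV: "continuous_on {a..b} (prim a v)"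
    unfolding prim_def by (rule indefinite_integral_continuous_1[OF J.v_integrable])
  define T where "T e = min (f e) (exp (A / e))" for e
  define d where "d e = L1dist a b (\<lambda>x. u e x 0) v" for e
  define Q where "Q = 8 * (1 + C) * (c + 1) + 16 * (c + 1)\<^sup>2 / tau"
  \<comment> \<open>The initial distance of the primitives plus their displacement up to
    \<open>T e\<close>; \<open>1 + C\<close> bounds \<open>T e\<close> times the energy available
    for dissipation.\<close>
  define B1 where "B1 e = (b - a) * d e + sqrt (b - a) * sqrt (e * (1 + C))" for e
  have d_lim: "(d \<longlongrightarrow> 0) (at_right 0)" unfolding d_def by (rule init_L1)
  have B1_lim: "(B1 \<longlongrightarrow> 0) (at_right 0)"
    unfolding B1_def using d_lim by (auto intro!: tendsto_eq_intros)
  have sol_e: "hyperbolic_Cahn_Hilliard_nonneg tau e a b W (u e) (ux e) (uxx e) (ut e)" if "0 < e" for e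
    using that ab tau W(1) sol init_mass double_well_nonneg[OF dw] by unfold_locales auto
  \<comment> \<open>The fraction \<open>p\<close> of the horizon stays free here; it becomes
    \<open>e powr \<eta>\<close> in the second claim.\<close>
  have main: "L1dist a b (prim a (\<lambda>x. u e x t)) (prim a v) \<le> B1 e"
    "0 \<le> p \<Longrightarrow> p \<le> 1 \<Longrightarrow> t \<le> p * T e \<Longrightarrow>
      L1dist a b (\<lambda>x. u e x t) v \<le> sqrt (b - a) * sqrt (sqrt (p * Q)) + d e"
    if e: "0 < e" and small: "B1 e < \<delta>0" and t: "0 \<le> t" "t \<le> T e"
      and E0: "energy tau W a b e (\<lambda>x. u e x 0) (\<lambda>x. ux e x 0) (prim a (\<lambda>x. ut e x 0)) \<le> c + 1 / f e" for e t p
  proof -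
    interpret S: hyperbolic_Cahn_Hilliard_nonneg tau e a b W "u e" "ux e" "uxx e" "ut e" by (rule sol_e[OF e])
    define k where "k = C * exp (- A / e)"
    have F: "0 < f e" using f e by blast
    have k: "0 \<le> k" using C by (simp add: k_def)
    \<comment> \<open>Each argument of the minimum controls one part of the energy gap:
      \<open>f e\<close> the initial excess \<open>1 / f e\<close>, and \<open>exp (A / e)\<close>
      the possible saving \<open>k\<close> in the tails.\<close>
    have "T e * (1 / f e) \<le> 1" using F by (simp add: T_def)
    moreover have "T e * k \<le> C"
    proof -
      have "T e * k \<le> exp (A / e) * k" using k by (intro mult_right_mono) (auto simp: T_def)
      also have "\<dots> = C" by (simp add: k_def exp_minus)
      finally show ?thesis .
    qed
    ultimately have TM: "T e * (1 / f e + k) \<le> 1 + C" by (simp add: distrib_left)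
    have lo: "c - k \<le> S.potential s" if "0 \<le> s" "L1dist a b (S.U s) (prim a v) < \<delta>0" for s
    proof -
      have "c - C * exp (- A / e) \<le> GL W e (\<lambda>x. u e x s) (\<lambda>x. ux e x s) a b"
        using that by (intro lower e S.continuous_ux S.du_x) (auto simp: S.U_def)
      then show ?thesis by (simp add: S.potential_def GL_def k_def)
    qed
    have E0': "S.en 0 \<le> c + 1 / f e" using E0 unfolding S.en_def S.w_def .
    have u0: "(\<lambda>x. u e x s) absolutely_integrable_on {a..b}" if "0 \<le> s" for s
      by (intro absolutely_integrable_continuous_real S.continuous_u that)
    have U0: "L1dist a b (S.U 0) (prim a v) + sqrt (b - a) * sqrt (e * (1 + C)) \<le> B1 e"
      unfolding S.U_def B1_def d_def
      using L1dist_prim_le[OF u0[OF order_refl] J.v_absolutely_integrable] ab by simp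
    note sm = S.slow_motion[OF cV lo E0' _ k TM _ t]
    have sm1: "L1dist a b (S.U t) (prim a v) \<le> L1dist a b (S.U 0) (prim a v) + sqrt (b - a) * sqrt (e * (1 + C))"
      and sm2: "S.en 0 - S.en t \<le> 1 / f e + k"
      using sm U0 small F by auto
    show "L1dist a b (prim a (\<lambda>x. u e x t)) (prim a v) \<le> B1 e"
      using sm1 U0 unfolding S.U_def by linarith
    assume p: "0 \<le> p" "p \<le> 1" and tp: "t \<le> p * T e"
    have "t \<le> p * f e"
      using tp p(1) mult_left_mono[of "T e" "f e" p] by (simp add: T_def)
    moreover have "t * (1 / f e + k) \<le> p * (1 + C)"
    proof -
      have "t * (1 / f e + k) \<le> (p * T e) * (1 / f e + k)" using tp F k by (intro mult_right_mono) auto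
      also have "\<dots> = p * (T e * (1 / f e + k))" by simp
      also have "\<dots> \<le> p * (1 + C)" using TM p(1) by (rule mult_left_mono)
      finally show ?thesis .
    qed
    ultimately have "L1dist a b (\<lambda>x. u e x t) (\<lambda>x. u e x 0) \<le> sqrt (b - a) * sqrt (sqrt (p * Q))"
      unfolding Q_def using S.displacement_bound[OF E0' c0 F C t(1) _ p sm2] by blast
    moreover have "L1dist a b (\<lambda>x. u e x t) v \<le> L1dist a b (\<lambda>x. u e x t) (\<lambda>x. u e x 0) + d e"
      unfolding d_def by (intro L1dist_triangle u0 J.v_absolutely_integrable t order_refl)
    ultimately show "L1dist a b (\<lambda>x. u e x t) v \<le> sqrt (b - a) * sqrt (sqrt (p * Q)) + d e" by linarith
  qed
  have ev: "\<forall>\<^sub>F e in at_right 0. 0 < e \<and> e < 1 \<and> B1 e < \<delta>0 \<and>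
      energy tau W a b e (\<lambda>x. u e x 0) (\<lambda>x. ux e x 0) (prim a (\<lambda>x. ut e x 0)) \<le> c + 1 / f e"
    using order_tendstoD(2)[OF B1_lim \<delta>0] init_energy eventually_at_right_less[of "0::real"]
      eventually_at_rightI[of 0 1 "\<lambda>e::real. e < 1"]
    unfolding c_def[symmetric] by (auto elim!: eventually_elim2 intro!: eventually_conj)
  show ?thesis
  proof (intro conjI allI impI)
    fix \<delta> :: real assume "0 < \<delta>"
    from order_tendstoD(2)[OF B1_lim this] ev
    show "\<forall>\<^sub>F e in at_right 0. \<forall>t\<in>{0..min (f e) (exp (A / e))}. L1dist a b (prim a (\<lambda>x. u e x t)) (prim a v) \<le> \<delta>"
    proof eventually_elim
      case (elim e)
      show ?case
      proof
        fix t assume "t \<in> {0..min (f e) (exp (A / e))}"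
        then have "L1dist a b (prim a (\<lambda>x. u e x t)) (prim a v) \<le> B1 e"
          using elim by (intro main(1)) (auto simp: T_def)
        then show "L1dist a b (prim a (\<lambda>x. u e x t)) (prim a v) \<le> \<delta>" using elim by linarith
      qed
    qed
  next
    fix \<eta> \<delta> :: real assume \<eta>: "0 < \<eta> \<and> \<eta> < 1" and "0 < \<delta>"
    \<comment> \<open>The time factor enters through a fourth root: one square root comes from the
      interpolation of the squared norm, the other from passing to the norm itself.\<close>
    have "((\<lambda>e. e powr \<eta>) \<longlongrightarrow> 0) (at_right 0)"
      by (rule tendsto_zero_powrI[of _ _ _ \<eta>]) (use \<eta> eventually_at_right_less[of "0::real"] in \<open>auto elim: eventually_mono\<close>)
    then have "((\<lambda>e. sqrt (b - a) * sqrt (sqrt (e powr \<eta> * Q)) + d e) \<longlongrightarrow> sqrt (b - a) * sqrt (sqrt (0 * Q)) + 0) (at_right 0)"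
      by (intro tendsto_add tendsto_mult_left tendsto_mult_right tendsto_real_sqrt d_lim)
    then have "((\<lambda>e. sqrt (b - a) * sqrt (sqrt (e powr \<eta> * Q)) + d e) \<longlongrightarrow> 0) (at_right 0)" by simp
    from order_tendstoD(2)[OF this \<open>0 < \<delta>\<close>] ev
    show "\<forall>\<^sub>F e in at_right 0. \<forall>t\<in>{0..e powr \<eta> * min (f e) (exp (A / e))}. L1dist a b (\<lambda>x. u e x t) v \<le> \<delta>"
    proof eventually_elim
      case (elim e)
      have p: "0 \<le> e powr \<eta>" "e powr \<eta> \<le> 1" using elim \<eta> by (auto intro: powr_le1)
      have T0: "0 \<le> T e" using f elim by (auto simp: T_def less_imp_le)
      show ?case
      proof
        fix t assume "t \<in> {0..e powr \<eta> * min (f e) (exp (A / e))}"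
        then have t: "0 \<le> t" "t \<le> e powr \<eta> * T e" by (auto simp: T_def)
        then have "t \<le> T e" using mult_right_mono[OF p(2) T0] by simp
        then have "L1dist a b (\<lambda>x. u e x t) v \<le> sqrt (b - a) * sqrt (sqrt (e powr \<eta> * Q)) + d e"
          using elim t p by (intro main(2)) auto
        then show "L1dist a b (\<lambda>x. u e x t) v \<le> \<delta>" using elim by linarith
      qed
    qed
  qed
qed

end
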